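(* Let $\nu$ be a complex number such that $\Re\nu>0$. Then the following three identities hold for every complex number $z$: $$e^{\frac{z^2}{2}}D_{-\nu}(z)^2=\frac{2^{2\nu}}{\Gamma(2\nu)}\int_0^{+\infty}x^{2\nu-1}e^{-2zx-2x^2}\,\Phi\left(\nu,\nu+\tfrac12;x^2\right)dx,$$ $$e^{\frac{z^2}{2}}D_{-\nu}(z)D_{-\nu}(-z)=\frac{2}{\Gamma(\nu)}\int_0^{+\infty}\cosh(2zx)\,x^{2\nu-1}e^{-2x^2}\,\Psi\left(\nu,\nu+\tfrac12;x^2\right)dx,$$ $$e^{-\frac{z^2}{2}}D_{-\nu}(z)D_{-\nu}(-z)=\frac{2}{\Gamma(\nu+\frac12)}\int_0^{+\infty}\cos(2zx)\,e^{-2x^2}\,\Phi\left(\tfrac12,\nu+\tfrac12;x^2\right)dx.$$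
   Context: $\Phi$ is Kummer's confluent hypergeometric function of the first kind, $\Phi(\nu,\mu;z)=\sum_{n=0}^{\infty}\frac{(\nu)_n}{(\mu)_n}\frac{z^n}{n!}$, where $(\nu)_n=\nu(\nu+1)\cdots(\nu+n-1)$. $\Psi$ is the confluent hypergeometric function of the second kind, $$\Psi(\nu,\mu;z)=\frac{\Gamma(1-\mu)}{\Gamma(\nu+1-\mu)}\Phi(\nu,\mu;z)+\frac{\Gamma(\mu-1)}{\Gamma(\nu)}z^{1-\mu}\Phi(\nu+1-\mu,2-\mu;z),$$ understood as the limit in $\mu$ when $\mu$ is an integer; for $\Re\nu>0$ and $\Re z>0$ it equals $\frac{1}{\Gamma(\nu)}\int_0^\infty e^{-zt}t^{\nu-1}(1+t)^{\mu-\nu-1}dt$. $D_\nu$ is the parabolic cylinder function, the entire function of $z\in\mathbb{C}$ (and of $\nu\in\mathbb{C}$) defined by $$D_\nu(z)=2^{\nu/2}e^{-z^2/4}\left(\frac{\sqrt{\pi}}{\Gamma(\frac12-\frac{\nu}{2})}\Phi\left(-\tfrac{\nu}{2},\tfrac12;\tfrac{z^2}{2}\right)-\frac{\sqrt{2\pi}\,z}{\Gamma(-\frac{\nu}{2})}\Phi\left(\tfrac12-\tfrac{\nu}{2},\tfrac32;\tfrac{z^2}{2}\right)\right),$$ with $1/\Gamma$ taken to be $0$ at the poles of $\Gamma$. *)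

theory Defs
  imports "HOL-Analysis.Analysis"
begin

definition kummer_Phi :: "complex \<Rightarrow> complex \<Rightarrow> complex \<Rightarrow> complex" where
  "kummer_Phi \<nu> \<mu> z = (\<Sum>n. pochhammer \<nu> n / pochhammer \<mu> n * z ^ n / fact n)"

text \<open>
  \<^const>\<open>rGamma\<close> is the entire function \<open>1 / \<Gamma>\<close>, so it vanishes at the poles
  of \<open>\<Gamma>\<close>. The powers of \<open>z\<close> and of \<open>2\<close> below are principal ones.
\<close>

definition kummer_Psi_nonint :: "complex \<Rightarrow> complex \<Rightarrow> complex \<Rightarrow> complex" where
  "kummer_Psi_nonint \<nu> \<mu> z =
     Gamma (1 - \<mu>) * rGamma (\<nu> + 1 - \<mu>) * kummer_Phi \<nu> \<mu> z
     + Gamma (\<mu> - 1) * rGamma \<nu> * z powr (1 - \<mu>) * kummer_Phi (\<nu> + 1 - \<mu>) (2 - \<mu>) z"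

definition kummer_Psi :: "complex \<Rightarrow> complex \<Rightarrow> complex \<Rightarrow> complex" where
  "kummer_Psi \<nu> \<mu> z =
     (if \<mu> \<in> \<int> then Lim (at \<mu>) (\<lambda>m. kummer_Psi_nonint \<nu> m z)
      else kummer_Psi_nonint \<nu> \<mu> z)"

definition parabolic_cylinder_D :: "complex \<Rightarrow> complex \<Rightarrow> complex" where
  "parabolic_cylinder_D \<nu> z =
     2 powr (\<nu> / 2) * exp (- (z\<^sup>2 / 4)) *
     (complex_of_real (sqrt pi) * rGamma (1 / 2 - \<nu> / 2) * kummer_Phi (- (\<nu> / 2)) (1 / 2) (z\<^sup>2 / 2)
      - complex_of_real (sqrt (2 * pi)) * z * rGamma (- (\<nu> / 2))
        * kummer_Phi (1 / 2 - \<nu> / 2) (3 / 2) (z\<^sup>2 / 2))"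

end

theory Submission
  imports Defs "HOL-Real_Asymp.Real_Asymp"
begin

text \<open>
  The function \<open>\<Gamma>(\<nu>) e\<^bsup>z\<^sup>2/4\<^esup> D\<^bsub>-\<nu>\<^esub>(z)\<close> equals \<open>J(z) = \<integral> x\<^bsup>\<nu>-1\<^esup> e\<^bsup>-zx-x\<^sup>2/2\<^esup> dx\<close>, as one sees by expanding \<open>e\<^bsup>-zx\<^esup>\<close>.
  The first two identities arise from \<open>J(z) J(\<plusminus>z)\<close> by the rotation \<open>x = u + v\<close>, \<open>y = \<plusminus>(u - v)\<close>:
  after the substitution \<open>v\<^sup>2 = u\<^sup>2(1 \<mp> t)\<close> the inner integral is the Euler integral of \<open>\<Phi>\<close> in the
  first case and the Laplace integral of \<open>\<Psi>\<close> in the second. For the third identity, the Laplace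
  integral is transformed by \<open>\<Psi>(a,b;w) = w\<^bsup>1-b\<^esup> \<Psi>(a+1-b,2-b;w)\<close>; then both sides are Gaussian
  mixtures, and they are matched by the substitution \<open>s = t/(1+t)\<close>.

  The Laplace integral for \<open>\<Psi>\<close> is derived from its definition through \<open>\<Phi>\<close>: the integral solves
  Kummer's equation, so its Wronskians with the two solutions at \<open>0\<close>, suitably weighted, are
  constants, which are read off as \<open>z \<rightarrow> 0\<close> in the strip \<open>0 < Re b \<le> 1\<close>. The rule
  \<open>\<Psi>(a,b+1;z) = \<Psi>(a,b;z) - \<Psi>'(a,b;z)\<close> extends the result to \<open>Re b > 0\<close>, and continuity in \<open>b\<close>
  covers integral \<open>b\<close>.
\<close>

section \<open>Integration\<close>

text \<open>For integer \<open>\<mu>\<close> the definition of \<open>kummer_Psi\<close> is a limit,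
  and \<open>\<nu> + 1 / 2\<close> is an integer whenever \<open>\<nu>\<close> is half an odd
  integer; so the Laplace integral has to be known for integer \<open>b\<close> as well. Near 0 the
  Laplace integral F behaves like C + D z^(1-b), and C and D are the two connection coefficients.
  One Wronskian is taken against each solution in order to separate them: the weight z^b isolates D,
  and the operator (1-b) - z d/dz, which annihilates z^(1-b), isolates C. The bound Re b <= 1 serves
  to see that z F(z) tends to 0. In the third identity the change from exp(z^2/2) to exp(-z^2/2)
  comes from the last substitution: 2 - s = (2+t)/(1+t), hence z^2/(2-s) = z^2 - z^2/(2+t), which
  splits off the factor exp(-z^2).\<close>

text \<open>The library rule concerns absolute integrability for the completed measure. Openness and
  continuity make both integrands Borel measurable, so that integrability and value transfer to
  \<open>lborel\<close>.\<close>

lemma set_integral_change_of_variables_real: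
  fixes f :: "real \<Rightarrow> complex" and g h :: "real \<Rightarrow> real"
  assumes "open S" "open T" "g ` S = T" "inj_on g S"
    and deriv: "\<And>x. x \<in> S \<Longrightarrow> (g has_real_derivative h x) (at x)"
    and "continuous_on S h" "continuous_on T f"
  shows "set_integrable lborel T f \<longleftrightarrow> set_integrable lborel S (\<lambda>x. \<bar>h x\<bar> *\<^sub>R f (g x))"
    and "(LBINT x:T. f x) = (LBINT x:S. \<bar>h x\<bar> *\<^sub>R f (g x))"
proof -
  have contg: "continuous_on S g"
    using deriv by (meson DERIV_continuous continuous_at_imp_continuous_on)
  have "continuous_on S (\<lambda>x. f (g x))"
    by (rule continuous_on_compose2[OF assms(7) contg]) (use assms(3) in auto)
  then have cont: "continuous_on S (\<lambda>x. \<bar>h x\<bar> *\<^sub>R f (g x))"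
    using assms(6) by (intro continuous_intros)
  have mS: "(\<lambda>x. indicator S x *\<^sub>R (\<bar>h x\<bar> *\<^sub>R f (g x))) \<in> borel_measurable lborel"
    using borel_measurable_continuous_on_indicator[OF borel_open[OF assms(1)] cont] by simp
  have mT: "(\<lambda>x. indicator T x *\<^sub>R f x) \<in> borel_measurable lborel"
    using assms(2,7) by (auto intro: borel_measurable_continuous_on_indicator)
  have iS: "set_integrable lebesgue S (\<lambda>x. \<bar>h x\<bar> *\<^sub>R f (g x))
      \<longleftrightarrow> set_integrable lborel S (\<lambda>x. \<bar>h x\<bar> *\<^sub>R f (g x))"
    using mS unfolding set_integrable_def by (rule integrable_completion)
  have iT: "set_integrable lebesgue T f \<longleftrightarrow> set_integrable lborel T f"
    using mT unfolding set_integrable_def by (rule integrable_completion)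
  have lS: "S \<in> sets lebesgue" using assms(1) by auto
  have d: "\<And>x. x \<in> S \<Longrightarrow> (g has_real_derivative h x) (at x within S)"
    using deriv by (blast intro: has_field_derivative_at_within)
  have iff: "set_integrable lebesgue T f \<longleftrightarrow> set_integrable lebesgue S (\<lambda>x. \<bar>h x\<bar> *\<^sub>R f (g x))"
    using absolutely_integrable_change_of_variables_real[OF lS d assms(4), of f] assms(3) by simp
  then show int: "set_integrable lborel T f
      \<longleftrightarrow> set_integrable lborel S (\<lambda>x. \<bar>h x\<bar> *\<^sub>R f (g x))"
    using iS iT by simp
  show "(LBINT x:T. f x) = (LBINT x:S. \<bar>h x\<bar> *\<^sub>R f (g x))"
  proof (cases "set_integrable lborel T f")
    case True
    with int have *: "set_integrable lborel S (\<lambda>x. \<bar>h x\<bar> *\<^sub>R f (g x))" by simp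
    have "integral T f = integral S (\<lambda>x. \<bar>h x\<bar> *\<^sub>R f (g x))"
      using has_absolute_integral_change_of_variables_real
          [OF lS d assms(4), of f "integral S (\<lambda>x. \<bar>h x\<bar> *\<^sub>R f (g x))"]
        assms(3) * iS by simp
    then show ?thesis
      using set_borel_integral_eq_integral(2)[OF True] set_borel_integral_eq_integral(2)[OF *] by simp
  next
    \<comment> \<open>Neither side is integrable, so both integrals have the default value
      0.\<close>
    case False
    with int show ?thesis
      unfolding set_integrable_def set_lebesgue_integral_def by (simp add: not_integrable_integral_eq)
  qed
qed

lemma set_integral_scale_Ioi:
  fixes f :: "real \<Rightarrow> complex"
  assumes c: "c > 0" and f: "continuous_on {0<..} f"
  shows "set_integrable lborel {0<..} f \<longleftrightarrow> set_integrable lborel {0<..} (\<lambda>x. of_real c * f (c * x))"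
    and "(LBINT x:{0<..}. f x) = (LBINT x:{0<..}. of_real c * f (c * x))"
proof -
  have "y \<in> (\<lambda>t. c * t) ` {0<..}" if "y > 0" for y
    using c that by (intro image_eqI[of _ _ "y / c"]) auto
  then have img: "(\<lambda>t. c * t) ` {0<..} = {0<..}" using c by auto
  have inj: "inj_on (\<lambda>t. c * t) {0<..}" using c by (auto simp: inj_on_def)
  have der: "((\<lambda>t. c * t) has_real_derivative c) (at t)" for t
    by (auto intro!: derivative_eq_intros)
  note sub = set_integral_change_of_variables_real[OF open_greaterThan open_greaterThan img inj der
      continuous_on_const f]
  have eq: "\<bar>c\<bar> *\<^sub>R f (c * x) = of_real c * f (c * x)" for x
    using c by (simp add: scaleR_conv_of_real)
  show "set_integrable lborel {0<..} f \<longleftrightarrow> set_integrable lborel {0<..} (\<lambda>x. of_real c * f (c * x))"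
    using sub(1) unfolding eq .
  show "(LBINT x:{0<..}. f x) = (LBINT x:{0<..}. of_real c * f (c * x))"
    using sub(2) unfolding eq .
qed

text \<open>The substitution s = t/(1+t), for which 1 - s = 1/(1+t). It leads from the half-line
  Beta integral to the one on the unit interval, and it also matches the two mixtures in the third
  identity.\<close>

lemma set_integral_rational_substitution:
  fixes f :: "real \<Rightarrow> complex"
  assumes f: "continuous_on {0<..<1} f"
  shows "set_integrable lborel {0<..<1} f
      \<longleftrightarrow> set_integrable lborel {0<..} (\<lambda>t. of_real (1 / (1 + t)\<^sup>2) * f (t / (1 + t)))"
    and "(LBINT s:{0<..<1}. f s) = (LBINT t:{0<..}. of_real (1 / (1 + t)\<^sup>2) * f (t / (1 + t)))"
proof -
  let ?g = "\<lambda>t::real. t / (1 + t)" and ?h = "\<lambda>t::real. 1 / (1 + t)\<^sup>2"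
  have "x \<in> ?g ` {0<..}" if "0 < x" "x < 1" for x
    using that by (intro image_eqI[of _ _ "x / (1 - x)"]) (auto simp: field_simps)
  then have img: "?g ` {0<..} = {0<..<1}" by (auto simp: field_simps)
  have inj: "inj_on ?g {0<..}" by (auto simp: inj_on_def field_simps)
  have der: "(?g has_real_derivative ?h t) (at t)" if "t \<in> {0<..}" for t
    using that by (auto intro!: derivative_eq_intros simp: power2_eq_square field_simps)
  have h: "continuous_on {0<..} ?h" by (auto intro!: continuous_intros)
  note sub = set_integral_change_of_variables_real
    [OF open_greaterThan open_greaterThanLessThan img inj der h f]
  have eq: "\<bar>?h t\<bar> *\<^sub>R f (?g t) = of_real (?h t) * f (?g t)" for t
    by (simp add: scaleR_conv_of_real)
  show "set_integrable lborel {0<..<1} f \<longleftrightarrow> set_integrable lborel {0<..} (\<lambda>t. of_real (?h t) * f (?g t))"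
    using sub(1) unfolding eq .
  show "(LBINT s:{0<..<1}. f s) = (LBINT t:{0<..}. of_real (?h t) * f (?g t))"
    using sub(2) unfolding eq .
qed

text \<open>Every partial sum of the exponential series of z h(x) is bounded by exp(|z| |h(x)|), so
  dominated convergence applies to the partial sums. This turns moments into power series: for
  Euler's integral of Kummer's function, for analyticity of Tricomi's integral, and for the
  expansion of \<open>cylinder_integral\<close>.\<close>

lemma set_integral_exp_sums:
  fixes h :: "'a \<Rightarrow> real" and g :: "'a \<Rightarrow> complex" and z :: complex
  assumes int: "set_integrable M A (\<lambda>x. exp (norm z * \<bar>h x\<bar>) *\<^sub>R g x)"
    and h: "set_borel_measurable M A h" and A: "A \<in> sets M"
  shows "(\<lambda>n. z ^ n / fact n * (LINT x:A|M. of_real (h x) ^ n * g x)) sums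
           (LINT x:A|M. exp (z * of_real (h x)) * g x)"
proof -
  \<comment> \<open>Cutting off at \<open>A\<close> gives functions on the whole space, for which
    the measurability rules apply.\<close>
  define h' where "h' x = indicator A x *\<^sub>R h x" for x
  define G where "G x = indicator A x *\<^sub>R exp (norm z * \<bar>h' x\<bar>) *\<^sub>R g x" for x
  define g' where "g' x = indicator A x *\<^sub>R g x" for x
  have [measurable]: "h' \<in> borel_measurable M"
    using h unfolding set_borel_measurable_def h'_def by simp
  have G: "integrable M G"
    using int unfolding set_integrable_def G_def h'_def
    by (rule Bochner_Integration.integrable_cong[THEN iffD1, rotated -1]) (auto simp: indicator_def)
  \<comment> \<open>Measurability of \<open>g\<close> is not among the assumptions; it follows from
    that of the integrable \<open>G\<close>, since the exponential factor can be inverted.\<close>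
  have "g' = (\<lambda>x. exp (- (norm z * \<bar>h' x\<bar>)) *\<^sub>R G x)"
    unfolding g'_def G_def by (auto simp: indicator_def exp_minus)
  moreover have [measurable]: "G \<in> borel_measurable M" using G by simp
  ultimately have [measurable]: "g' \<in> borel_measurable M" by simp
  have Gn: "norm (G x) = exp (norm z * \<bar>h' x\<bar>) * norm (g' x)" for x
    unfolding G_def g'_def by (simp add: indicator_def)
  have exp_ge: "(\<Sum>k<n. r ^ k / fact k) \<le> exp r" if "r \<ge> 0" for n and r :: real
    using exp_converges[of r] that
    by (intro sum_le_suminf[THEN order_trans])
       (auto simp: sums_iff divide_inverse mult.commute scaleR_conv_of_real)
  have bound: "norm (\<Sum>k<n. (z * of_real y) ^ k / fact k) \<le> exp (norm z * \<bar>y\<bar>)" for n and y :: real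
    by (rule order_trans[OF norm_sum], rule order_trans[OF _ exp_ge[of _ n]])
       (simp_all add: norm_divide norm_power norm_mult)
  have bound1: "norm (of_real y ^ n * z ^ n / fact n :: complex) \<le> exp (norm z * \<bar>y\<bar>)" for n and y :: real
  proof -
    have "norm (of_real y ^ n * z ^ n / fact n :: complex) = (norm z * \<bar>y\<bar>) ^ n / fact n"
      by (simp add: norm_divide norm_power norm_mult power_mult_distrib mult.commute)
    also have "\<dots> \<le> (\<Sum>k<Suc n. (norm z * \<bar>y\<bar>) ^ k / fact k)"
      by (simp add: sum_nonneg)
    also have "\<dots> \<le> exp (norm z * \<bar>y\<bar>)" by (rule exp_ge) simp
    finally show ?thesis .
  qed
  let ?t = "\<lambda>k x. z ^ k / fact k * (of_real (h' x) ^ k * g' x)"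
  have inn: "integrable M (\<lambda>x. ?t n x)" for n
  proof (rule Bochner_Integration.integrable_bound[OF G])
    show "AE x in M. norm (?t n x) \<le> norm (G x)"
    proof (intro AE_I2)
      fix x
      have "norm (?t n x)
          = norm (of_real (h' x) ^ n * z ^ n / fact n) * norm (g' x)"
        by (simp add: norm_mult norm_divide norm_power)
      also have "\<dots> \<le> norm (G x)" unfolding Gn by (intro mult_right_mono bound1) auto
      finally show "norm (?t n x) \<le> norm (G x)" .
    qed
  qed simp
  have "(\<lambda>n. LINT x|M. (\<Sum>k<n. ?t k x))
      \<longlonglongrightarrow> (LINT x|M. exp (z * of_real (h' x)) * g' x)"
  proof (rule integral_dominated_convergence[where w = "\<lambda>x. norm (G x)"])
    show "integrable M (\<lambda>x. norm (G x))" using G by simp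
    show "AE x in M. (\<lambda>n. \<Sum>k<n. ?t k x)
        \<longlonglongrightarrow> exp (z * of_real (h' x)) * g' x"
    proof (intro AE_I2)
      fix x
      have "(\<lambda>n. (z * of_real (h' x)) ^ n / fact n) sums exp (z * of_real (h' x))"
        using exp_converges[of "z * of_real (h' x)"] by (simp add: scaleR_conv_of_real divide_inverse mult.commute)
      from sums_mult2[OF this, of "g' x"]
      show "(\<lambda>n. \<Sum>k<n. ?t k x)
        \<longlonglongrightarrow> exp (z * of_real (h' x)) * g' x"
        by (simp add: sums_def power_mult_distrib mult.assoc)
    qed
    show "AE x in M. norm (\<Sum>k<n. ?t k x) \<le> norm (G x)" for n
    proof (intro AE_I2)
      fix x
      have "(\<Sum>k<n. ?t k x)
         = (\<Sum>k<n. (z * of_real (h' x)) ^ k / fact k) * g' x"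
        by (simp add: sum_distrib_right power_mult_distrib mult.assoc)
      then show "norm (\<Sum>k<n. ?t k x) \<le> norm (G x)"
        unfolding Gn using bound by (simp add: norm_mult mult_right_mono)
    qed
  qed simp_all
  also have "(LINT x|M. exp (z * of_real (h' x)) * g' x) = (LINT x:A|M. exp (z * of_real (h x)) * g x)"
    unfolding set_lebesgue_integral_def g'_def h'_def
    by (intro Bochner_Integration.integral_cong) (auto simp: indicator_def)
  also have "(\<lambda>n. LINT x|M. (\<Sum>k<n. ?t k x))
     = (\<lambda>n. \<Sum>k<n. z ^ k / fact k * (LINT x:A|M. of_real (h x) ^ k * g x))"
  proof
    fix n
    have "(LINT x|M. of_real (h' x) ^ k * g' x) = (LINT x:A|M. of_real (h x) ^ k * g x)" for k
      unfolding set_lebesgue_integral_def g'_def h'_def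
      by (intro Bochner_Integration.integral_cong) (auto simp: indicator_def)
    then show "(LINT x|M. (\<Sum>k<n. ?t k x))
     = (\<Sum>k<n. z ^ k / fact k * (LINT x:A|M. of_real (h x) ^ k * g x))"
      using inn by (subst Bochner_Integration.integral_sum) auto
  qed
  finally show ?thesis unfolding sums_def .
qed

text \<open>Continuity on the open rectangle gives joint measurability, and the majorant
  \<open>g\<close> of the inner norm integrals gives integrability on the product; it spares
  computing these norm integrals exactly.\<close>

lemma set_integral_swap_lborel:
  fixes f :: "real \<Rightarrow> real \<Rightarrow> complex" and g :: "real \<Rightarrow> real"
  assumes "open S" "open T" and cont: "continuous_on (S \<times> T) (\<lambda>(x, y). f x y)"
    and inner: "\<And>y. y \<in> T \<Longrightarrow> set_integrable lborel S (\<lambda>x. f x y)"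
    and outer: "set_integrable lborel T g"
    and bound: "\<And>y. y \<in> T \<Longrightarrow> (LBINT x:S. norm (f x y)) \<le> g y"
  shows "set_integrable lborel S (\<lambda>x. LBINT y:T. f x y)"
    and "set_integrable lborel T (\<lambda>y. LBINT x:S. f x y)"
    and "(LBINT x:S. LBINT y:T. f x y) = (LBINT y:T. LBINT x:S. f x y)"
proof -
  define F where "F = (\<lambda>(x, y). indicator (S \<times> T) (x, y) *\<^sub>R f x y)"
  have "(\<lambda>p. indicator (S \<times> T) p *\<^sub>R (\<lambda>(x, y). f x y) p) \<in> borel_measurable borel"
    by (intro borel_measurable_continuous_on_indicator cont borel_open open_Times assms(1,2))
  then have F: "F \<in> borel_measurable (lborel \<Otimes>\<^sub>M lborel)"
    unfolding F_def by (simp add: lborel_prod case_prod_unfold)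
  \<comment> \<open>The integrability criterion takes its inner integral over the second component,
    while the bound concerns the inner integral over \<open>x\<close>; hence the exchanged
    coordinates.\<close>
  have F': "(\<lambda>(y, x). F (x, y)) \<in> borel_measurable (lborel \<Otimes>\<^sub>M lborel)"
    using F by (rule measurable_pair_swap)
  have "integrable (lborel \<Otimes>\<^sub>M lborel) (\<lambda>(y, x). F (x, y))"
  proof (rule lborel_pair.Fubini_integrable[OF F'])
    show "AE y in lborel. integrable lborel (\<lambda>x. case (y, x) of (y, x) \<Rightarrow> F (x, y))"
    proof (intro AE_I2)
      fix y :: real
      show "integrable lborel (\<lambda>x. case (y, x) of (y, x) \<Rightarrow> F (x, y))"
        using inner[of y] by (cases "y \<in> T") (auto simp: F_def set_integrable_def indicator_times)
    qed
    have "(\<lambda>y. LBINT x. norm (case (y, x) of (y, x) \<Rightarrow> F (x, y))) =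
        (\<lambda>y. indicator T y *\<^sub>R (LBINT x:S. norm (f x y)))"
      by (auto simp: F_def set_lebesgue_integral_def indicator_def intro!: ext Bochner_Integration.integral_cong)
    moreover have "integrable lborel (\<lambda>y. indicator T y *\<^sub>R (LBINT x:S. norm (f x y)))"
    proof (rule Bochner_Integration.integrable_bound)
      show "integrable lborel (\<lambda>y. indicator T y *\<^sub>R g y)"
        using outer by (simp add: set_integrable_def)
      have "(\<lambda>y. LBINT x. norm (case (y, x) of (y, x) \<Rightarrow> F (x, y))) \<in> borel_measurable lborel"
        using F' by (intro lborel.borel_measurable_lebesgue_integral) (simp add: case_prod_unfold)
      then show "(\<lambda>y. indicator T y *\<^sub>R (LBINT x:S. norm (f x y))) \<in> borel_measurable lborel"
        unfolding calculation .
      have nonneg: "0 \<le> (LBINT x:S. norm (f x y))" for y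
        unfolding set_lebesgue_integral_def by (intro Bochner_Integration.integral_nonneg) simp
      show "AE y in lborel. norm (indicator T y *\<^sub>R (LBINT x:S. norm (f x y))) \<le> norm (indicator T y *\<^sub>R g y)"
      proof (intro AE_I2)
        fix y
        show "norm (indicator T y *\<^sub>R (LBINT x:S. norm (f x y))) \<le> norm (indicator T y *\<^sub>R g y)"
          using bound[of y] nonneg[of y] by (auto simp: indicator_def)
      qed
    qed
    ultimately show "integrable lborel (\<lambda>y. LBINT x. norm (case (y, x) of (y, x) \<Rightarrow> F (x, y)))"
      by simp
  qed
  then have I: "integrable (lborel \<Otimes>\<^sub>M lborel) F"
    using lborel_pair.integrable_product_swap_iff[of F] by simp
  have eq1: "(LBINT y. F (x, y)) = indicator S x *\<^sub>R (LBINT y:T. f x y)" for x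
    by (auto simp: F_def set_lebesgue_integral_def indicator_def intro!: Bochner_Integration.integral_cong)
  have eq2: "(LBINT x. F (x, y)) = indicator T y *\<^sub>R (LBINT x:S. f x y)" for y
    by (auto simp: F_def set_lebesgue_integral_def indicator_def intro!: Bochner_Integration.integral_cong)
  have I': "integrable (lborel \<Otimes>\<^sub>M lborel) (case_prod (\<lambda>x y. F (x, y)))" using I by simp
  show "set_integrable lborel S (\<lambda>x. LBINT y:T. f x y)"
    using lborel_pair.integrable_fst[OF I'] unfolding set_integrable_def eq1 .
  show "set_integrable lborel T (\<lambda>y. LBINT x:S. f x y)"
    using lborel_pair.integrable_snd[OF I'] unfolding set_integrable_def eq2 .
  show "(LBINT x:S. LBINT y:T. f x y) = (LBINT y:T. LBINT x:S. f x y)"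
    using lborel_pair.Fubini_integral[OF I'] unfolding eq1 eq2 set_lebesgue_integral_def by simp
qed

text \<open>Folds the line onto the half line. Applied to exp(-2zu) times an even function of u,
  this produces the hyperbolic cosine of the second identity.\<close>

lemma lborel_integral_eq_integral_even_part:
  fixes f :: "real \<Rightarrow> 'a :: {banach, second_countable_topology}"
  assumes "integrable lborel f"
  shows "set_integrable lborel {0<..} (\<lambda>x. f x + f (- x))"
    and "integral\<^sup>L lborel f = (LBINT x:{0<..}. f x + f (- x))"
proof -
  have f': "integrable lborel (\<lambda>x. f (- x))"
    using lborel_integrable_real_affine[OF assms, of "-1" 0] by simp
  have s: "set_integrable lborel A f" if "A \<in> sets borel" for A
    using assms that unfolding set_integrable_def by (intro integrable_mult_indicator) auto
  have s': "set_integrable lborel A (\<lambda>x. f (- x))" if "A \<in> sets borel" for A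
    using f' that unfolding set_integrable_def by (intro integrable_mult_indicator) auto
  show "set_integrable lborel {0<..} (\<lambda>x. f x + f (- x))"
    using s s' by (intro set_integral_add) auto
  have "integral\<^sup>L lborel f = (LBINT x:{..<0} \<union> {0<..}. f x)"
    unfolding set_lebesgue_integral_def
    using AE_lborel_singleton[of 0]
    by (intro integral_cong_AE borel_measurable_scaleR borel_measurable_indicator borel_measurable_integrable assms)
       (auto simp: indicator_def elim!: eventually_mono)
  also have "\<dots> = (LBINT x:{..<0}. f x) + (LBINT x:{0<..}. f x)"
    using s by (intro set_integral_Un) auto
  also have "(LBINT x:{..<0}. f x) = (LBINT x:{0<..}. f (- x))"
    unfolding set_lebesgue_integral_def
    by (subst lborel_integral_real_affine[of "-1" _ 0]) (auto simp: indicator_def)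
  also have "(LBINT x:{0<..}. f (- x)) + (LBINT x:{0<..}. f x) = (LBINT x:{0<..}. f x + f (- x))"
    using s s' by (subst set_integral_add) (auto simp: add.commute)
  finally show "integral\<^sup>L lborel f = (LBINT x:{0<..}. f x + f (- x))" .
qed

section \<open>Complex powers and Gamma integrals\<close>

lemma Re_pos_notin_nonpos_Ints: "Re z > 0 \<Longrightarrow> z \<notin> \<int>\<^sub>\<le>\<^sub>0"
  by (auto elim!: nonpos_Ints_cases)

lemma Gamma_Re_pos_nonzero: "Re z > 0 \<Longrightarrow> Gamma z \<noteq> (0 :: complex)"
  by (simp add: Gamma_eq_zero_iff Re_pos_notin_nonpos_Ints)

lemma powr_minus_half_of_real:
  assumes "x > 0"
  shows "of_real x powr (- 1 / 2) = complex_of_real (1 / sqrt x)"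
proof -
  have "of_real x powr (- 1 / 2) = complex_of_real (x powr (- 1 / 2))"
    using assms powr_of_real[of x "- 1 / 2"] by simp
  then show ?thesis using assms by (simp add: powr_minus_divide powr_half_sqrt)
qed

lemma of_real_powr_twice:
  assumes "x > 0"
  shows "of_real x * (of_real x powr a * of_real x powr a) = (of_real x powr (2 * a + 1) :: complex)"
proof -
  have "2 * a + 1 = 1 + (a + a)" by simp
  then have "of_real x powr (2 * a + 1) = (of_real x powr (1 + (a + a)) :: complex)" by (rule arg_cong)
  then show ?thesis using assms unfolding powr_add by simp
qed

lemma has_Gamma_integral_scaled:
  fixes a :: complex and y :: real
  assumes "Re a > 0" "y > 0"
  shows "set_integrable lborel {0<..} (\<lambda>t. exp (- (of_real y * of_real t)) * of_real t powr (a - 1))"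
    and "(LBINT t:{0<..}. exp (- (of_real y * of_real t)) * of_real t powr (a - 1))
           = Gamma a * of_real y powr (- a)"
proof -
  let ?k = "\<lambda>t::real. exp (- (of_real y * of_real t)) * of_real t powr (a - 1) :: complex"
  let ?f = "\<lambda>t. exp (- of_real t) * of_real t powr (a - 1) :: complex"
  have eq: "?f = (\<lambda>t. of_real t powr (a - 1) / of_real (exp t))"
    by (auto simp: exp_minus exp_of_real divide_inverse)
  have cont: "continuous_on {0<..} ?f"
    by (auto intro!: continuous_intros)
  have "?f absolutely_integrable_on {0<..}"
    unfolding eq by (rule absolutely_integrable_Gamma_integral'[OF assms(1)])
  moreover have "(\<lambda>x. indicator {0<..} x *\<^sub>R ?f x) \<in> borel_measurable lborel"
    using borel_measurable_continuous_on_indicator[OF _ cont] by simp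
  ultimately have int: "set_integrable lborel {0<..} ?f"
    unfolding set_integrable_def by (subst (asm) integrable_completion)
  have val: "(LBINT t:{0<..}. ?f t) = Gamma a"
    using set_borel_integral_eq_integral(2)[OF int] Gamma_integral_complex'[OF assms(1)]
    unfolding eq by (simp add: integral_unique)
  note sub = set_integral_scale_Ioi[OF assms(2) cont]
  have pw: "of_real y * ?f (y * t) = of_real y powr a * (?k t)"
    if "t > 0" for t
  proof -
    have "of_real (y * t) powr (a - 1) = (of_real y powr (a - 1) * of_real t powr (a - 1) :: complex)"
      using assms(2) that by (simp add: powr_times_real)
    moreover have "of_real y * of_real y powr (a - 1) = (of_real y powr a :: complex)"
      using assms(2) by (simp add: powr_diff)
    ultimately show ?thesis using assms(2) by (simp add: mult_ac)
  qed
  have nz: "of_real y powr a \<noteq> (0::complex)" using assms(2) by simp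
  have "set_integrable lborel {0<..} (\<lambda>t. of_real y powr a * (?k t))"
    using sub(1) int pw by (subst set_integrable_cong[OF refl refl pw[symmetric]]) auto
  then show "set_integrable lborel {0<..} (\<lambda>t. ?k t)"
    using nz by simp
  have "Gamma a = (LBINT t:{0<..}. of_real y powr a * (?k t))"
    unfolding val[symmetric] sub(2) by (intro set_lebesgue_integral_cong) (use pw in auto)
  then show "(LBINT t:{0<..}. ?k t)
           = Gamma a * of_real y powr (- a)"
    using nz by (simp add: powr_minus field_simps)
qed

text \<open>Needed for majorants: the norm of the complex integrand with exponent \<open>a\<close>
  is the real integrand with exponent \<open>Re a\<close>.\<close>

lemma has_Gamma_integral_scaled_real:
  fixes a y :: real
  assumes "a > 0" "y > 0"
  shows "set_integrable lborel {0<..} (\<lambda>t. exp (- (y * t)) * t powr (a - 1))"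
    and "(LBINT t:{0<..}. exp (- (y * t)) * t powr (a - 1)) = Gamma a * y powr (- a)"
proof -
  have eq: "exp (- (of_real y * of_real t)) * of_real t powr (of_real a - 1)
      = complex_of_real (exp (- (y * t)) * t powr (a - 1))" if "t > 0" for t
    using that powr_of_real[of t "a - 1"] by (simp add: exp_of_real[symmetric])
  have int: "set_integrable lborel {0<..} (\<lambda>t. complex_of_real (exp (- (y * t)) * t powr (a - 1)))"
    using has_Gamma_integral_scaled(1)[of "of_real a" y] assms
    by (subst set_integrable_cong[OF refl refl eq[symmetric]]) auto
  have "set_integrable lborel {0<..} (\<lambda>t. norm (complex_of_real (exp (- (y * t)) * t powr (a - 1))))"
    using int by (rule set_integrable_norm)
  then show "set_integrable lborel {0<..} (\<lambda>t. exp (- (y * t)) * t powr (a - 1))"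
    unfolding norm_of_real by (simp add: abs_mult)
  have "complex_of_real (LBINT t:{0<..}. exp (- (y * t)) * t powr (a - 1))
    = (LBINT t:{0<..}. complex_of_real (exp (- (y * t)) * t powr (a - 1)))"
    by (simp only: set_integral_complex_of_real)
  also have "\<dots> = (LBINT t:{0<..}. exp (- (of_real y * of_real t)) * of_real t powr (of_real a - 1))"
    by (intro set_lebesgue_integral_cong) (use eq in auto)
  also have "\<dots> = Gamma (of_real a) * of_real y powr (- of_real a)"
    using has_Gamma_integral_scaled(2)[of "of_real a" y] assms by simp
  also have "\<dots> = complex_of_real (Gamma a * y powr (- a))"
    using powr_of_real[of y "- a"] assms by (simp add: Gamma_complex_of_real)
  finally show "(LBINT t:{0<..}. exp (- (y * t)) * t powr (a - 1)) = Gamma a * y powr (- a)"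
    using of_real_eq_iff by blast
qed

section \<open>Tricomi's integral: bounds and reflection\<close>

text \<open>The two exponents are independent parameters, because differentiation in
  \<open>w\<close>, integration by parts and multiplication by 1 + t shift them separately. The
  value \<open>w = 0\<close> is used too: it gives the Beta integral.\<close>

definition tricomi_integrand :: "complex \<Rightarrow> complex \<Rightarrow> complex \<Rightarrow> real \<Rightarrow> complex" where
  "tricomi_integrand p q w t = exp (- (w * of_real t)) * of_real t powr (p - 1) * of_real (1 + t) powr q"

text \<open>For \<open>p = a\<close> and \<open>q = b - a - 1\<close> this equals \<open>\<Gamma>(a) \<Psi>(a, b; w)\<close>.\<close>

definition tricomi_integral :: "complex \<Rightarrow> complex \<Rightarrow> complex \<Rightarrow> complex" where
  "tricomi_integral p q w = (LBINT t:{0<..}. tricomi_integrand p q w t)"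

lemma continuous_on_tricomi_integrand [continuous_intros]:
  "continuous_on {0<..} (tricomi_integrand p q w)"
  unfolding tricomi_integrand_def by (auto intro!: continuous_intros simp del: of_real_add)

lemma set_borel_measurable_lborel_continuous_on:
  fixes f :: "real \<Rightarrow> 'b::real_normed_vector"
  assumes "open S" "continuous_on S f"
  shows "set_borel_measurable lborel S f"
  using set_measurable_continuous_on[OF borel_open[OF assms(1)] assms(2)]
  by (simp add: set_borel_measurable_def)

text \<open>For a natural number N >= r, the N-th term of the exponential series at e(1+t) already
  dominates; this gives the constant C = N! e^(-N) exp(e).\<close>

lemma powr_le_const_exp:
  fixes r e :: real
  assumes "e > 0"
  obtains C where "C \<ge> 0" "\<And>t. t \<ge> 0 \<Longrightarrow> (1 + t) powr r \<le> C * exp (e * t)"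
proof -
  obtain N :: nat where N: "r \<le> real N" using real_arch_simple by blast
  show ?thesis
  proof (rule that[of "fact N / e ^ N * exp e"])
    fix t :: real assume t: "t \<ge> 0"
    have "(\<Sum>n\<in>{N}. (e * (1 + t)) ^ n /\<^sub>R fact n) \<le> exp (e * (1 + t))"
      unfolding exp_def by (rule sum_le_suminf[OF summable_exp_generic]) (use assms t in auto)
    then have 1: "e ^ N * (1 + t) ^ N \<le> fact N * exp (e * (1 + t))"
      by (simp add: field_simps flip: power_mult_distrib)
    have "(1 + t) powr r \<le> (1 + t) ^ N"
      using N t powr_mono[of r "real N" "1 + t"] by (simp add: powr_realpow)
    also have "\<dots> \<le> fact N * exp (e * (1 + t)) / e ^ N"
      using 1 assms by (subst pos_le_divide_eq) (auto simp: mult.commute)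
    also have "\<dots> = fact N / e ^ N * exp e * exp (e * t)"
      by (simp add: exp_add distrib_left)
    finally show "(1 + t) powr r \<le> fact N / e ^ N * exp e * exp (e * t)" .
  qed (use assms in auto)
qed

lemma norm_tricomi_integrand:
  "t > 0 \<Longrightarrow> norm (tricomi_integrand p q w t) = exp (- (Re w * t)) * t powr (Re p - 1) * (1 + t) powr Re q"
  by (simp add: tricomi_integrand_def norm_mult norm_powr_real_powr del: of_real_add)

lemma set_integrable_tricomi_integrand:
  assumes "Re p > 0" "Re w > 0"
  shows "set_integrable lborel {0<..} (tricomi_integrand p q w)"
proof -
  \<comment> \<open>Half of the decay rate \<open>Re w\<close> is spent on absorbing the power of 1
    + t; the other half leaves a Gamma integrand.\<close>
  obtain C where C: "C \<ge> 0" "\<And>t. t \<ge> 0 \<Longrightarrow> (1 + t) powr Re q \<le> C * exp (Re w / 2 * t)"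
    using powr_le_const_exp[of "Re w / 2" "Re q"] assms by auto
  show ?thesis
  proof (rule set_integrable_bound)
    show "set_integrable lborel {0<..} (\<lambda>t. C * (exp (- (Re w / 2 * t)) * t powr (Re p - 1)))"
      using has_Gamma_integral_scaled_real(1)[of "Re p" "Re w / 2"] assms by simp
    show "set_borel_measurable lborel {0<..} (tricomi_integrand p q w)"
      by (intro set_borel_measurable_lborel_continuous_on continuous_intros)
    show "AE t in lborel. t \<in> {0<..} \<longrightarrow> norm (tricomi_integrand p q w t)
        \<le> norm (C * (exp (- (Re w / 2 * t)) * t powr (Re p - 1)))"
    proof (intro AE_I2 impI)
      fix t :: real assume "t \<in> {0<..}"
      then have t: "t > 0" by simp
      have "norm (tricomi_integrand p q w t)
          \<le> exp (- (Re w * t)) * t powr (Re p - 1) * (C * exp (Re w / 2 * t))"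
        unfolding norm_tricomi_integrand[OF t] using C(2)[of t] t by (intro mult_left_mono) auto
      also have "\<dots> = C * ((exp (- (Re w * t)) * exp (Re w / 2 * t)) * t powr (Re p - 1))" by simp
      also have "exp (- (Re w * t)) * exp (Re w / 2 * t) = exp (- (Re w / 2 * t))"
        by (simp add: exp_add[symmetric] field_simps)
      finally show "norm (tricomi_integrand p q w t)
        \<le> norm (C * (exp (- (Re w / 2 * t)) * t powr (Re p - 1)))"
        using C(1) by (simp add: abs_mult)
    qed
  qed
qed

text \<open>Both sides arise from integrating \<open>e\<^bsup>-wt\<^esup> t\<^bsup>a-1\<^esup> y\<^bsup>c-1\<^esup> e\<^bsup>-y(1+t)\<^esup>\<close> over \<open>t\<close> and \<open>y\<close>. The case \<open>w = 0\<close> yields the Beta integral.\<close>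

lemma tricomi_integral_reflect:
  fixes w :: real
  assumes a: "Re a > 0" and c: "Re c > 0" and w: "w \<ge> 0"
    and int: "set_integrable lborel {0<..} (\<lambda>y. exp (- of_real y) * of_real y powr (c - 1) * of_real (w + y) powr (- a))"
  shows "set_integrable lborel {0<..} (tricomi_integrand a (- c) (of_real w))"
    and "Gamma c * tricomi_integral a (- c) (of_real w)
       = Gamma a * (LBINT y:{0<..}. exp (- of_real y) * of_real y powr (c - 1) * of_real (w + y) powr (- a))"
proof -
  let ?k = "\<lambda>y::real. exp (- of_real y) * of_real y powr (c - 1) * of_real (w + y) powr (- a) :: complex"
  define f :: "real \<Rightarrow> real \<Rightarrow> complex" where
    "f t y = exp (- (of_real w * of_real t)) * of_real t powr (a - 1) * (of_real y powr (c - 1) * exp (- (of_real (1 + t) * of_real y)))" for t y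
  have f1: "f t y = of_real y powr (c - 1) * exp (- of_real y) * (exp (- (of_real (w + y) * of_real t)) * of_real t powr (a - 1))" for t y
  proof -
    have "exp (- (of_real w * of_real t)) * exp (- (of_real (1 + t) * of_real y))
        = exp (- of_real y) * exp (- (of_real (w + y) * of_real t) :: complex)"
      by (simp add: exp_add[symmetric] algebra_simps)
    then show ?thesis unfolding f_def by (simp add: mult_ac)
  qed
  have cont: "continuous_on ({0<..} \<times> {0<..}) (\<lambda>(t, y). f t y)"
    unfolding f_def case_prod_unfold by (auto intro!: continuous_intros simp del: of_real_add)
  have inner: "set_integrable lborel {0<..} (\<lambda>t. f t y)" if "y \<in> {0<..}" for y
    unfolding f1 using has_Gamma_integral_scaled(1)[OF a, of "w + y"] that w
    by (intro set_integrable_mult_right) auto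
  have innerv: "(LBINT t:{0<..}. f t y) = Gamma a * (?k y)"
    if "y > 0" for y
    unfolding f1 set_integral_mult_right
    by (subst has_Gamma_integral_scaled(2)[OF a]) (use that w in \<open>auto simp: mult_ac\<close>)
  have innern: "(LBINT t:{0<..}. norm (f t y)) = Gamma (Re a) * norm (?k y)"
    if "y \<in> {0<..}" for y
  proof -
    have "(LBINT t:{0<..}. norm (f t y))
        = (LBINT t:{0<..}. norm (of_real y powr (c - 1) * exp (- of_real y :: complex)) * (exp (- ((w + y) * t)) * t powr (Re a - 1)))"
      unfolding f1 by (intro set_lebesgue_integral_cong) (auto simp: norm_mult norm_powr_real_powr)
    also have "\<dots> = norm (of_real y powr (c - 1) * exp (- of_real y :: complex)) * (Gamma (Re a) * (w + y) powr (- Re a))"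
      using has_Gamma_integral_scaled_real(2)[of "Re a" "w + y"] a w that by simp
    also have "(w + y) powr (- Re a) = norm (of_real (w + y) powr (- a) :: complex)"
      using w that by (simp add: norm_powr_real_powr del: of_real_add)
    finally show ?thesis by (simp add: norm_mult mult_ac)
  qed
  \<comment> \<open>For w = 0 the behaviour of \<open>?k\<close> at 0 depends on c - a, so its
    integrability is the assumption \<open>int\<close>; here it supplies the outer majorant for
    Fubini.\<close>
  have "set_integrable lborel {0<..} (\<lambda>y. Gamma (Re a) * norm (?k y))"
    using set_integrable_norm[OF int] by simp
  note swap = set_integral_swap_lborel[OF open_greaterThan open_greaterThan cont inner this
      eq_refl[OF innern]]
  have other: "(LBINT y:{0<..}. f t y) = Gamma c * tricomi_integrand a (- c) (of_real w) t" if "t > 0" for t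
  proof -
    have "(LBINT y:{0<..}. f t y) = exp (- (of_real w * of_real t)) * of_real t powr (a - 1) *
        (LBINT y:{0<..}. exp (- (of_real (1 + t) * of_real y)) * of_real y powr (c - 1))"
      unfolding f_def by (subst set_integral_mult_right[symmetric]) (simp add: mult_ac)
    also have "(LBINT y:{0<..}. exp (- (of_real (1 + t) * of_real y)) * of_real y powr (c - 1)) = Gamma c * of_real (1 + t) powr (- c)"
      using has_Gamma_integral_scaled(2)[OF c, of "1 + t"] that by simp
    finally show ?thesis by (simp add: tricomi_integrand_def mult_ac)
  qed
  have nz: "Gamma c \<noteq> 0" using c by (rule Gamma_Re_pos_nonzero)
  have "set_integrable lborel {0<..} (\<lambda>t. Gamma c * tricomi_integrand a (- c) (of_real w) t)"
    using swap(1) by (subst set_integrable_cong[OF refl refl other[symmetric]]) auto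
  then show "set_integrable lborel {0<..} (tricomi_integrand a (- c) (of_real w))"
    using nz by simp
  have "Gamma c * tricomi_integral a (- c) (of_real w) = (LBINT t:{0<..}. Gamma c * tricomi_integrand a (- c) (of_real w) t)"
    by (simp add: tricomi_integral_def)
  also have "\<dots> = (LBINT t:{0<..}. LBINT y:{0<..}. f t y)"
    by (intro set_lebesgue_integral_cong) (use other in auto)
  also have "\<dots> = (LBINT y:{0<..}. LBINT t:{0<..}. f t y)" by (rule swap(3))
  also have "\<dots> = (LBINT y:{0<..}. Gamma a * (?k y))"
    by (intro set_lebesgue_integral_cong) (use innerv in auto)
  finally show "Gamma c * tricomi_integral a (- c) (of_real w)
       = Gamma a * (LBINT y:{0<..}. ?k y)"
    by simp
qed

section \<open>Kummer's function\<close>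

text \<open>As a formal power series, Kummer's series inherits termwise differentiation from
  \<open>eval_fps\<close>.\<close>

definition kummer_fps :: "complex \<Rightarrow> complex \<Rightarrow> complex fps" where
  "kummer_fps a b = Abs_fps (\<lambda>n. pochhammer a n / (pochhammer b n * fact n))"

lemma kummer_Phi_eq_eval_fps: "kummer_Phi a b = eval_fps (kummer_fps a b)"
  by (simp add: fun_eq_iff kummer_Phi_def eval_fps_def kummer_fps_def mult_ac divide_inverse)

text \<open>The ratio of consecutive coefficients tends to 0. If \<open>b\<close> is a nonpositive
  integer, the coefficients are eventually 0 by the convention on division by zero, and they obey
  the same recursion.\<close>

lemma summable_kummer: "summable (\<lambda>n. fps_nth (kummer_fps a b) n * z ^ n)"
proof (rule summable_ratio_test)
  show "(1/2::real) < 1" by simp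
  \<comment> \<open>Beyond this threshold |b + n| >= n/2, |a + n| <= 2n and 8|z| <= n + 1, so the
    ratio is at most 4|z|/(n+1) <= 1/2.\<close>
  define N where "N = nat \<lceil>2 * norm b + norm a + 8 * norm z + 1\<rceil>"
  fix n assume "n \<ge> N"
  then have n: "real n \<ge> 2 * norm b + norm a + 8 * norm z + 1"
    unfolding N_def by linarith
  have "real n - norm b \<le> norm (b + of_nat n)"
    using norm_triangle_ineq2[of "of_nat n :: complex" "- b"] by (simp add: add.commute)
  moreover have "0 \<le> norm a" "0 \<le> norm z" "0 \<le> norm b" by simp_all
  ultimately have B: "real n / 2 \<le> norm (b + of_nat n)" using n by linarith
  have "norm (a + of_nat n) \<le> norm a + real n"
    using norm_triangle_ineq[of a "of_nat n"] by simp
  then have A: "norm (a + of_nat n) \<le> 2 * real n"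
    using n \<open>0 \<le> norm z\<close> \<open>0 \<le> norm b\<close> by linarith
  have npos: "real n > 0" using n \<open>0 \<le> norm a\<close> \<open>0 \<le> norm z\<close> \<open>0 \<le> norm b\<close> by linarith
  have "norm ((a + of_nat n) / ((b + of_nat n) * of_nat (Suc n)) * z)
      = norm (a + of_nat n) / (norm (b + of_nat n) * real (Suc n)) * norm z"
    by (simp add: norm_mult norm_divide del: of_nat_Suc)
  also have "\<dots> \<le> (2 * real n) / (real n / 2 * real (Suc n)) * norm z"
    using A B npos by (intro mult_right_mono frac_le mult_pos_pos) auto
  also have "\<dots> = 4 * norm z / real (Suc n)" using npos by (simp add: divide_simps del: of_nat_Suc)
  also have "\<dots> \<le> 1 / 2"
  proof -
    have "8 * norm z \<le> real (Suc n)"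
      using n \<open>0 \<le> norm a\<close> \<open>0 \<le> norm z\<close> \<open>0 \<le> norm b\<close> by linarith
    then show ?thesis by (simp add: divide_simps del: of_nat_Suc)
  qed
  finally have r: "norm ((a + of_nat n) / ((b + of_nat n) * of_nat (Suc n)) * z) \<le> 1/2" .
  have "fps_nth (kummer_fps a b) (Suc n) * z ^ Suc n
      = ((a + of_nat n) / ((b + of_nat n) * of_nat (Suc n)) * z) * (fps_nth (kummer_fps a b) n * z ^ n)"
    by (simp add: kummer_fps_def pochhammer_rec' divide_inverse mult_ac del: of_nat_Suc)
  then have "norm (fps_nth (kummer_fps a b) (Suc n) * z ^ Suc n)
      = norm ((a + of_nat n) / ((b + of_nat n) * of_nat (Suc n)) * z) * norm (fps_nth (kummer_fps a b) n * z ^ n)"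
    by (simp only: norm_mult)
  also have "\<dots> \<le> 1/2 * norm (fps_nth (kummer_fps a b) n * z ^ n)"
    using r by (intro mult_right_mono) auto
  finally show "norm (fps_nth (kummer_fps a b) (Suc n) * z ^ Suc n)
     \<le> 1/2 * norm (fps_nth (kummer_fps a b) n * z ^ n)" .
qed

lemma fps_conv_radius_kummer [simp]: "fps_conv_radius (kummer_fps a b) = \<infinity>"
  unfolding fps_conv_radius_def using summable_kummer by (intro conv_radius_inftyI'') auto

lemma kummer_Phi_sums:
  "(\<lambda>n. pochhammer a n / pochhammer b n * z ^ n / fact n) sums kummer_Phi a b z"
  using summable_kummer[of a b z] unfolding kummer_Phi_def kummer_fps_def
  by (simp add: summable_sums_iff mult_ac divide_inverse)

lemma kummer_Phi_0 [simp]: "kummer_Phi a b 0 = 1"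
  by (simp add: kummer_Phi_eq_eval_fps eval_fps_at_0 kummer_fps_def)

lemma has_field_derivative_kummer_Phi:
  "(kummer_Phi a b has_field_derivative a / b * kummer_Phi (a + 1) (b + 1) z) (at z within A)"
proof -
  have "fps_deriv (kummer_fps a b) = fps_const (a / b) * kummer_fps (a + 1) (b + 1)"
    by (rule fps_ext) (simp add: kummer_fps_def pochhammer_rec divide_inverse mult_ac del: of_nat_Suc)
  then show ?thesis
    using has_field_derivative_eval_fps[of z "kummer_fps a b" A]
    by (simp add: kummer_Phi_eq_eval_fps eval_fps_mult)
qed

text \<open>The factor n is the effect of the Euler operator z d/dz on the n-th term. With it the
  contiguous relations below reduce to identities between coefficients.\<close>

lemma kummer_Phi_Euler_sums:
  "(\<lambda>n. of_nat n * (pochhammer a n / pochhammer b n * z ^ n / fact n)) sums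
     (z * (a / b * kummer_Phi (a + 1) (b + 1) z))"
proof -
  have eq: "of_nat (Suc n) * (pochhammer a (Suc n) / pochhammer b (Suc n) * z ^ Suc n / fact (Suc n))
      = z * (a / b) * (pochhammer (a + 1) n / pochhammer (b + 1) n * z ^ n / fact n)" for n
    by (simp add: pochhammer_rec divide_inverse mult_ac del: of_nat_Suc)
  have "(\<lambda>n. of_nat (Suc n) * (pochhammer a (Suc n) / pochhammer b (Suc n) * z ^ Suc n / fact (Suc n)))
      sums (z * (a / b) * kummer_Phi (a + 1) (b + 1) z)"
    unfolding eq by (intro sums_mult kummer_Phi_sums)
  from sums_Suc[OF this] show ?thesis by (simp add: mult.assoc)
qed

text \<open>The operator z d/dz + a multiplies the n-th term by a + n, and (a + n) (a)_n = a
  (a+1)_n.\<close>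

lemma kummer_Phi_raise_a:
  "z * (a / b * kummer_Phi (a + 1) (b + 1) z) + a * kummer_Phi a b z = a * kummer_Phi (a + 1) b z"
proof (rule sums_unique2)
  show "(\<lambda>n. of_nat n * (pochhammer a n / pochhammer b n * z ^ n / fact n)
      + a * (pochhammer a n / pochhammer b n * z ^ n / fact n)) sums
    (z * (a / b * kummer_Phi (a + 1) (b + 1) z) + a * kummer_Phi a b z)"
    by (intro sums_add sums_mult kummer_Phi_Euler_sums kummer_Phi_sums)
  have "of_nat n * (pochhammer a n / pochhammer b n * z ^ n / fact n)
      + a * (pochhammer a n / pochhammer b n * z ^ n / fact n)
      = a * (pochhammer (a + 1) n / pochhammer b n * z ^ n / fact n)" for n
  proof -
    have e: "(a + of_nat n) * pochhammer a n = a * pochhammer (a + 1) n"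
      by (metis pochhammer_rec pochhammer_rec')
    have "of_nat n * (pochhammer a n / pochhammer b n * z ^ n / fact n)
          + a * (pochhammer a n / pochhammer b n * z ^ n / fact n)
        = (a + of_nat n) * pochhammer a n * (z ^ n / (pochhammer b n * fact n))"
      by (simp add: divide_inverse algebra_simps)
    also have "\<dots> = a * (pochhammer (a + 1) n / pochhammer b n * z ^ n / fact n)"
      unfolding e by (simp add: divide_inverse mult_ac)
    finally show ?thesis .
  qed
  then show "(\<lambda>n. of_nat n * (pochhammer a n / pochhammer b n * z ^ n / fact n)
      + a * (pochhammer a n / pochhammer b n * z ^ n / fact n)) sums (a * kummer_Phi (a + 1) b z)"
    using sums_mult[OF kummer_Phi_sums[of "a + 1" b z], of a] by simp
qed

lemma pochhammer_nonzero: "b \<notin> \<int>\<^sub>\<le>\<^sub>0 \<Longrightarrow> pochhammer b n \<noteq> (0::complex)"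
  by (auto simp: pochhammer_eq_0_iff)

text \<open>The operator z d/dz + b - 1 multiplies the n-th term by b - 1 + n, and (b - 1 + n)
  (b-1)_n = (b - 1) (b)_n; the assumption keeps these denominators nonzero.\<close>

lemma kummer_Phi_lower_b:
  assumes b: "b - 1 \<notin> \<int>\<^sub>\<le>\<^sub>0"
  shows "z * (a / b * kummer_Phi (a + 1) (b + 1) z) + (b - 1) * kummer_Phi a b z = (b - 1) * kummer_Phi a (b - 1) z"
proof (rule sums_unique2)
  show "(\<lambda>n. of_nat n * (pochhammer a n / pochhammer b n * z ^ n / fact n)
      + (b - 1) * (pochhammer a n / pochhammer b n * z ^ n / fact n)) sums
    (z * (a / b * kummer_Phi (a + 1) (b + 1) z) + (b - 1) * kummer_Phi a b z)"
    by (intro sums_add sums_mult kummer_Phi_Euler_sums kummer_Phi_sums)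
  have "of_nat n * (pochhammer a n / pochhammer b n * z ^ n / fact n)
      + (b - 1) * (pochhammer a n / pochhammer b n * z ^ n / fact n)
      = (b - 1) * (pochhammer a n / pochhammer (b - 1) n * z ^ n / fact n)" for n
  proof -
    have p: "(b - 1 + of_nat n) * pochhammer (b - 1) n = (b - 1) * pochhammer b n"
      by (metis diff_add_cancel pochhammer_rec pochhammer_rec')
    have nz: "pochhammer (b - 1) n \<noteq> 0" "pochhammer (b - 1) (Suc n) \<noteq> 0"
      by (intro pochhammer_nonzero b)+
    then have nz': "pochhammer b n \<noteq> 0"
      by (metis diff_add_cancel mult_zero_right pochhammer_rec)
    have "(b - 1 + of_nat n) / pochhammer b n = (b - 1) / pochhammer (b - 1) n"
      using p nz nz' by (simp add: frac_eq_eq mult_ac)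
    then have "(b - 1 + of_nat n) / pochhammer b n * (pochhammer a n * z ^ n / fact n)
        = (b - 1) / pochhammer (b - 1) n * (pochhammer a n * z ^ n / fact n)" by simp
    moreover have "(b - 1 + of_nat n) / pochhammer b n * (pochhammer a n * z ^ n / fact n)
      = of_nat n * (pochhammer a n / pochhammer b n * z ^ n / fact n)
      + (b - 1) * (pochhammer a n / pochhammer b n * z ^ n / fact n)"
      by (simp add: divide_inverse algebra_simps)
    ultimately show ?thesis by simp
  qed
  then show "(\<lambda>n. of_nat n * (pochhammer a n / pochhammer b n * z ^ n / fact n)
      + (b - 1) * (pochhammer a n / pochhammer b n * z ^ n / fact n)) sums ((b - 1) * kummer_Phi a (b - 1) z)"
    using sums_mult[OF kummer_Phi_sums[of a "b - 1" z], of "b - 1"] by simp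
qed

text \<open>\<open>kummer_Phi_raise_a\<close> and \<open>kummer_Phi_lower_b\<close>, both at b + 1,
  share the term z d/dz, which cancels in their difference. Divided by b, the left side is the
  function minus its derivative; this is how the first part of \<open>kummer_Psi_nonint\<close>
  passes from b to b + 1.\<close>

lemma kummer_Phi_raise_b:
  assumes "b \<notin> \<int>\<^sub>\<le>\<^sub>0"
  shows "b * kummer_Phi a b z - a * kummer_Phi (a + 1) (b + 1) z = (b - a) * kummer_Phi a (b + 1) z"
proof -
  let ?X = "z * (a / (b + 1) * kummer_Phi (a + 1) (b + 1 + 1) z)"
  have h: "?X + a * kummer_Phi a (b + 1) z = a * kummer_Phi (a + 1) (b + 1) z"
    by (rule kummer_Phi_raise_a)
  have h': "?X + b * kummer_Phi a (b + 1) z = b * kummer_Phi a b z"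
    using kummer_Phi_lower_b[of "b + 1" z a] assms unfolding add_diff_cancel_right' by blast
  show ?thesis
    unfolding h[symmetric] h'[symmetric] by (simp add: left_diff_distrib)
qed

text \<open>Rests on (a)_(n+1) - (a-1)_(n+1) = (n+1) (a)_n. It serves the second part of
  \<open>kummer_Psi_nonint\<close> in the step from b to b + 1.\<close>

lemma kummer_Phi_diff_a:
  "kummer_Phi a b z - kummer_Phi (a - 1) b z = z / b * kummer_Phi a (b + 1) z"
proof (rule sums_unique2)
  let ?g = "\<lambda>n. pochhammer a n / pochhammer b n * z ^ n / fact n - pochhammer (a - 1) n / pochhammer b n * z ^ n / fact n"
  show "?g sums (kummer_Phi a b z - kummer_Phi (a - 1) b z)"
    by (intro sums_diff kummer_Phi_sums)
  have "?g (Suc n) = z / b * (pochhammer a n / pochhammer (b + 1) n * z ^ n / fact n)" for n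
  proof -
    have "pochhammer a (Suc n) - pochhammer (a - 1) (Suc n) = of_nat (Suc n) * pochhammer a n"
      using pochhammer_rec[of "a - 1" n] pochhammer_rec'[of a n] by (simp add: algebra_simps)
    moreover have "?g (Suc n) = (pochhammer a (Suc n) - pochhammer (a - 1) (Suc n)) * (z ^ Suc n / (pochhammer b (Suc n) * fact (Suc n)))"
      by (simp add: divide_inverse algebra_simps del: fact_Suc power_Suc)
    ultimately have "?g (Suc n) = of_nat (Suc n) * pochhammer a n * (z ^ Suc n / (pochhammer b (Suc n) * fact (Suc n)))"
      by simp
    also have "\<dots> = z / b * (pochhammer a n / pochhammer (b + 1) n * z ^ n / fact n)"
      by (simp add: pochhammer_rec divide_inverse mult_ac del: of_nat_Suc)
    finally show ?thesis .
  qed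
  then have "(\<lambda>n. ?g (Suc n)) sums (z / b * kummer_Phi a (b + 1) z)"
    using sums_mult[OF kummer_Phi_sums[of a "b + 1" z], of "z / b"] by simp
  from sums_Suc[OF this] show "?g sums (z / b * kummer_Phi a (b + 1) z)" by simp
qed

text \<open>Kummer's equation as a composition of ladder steps: lowering b for the derivative, whose
  parameters are a + 1 and b + 1, leads to parameters a + 1 and b, and raising a reaches the same
  function.\<close>

lemma kummer_Phi_ODE:
  assumes "b \<notin> \<int>\<^sub>\<le>\<^sub>0"
  shows "z * (a * (a + 1) / (b * (b + 1)) * kummer_Phi (a + 2) (b + 2) z)
     + (b - z) * (a / b * kummer_Phi (a + 1) (b + 1) z) = a * kummer_Phi a b z"
proof -
  have nz: "b \<noteq> 0" using assms by auto
  have "z * ((a + 1) / (b + 1) * kummer_Phi (a + 2) (b + 2) z) + b * kummer_Phi (a + 1) (b + 1) z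
      = b * kummer_Phi (a + 1) b z"
    using kummer_Phi_lower_b[of "b + 1" z "a + 1"] assms by (simp add: add.assoc)
  then have "a / b * (z * ((a + 1) / (b + 1) * kummer_Phi (a + 2) (b + 2) z) + b * kummer_Phi (a + 1) (b + 1) z)
      = a / b * (b * kummer_Phi (a + 1) b z)" by simp
  also have "\<dots> = a * kummer_Phi (a + 1) b z" using nz by simp
  also have "\<dots> = z * (a / b * kummer_Phi (a + 1) (b + 1) z) + a * kummer_Phi a b z"
    by (rule kummer_Phi_raise_a[symmetric])
  finally have "a / b * (z * ((a + 1) / (b + 1) * kummer_Phi (a + 2) (b + 2) z)) + a / b * b * kummer_Phi (a + 1) (b + 1) z
      = z * (a / b * kummer_Phi (a + 1) (b + 1) z) + a * kummer_Phi a b z"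
    by (simp only: distrib_left mult.assoc)
  moreover have "z * (a * (a + 1) / (b * (b + 1)) * kummer_Phi (a + 2) (b + 2) z)
      = a / b * (z * ((a + 1) / (b + 1) * kummer_Phi (a + 2) (b + 2) z))" by simp
  moreover have "(b - z) * (a / b * kummer_Phi (a + 1) (b + 1) z)
      = a / b * b * kummer_Phi (a + 1) (b + 1) z - z * (a / b * kummer_Phi (a + 1) (b + 1) z)"
    using nz by (simp add: field_simps)
  ultimately show ?thesis by (simp only:) (simp add: algebra_simps)
qed

section \<open>Beta integrals\<close>

text \<open>In \<open>tricomi_integral_reflect\<close> at w = 0 with c = a + b, the powers of y
  combine to y^(b-1), and the remaining integral is Gamma(b).\<close>

lemma Beta_prime_integral:
  assumes a: "Re a > 0" and b: "Re b > 0"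
  shows "set_integrable lborel {0<..} (tricomi_integrand a (- (a + b)) 0)"
    and "tricomi_integral a (- (a + b)) 0 = Beta a b"
proof -
  have c: "Re (a + b) > 0" using a b by simp
  have eq: "exp (- of_real y) * of_real y powr (a + b - 1) * of_real (0 + y) powr (- a)
      = exp (- (of_real 1 * of_real y)) * (of_real y :: complex) powr (b - 1)" if "y > 0" for y :: real
    using that by (simp add: powr_add[symmetric])
  have int: "set_integrable lborel {0<..} (\<lambda>y. exp (- of_real y) * of_real y powr (a + b - 1) * of_real (0 + y) powr (- a) :: complex)"
    using has_Gamma_integral_scaled(1)[OF b, of 1] by (subst set_integrable_cong[OF refl refl eq]) auto
  note r = tricomi_integral_reflect[OF a c order_refl int]
  show "set_integrable lborel {0<..} (tricomi_integrand a (- (a + b)) 0)" using r(1) by simp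
  have "(LBINT y:{0<..}. exp (- of_real y) * of_real y powr (a + b - 1) * of_real (0 + y) powr (- a) :: complex)
      = (LBINT y:{0<..}. exp (- (of_real 1 * of_real y)) * of_real y powr (b - 1))"
    by (intro set_lebesgue_integral_cong) (use eq in auto)
  also have "\<dots> = Gamma b" using has_Gamma_integral_scaled(2)[OF b, of 1] by simp
  finally have "Gamma (a + b) * tricomi_integral a (- (a + b)) 0 = Gamma a * Gamma b"
    using r(2) by simp
  moreover have "Gamma (a + b) \<noteq> 0" using c by (rule Gamma_Re_pos_nonzero)
  ultimately show "tricomi_integral a (- (a + b)) 0 = Beta a b"
    by (simp add: Beta_def field_simps)
qed

text \<open>Transported from \<open>Beta_prime_integral\<close>: the powers of 1 + t have the
  exponents -2, 1 - a and 1 - b, which add up to -(a+b).\<close>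

lemma has_Beta_integral_complex:
  assumes a: "Re a > 0" and b: "Re b > 0"
  shows "set_integrable lborel {0<..<1} (\<lambda>s. of_real s powr (a - 1) * of_real (1 - s) powr (b - 1) :: complex)"
    and "(LBINT s:{0<..<1}. of_real s powr (a - 1) * of_real (1 - s) powr (b - 1)) = Beta a b"
proof -
  let ?f = "\<lambda>s::real. of_real s powr (a - 1) * of_real (1 - s) powr (b - 1) :: complex"
  have contf: "continuous_on {0<..<1} ?f" by (auto intro!: continuous_intros simp del: of_real_diff)
  note sub = set_integral_rational_substitution[OF contf]
  have eq: "of_real (1 / (1 + t)\<^sup>2) * ?f (t / (1 + t)) = tricomi_integrand a (- (a + b)) 0 t" if "t > 0" for t
  proof -
    let ?u = "of_real (1 + t) :: complex"
    have u: "?u \<noteq> 0" using that by (simp del: of_real_add)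
    have "1 - t / (1 + t) = 1 / (1 + t)" using that by (simp add: field_simps)
    then have "?f (t / (1 + t)) = of_real (t * inverse (1 + t)) powr (a - 1) * of_real (inverse (1 + t)) powr (b - 1)"
      by (simp add: divide_inverse)
    also have "of_real (t * inverse (1 + t)) powr (a - 1) = of_real t powr (a - 1) * of_real (inverse (1 + t)) powr (a - 1)"
      using that unfolding of_real_mult by (intro powr_times_real) auto
    also have inv: "of_real (inverse (1 + t)) powr s = ?u powr (- s)" for s :: complex
      using that by (simp add: powr_def Ln_inverse Ln_of_real del: of_real_add)
    finally have 1: "?f (t / (1 + t)) = of_real t powr (a - 1) * ?u powr (- (a - 1)) * ?u powr (- (b - 1))"
      unfolding inv by simp
    have 2: "complex_of_real (1 / (1 + t)\<^sup>2) = ?u powr (- 2)"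
      using u by (simp add: powr_minus divide_inverse)
    have "?u powr (- 2) * (?u powr (- (a - 1)) * ?u powr (- (b - 1))) = ?u powr (- (a + b))"
      using u by (simp add: powr_add[symmetric] del: of_real_add)
    then show ?thesis
      unfolding 1 2 tricomi_integrand_def by (simp add: mult_ac)
  qed
  have "set_integrable lborel {0<..} (\<lambda>t. of_real (1 / (1 + t)\<^sup>2) * ?f (t / (1 + t)))"
    using Beta_prime_integral(1)[OF a b] by (subst set_integrable_cong[OF refl refl eq]) auto
  then show "set_integrable lborel {0<..<1} ?f"
    using sub(1) by blast
  have "(LBINT s:{0<..<1}. ?f s) = (LBINT t:{0<..}. of_real (1 / (1 + t)\<^sup>2) * ?f (t / (1 + t)))"
    by (rule sub(2))
  also have "\<dots> = (LBINT t:{0<..}. tricomi_integrand a (- (a + b)) 0 t)"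
    by (intro set_lebesgue_integral_cong) (use eq in auto)
  also have "\<dots> = Beta a b" using Beta_prime_integral(2)[OF a b] by (simp add: tricomi_integral_def)
  finally show "(LBINT s:{0<..<1}. ?f s) = Beta a b" .
qed

text \<open>Euler's integral. The n-th moment of the Beta density is Beta(a+n, b) = Beta(a, b) (a)_n
  / (a+b)_n, and on the unit interval exp(|z| s) is bounded by exp |z|.\<close>

lemma kummer_Phi_integral:
  assumes a: "Re a > 0" and b: "Re b > 0"
  shows "set_integrable lborel {0<..<1} (\<lambda>s. exp (z * of_real s) * (of_real s powr (a - 1) * of_real (1 - s) powr (b - 1)))"
    and "(LBINT s:{0<..<1}. exp (z * of_real s) * (of_real s powr (a - 1) * of_real (1 - s) powr (b - 1)))
       = Beta a b * kummer_Phi a (a + b) z"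
proof -
  let ?f = "\<lambda>s::real. of_real s powr (a - 1) * of_real (1 - s) powr (b - 1) :: complex"
  have contf: "continuous_on {0<..<1} ?f" by (auto intro!: continuous_intros simp del: of_real_diff)
  have "set_integrable lborel {0<..<1} (\<lambda>s. of_real (exp (norm z)) * ?f s)"
    using has_Beta_integral_complex(1)[OF a b] by (intro set_integrable_mult_right) auto
  then have int: "set_integrable lborel {0<..<1} (\<lambda>s. exp (norm z * \<bar>s\<bar>) *\<^sub>R ?f s)"
    by (rule set_integrable_bound)
       (auto intro!: AE_I2 set_borel_measurable_lborel_continuous_on continuous_intros contf mult_right_mono
          mult_left_le simp: norm_mult)
  show "set_integrable lborel {0<..<1} (\<lambda>s. exp (z * of_real s) * ?f s)"
  proof (rule set_integrable_bound[OF int])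
    show "AE s in lborel. s \<in> {0<..<1} \<longrightarrow> norm (exp (z * of_real s) * ?f s) \<le> norm (exp (norm z * \<bar>s\<bar>) *\<^sub>R ?f s)"
    proof (intro AE_I2 impI)
      fix s :: real assume "s \<in> {0<..<1}"
      then have "Re z * s \<le> norm z * \<bar>s\<bar>" by (auto intro!: mult_right_mono complex_Re_le_cmod)
      then show "norm (exp (z * of_real s) * ?f s) \<le> norm (exp (norm z * \<bar>s\<bar>) *\<^sub>R ?f s)"
        by (simp only: norm_mult norm_scaleR norm_exp_eq_Re) (intro mult_right_mono, auto)
    qed
  qed (auto intro!: set_borel_measurable_lborel_continuous_on continuous_intros contf)
  have "(\<lambda>n. z ^ n / fact n * (LBINT s:{0<..<1}. of_real s ^ n * ?f s)) sums
       (LBINT s:{0<..<1}. exp (z * of_real s) * ?f s)"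
    by (rule set_integral_exp_sums[OF int]) (auto simp: set_borel_measurable_def)
  moreover have "z ^ n / fact n * (LBINT s:{0<..<1}. of_real s ^ n * ?f s)
      = Beta a b * (pochhammer a n / pochhammer (a + b) n * z ^ n / fact n)" for n
  proof -
    have "(LBINT s:{0<..<1}. of_real s ^ n * ?f s)
        = (LBINT s:{0<..<1}. of_real s powr (a + of_nat n - 1) * of_real (1 - s) powr (b - 1))"
    proof (intro set_lebesgue_integral_cong allI impI)
      fix s :: real assume "s \<in> {0<..<1}"
      then have "of_real s powr (a + of_nat n - 1) = (of_real s powr (of_nat n + (a - 1)) :: complex)"
        by (simp add: algebra_simps)
      also have "\<dots> = of_real s ^ n * of_real s powr (a - 1)"
        using \<open>s \<in> {0<..<1}\<close> by (subst powr_add) simp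
      finally show "of_real s ^ n * ?f s = of_real s powr (a + of_nat n - 1) * of_real (1 - s) powr (b - 1)"
        by simp
    qed auto
    also have "\<dots> = Beta (a + of_nat n) b"
      using a b by (intro has_Beta_integral_complex(2)) auto
    also have "\<dots> = Beta a b * (pochhammer a n / pochhammer (a + b) n)"
    proof -
      have "a \<notin> \<int>\<^sub>\<le>\<^sub>0" "a + b \<notin> \<int>\<^sub>\<le>\<^sub>0" "a + of_nat n \<notin> \<int>\<^sub>\<le>\<^sub>0" "a + b + of_nat n \<notin> \<int>\<^sub>\<le>\<^sub>0"
        using a b by (auto intro!: Re_pos_notin_nonpos_Ints add_pos_nonneg)
      then show ?thesis
        by (simp add: Beta_def pochhammer_Gamma Gamma_eq_zero_iff add_ac)
    qed
    finally show ?thesis by (simp only:) (simp add: mult_ac)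
  qed
  ultimately have "(\<lambda>n. Beta a b * (pochhammer a n / pochhammer (a + b) n * z ^ n / fact n)) sums
       (LBINT s:{0<..<1}. exp (z * of_real s) * ?f s)" by simp
  then show "(LBINT s:{0<..<1}. exp (z * of_real s) * ?f s) = Beta a b * kummer_Phi a (a + b) z"
    using sums_mult[OF kummer_Phi_sums[of a "a + b" z], of "Beta a b"] by (rule sums_unique2)
qed

section \<open>Scaling and symmetry of Tricomi's integral\<close>

text \<open>The substitution s = x t moves the parameter from the exponential into the base x + s.
  This is the form in which the reflected integral appears, and the one in which x can tend to
  0.\<close>

lemma tricomi_integral_scaled:
  fixes x :: real
  assumes x: "x > 0"
  shows "set_integrable lborel {0<..} (\<lambda>s. exp (- of_real s) * of_real s powr (p - 1) * of_real (x + s) powr q :: complex)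
      \<longleftrightarrow> set_integrable lborel {0<..} (tricomi_integrand p q (of_real x))"
    and "(LBINT s:{0<..}. exp (- of_real s) * of_real s powr (p - 1) * of_real (x + s) powr q)
      = of_real x powr (p + q) * tricomi_integral p q (of_real x)"
proof -
  let ?f = "\<lambda>s::real. exp (- of_real s) * of_real s powr (p - 1) * of_real (x + s) powr q :: complex"
  have cont: "continuous_on {0<..} ?f"
    using x by (auto intro!: continuous_intros simp del: of_real_add)
  note sub = set_integral_scale_Ioi[OF x cont]
  have eq: "of_real x * ?f (x * t) = of_real x powr (p + q) * tricomi_integrand p q (of_real x) t" if "t > 0" for t
  proof -
    have "of_real (x * t) powr (p - 1) = (of_real x powr (p - 1) * of_real t powr (p - 1) :: complex)"
      using x that by (simp add: powr_times_real)
    moreover have "of_real (x + x * t) powr q = (of_real x powr q * of_real (1 + t) powr q :: complex)"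
    proof -
      have "x + x * t = x * (1 + t)" by (simp add: algebra_simps)
      then show ?thesis using x that unfolding of_real_mult
        by (metis Im_complex_of_real Re_complex_of_real Reals_of_real add_nonneg_nonneg less_imp_le of_real_mult powr_times_real zero_le_one)
    qed
    moreover have "of_real x * (of_real x powr (p - 1) * of_real x powr q) = (of_real x powr (p + q) :: complex)"
      using x by (simp add: powr_diff powr_add)
    ultimately show ?thesis using x
      by (simp add: tricomi_integrand_def mult_ac del: of_real_add)
  qed
  show "set_integrable lborel {0<..} ?f \<longleftrightarrow> set_integrable lborel {0<..} (tricomi_integrand p q (of_real x))"
    unfolding sub(1) using x by (subst set_integrable_cong[OF refl refl eq]) auto
  have "(LBINT s:{0<..}. ?f s) = (LBINT t:{0<..}. of_real x powr (p + q) * tricomi_integrand p q (of_real x) t)"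
    unfolding sub(2) by (intro set_lebesgue_integral_cong) (use eq in auto)
  then show "(LBINT s:{0<..}. ?f s) = of_real x powr (p + q) * tricomi_integral p q (of_real x)"
    by (simp add: tricomi_integral_def)
qed

text \<open>Reflection followed by scaling. With c = a + 1 - b this is Kummer's transformation of
  the second solution, \<open>c - a\<close> being 1 - b.\<close>

lemma tricomi_integral_symmetry:
  fixes w :: real
  assumes a: "Re a > 0" and c: "Re c > 0" and w: "w > 0"
  shows "Gamma c * tricomi_integral a (- c) (of_real w)
       = Gamma a * (of_real w powr (c - a) * tricomi_integral c (- a) (of_real w))"
proof -
  have "set_integrable lborel {0<..} (\<lambda>y. exp (- of_real y) * of_real y powr (c - 1) * of_real (w + y) powr (- a) :: complex)"
    using tricomi_integral_scaled(1)[OF w, of c "- a"] set_integrable_tricomi_integrand[of c "of_real w" "- a"] c w by simp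
  from tricomi_integral_reflect(2)[OF a c less_imp_le[OF w] this]
  show ?thesis using tricomi_integral_scaled(2)[OF w, of c "- a"] by simp
qed

section \<open>Tricomi's integral\<close>

text \<open>Splits (1+t)^(q+1) as (1+t)^q + t (1+t)^q. The last integral is minus the derivative in
  \<open>w\<close>, so this is the integral form of the rule that raises b.\<close>

lemma tricomi_integral_raise_q:
  assumes "Re p > 0" "Re w > 0"
  shows "tricomi_integral p (q + 1) w = tricomi_integral p q w + tricomi_integral (p + 1) q w"
proof -
  have "tricomi_integral p q w + tricomi_integral (p + 1) q w
      = (LBINT t:{0<..}. tricomi_integrand p q w t + tricomi_integrand (p + 1) q w t)"
    unfolding tricomi_integral_def
    using assms by (intro set_integral_add(2)[symmetric] set_integrable_tricomi_integrand) auto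
  also have "\<dots> = tricomi_integral p (q + 1) w"
    unfolding tricomi_integral_def
  proof (intro set_lebesgue_integral_cong allI impI)
    fix t :: real assume "t \<in> {0<..}"
    then have t: "t > 0" by simp
    have "of_real (1 + t) powr (q + 1) = of_real (1 + t) * (of_real (1 + t) powr q :: complex)"
      using t by (subst powr_add) (auto simp: mult.commute simp del: of_real_add)
    moreover have "of_real t powr (p + 1 - 1) = of_real t * (of_real t powr (p - 1) :: complex)"
      using t by (simp add: powr_diff)
    ultimately show "tricomi_integrand p q w t + tricomi_integrand (p + 1) q w t = tricomi_integrand p (q + 1) w t"
      unfolding tricomi_integrand_def by (simp add: algebra_simps)
  qed auto
  finally show ?thesis by simp
qed

text \<open>The integral of the derivative of e^(-wt) t^p (1+t)^q vanishes: Re p > 0 makes the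
  boundary value at 0 zero, and Re w > 0 the one at infinity.\<close>

lemma tricomi_integral_by_parts:
  assumes p: "Re p > 0" and w: "Re w > 0"
  shows "p * tricomi_integral p q w + q * tricomi_integral (p + 1) (q - 1) w = w * tricomi_integral (p + 1) q w"
proof -
  define F where "F t = exp (- (w * of_real t)) * of_real t powr p * of_real (1 + t) powr q" for t
  define f where "f t = p * tricomi_integrand p q w t + q * tricomi_integrand (p + 1) (q - 1) w t
      - w * tricomi_integrand (p + 1) q w t" for t
  have Re1: "Re (p + 1) > 0" using p by simp
  note ints = set_integrable_tricomi_integrand[OF p w] set_integrable_tricomi_integrand[OF Re1 w]
  have int: "set_integrable lborel {0<..} f"
    unfolding f_def by (intro set_integral_add set_integral_diff set_integrable_mult_right ints)
  have contf: "continuous_on {0<..} f"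
    unfolding f_def by (intro continuous_intros)
  have ein: "einterval 0 \<infinity> = {0<..}"
    by (auto simp: einterval_def)
  have "(LBINT t=0..\<infinity>. f t) = 0 - 0"
  proof (rule interval_integral_FTC_integrable[where F = F])
    show "(F has_vector_derivative f t) (at t)" if "0 < ereal t" "ereal t < \<infinity>" for t
    proof -
      have t: "t > 0" using that by simp
      have nn: "of_real t \<notin> \<real>\<^sub>\<le>\<^sub>0" "1 + of_real t \<notin> (\<real>\<^sub>\<le>\<^sub>0 :: complex set)"
        using t by (auto simp: complex_nonpos_Reals_iff)
      let ?D = "(- w) * (exp (- (w * of_real t)) * of_real t powr p * (1 + of_real t) powr q)
          + exp (- (w * of_real t)) * (p * of_real t powr (p - 1)) * (1 + of_real t) powr q
          + exp (- (w * of_real t)) * of_real t powr p * (q * (1 + of_real t) powr (q - 1))"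
      \<comment> \<open>The derivative is taken in the complex plane off the branch cuts and then
        restricted to the real axis.\<close>
      have "((\<lambda>z. exp (- (w * z)) * z powr p * (1 + z) powr q) has_field_derivative
          ?D) (at (of_real t))"
        using nn by (auto intro!: derivative_eq_intros has_field_derivative_powr simp: algebra_simps)
      from has_vector_derivative_real_field[OF this]
      have "((\<lambda>x. F x) has_vector_derivative
          ?D) (at t)"
        unfolding F_def by simp
      also have "?D = f t"
        unfolding f_def tricomi_integrand_def by (simp add: algebra_simps)
      finally show ?thesis .
    qed
    show "isCont f t" if "0 < ereal t" "ereal t < \<infinity>" for t
      using contf that by (simp add: continuous_on_eq_continuous_at)
    show "set_integrable lborel (einterval 0 \<infinity>) f" unfolding ein by (rule int)
    \<comment> \<open>One majorant serves both ends: it vanishes at 0 through t^(Re p) and at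
      infinity through the remaining half of the exponential decay.\<close>
    have ub: "\<exists>C. C \<ge> 0 \<and> (\<forall>t>0. norm (F t) \<le> C * exp (- (Re w / 2 * t)) * t powr Re p)"
    proof -
      obtain C where C: "C \<ge> 0" "\<And>t. t \<ge> 0 \<Longrightarrow> (1 + t) powr Re q \<le> C * exp (Re w / 2 * t)"
        using powr_le_const_exp[of "Re w / 2" "Re q"] w by auto
      have "norm (F t) \<le> C * exp (- (Re w / 2 * t)) * t powr Re p" if "t > 0" for t
      proof -
        have "norm (F t) = exp (- (Re w * t)) * t powr Re p * (1 + t) powr Re q"
          unfolding F_def using that by (simp add: norm_mult norm_powr_real_powr del: of_real_add)
        also have "\<dots> \<le> exp (- (Re w * t)) * t powr Re p * (C * exp (Re w / 2 * t))"
          using C(2)[of t] that by (intro mult_left_mono) auto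
        also have "\<dots> = C * (exp (- (Re w * t)) * exp (Re w / 2 * t)) * t powr Re p" by simp
        also have "exp (- (Re w * t)) * exp (Re w / 2 * t) = exp (- (Re w / 2 * t))"
          by (simp add: exp_add[symmetric] field_simps)
        finally show ?thesis .
      qed
      with C(1) show ?thesis by blast
    qed
    then obtain C where C: "\<And>t. t > 0 \<Longrightarrow> norm (F t) \<le> C * exp (- (Re w / 2 * t)) * t powr Re p" by blast
    have ev0: "\<forall>\<^sub>F t in at_right 0. norm (F t) \<le> C * exp (- (Re w / 2 * t)) * t powr Re p"
      by (rule eventually_mono[OF eventually_at_right_less]) (rule C)
    have p0: "((\<lambda>t. t powr Re p) \<longlongrightarrow> 0) (at_right 0)"
      using p by real_asymp
    have "((\<lambda>t. C * exp (- (Re w / 2 * t)) * t powr Re p) \<longlongrightarrow> C * exp (- (Re w / 2 * 0)) * 0) (at_right 0)"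
      by (intro tendsto_mult tendsto_const tendsto_exp tendsto_minus tendsto_ident_at p0)
    then have lim0: "((\<lambda>t. C * exp (- (Re w / 2 * t)) * t powr Re p) \<longlongrightarrow> 0) (at_right 0)"
      unfolding mult_zero_right .
    have "(F \<longlongrightarrow> 0) (at_right 0)"
      by (rule Lim_null_comparison[OF ev0 lim0])
    then show "((F \<circ> real_of_ereal) \<longlongrightarrow> 0) (at_right 0)"
      unfolding zero_ereal_def ereal_tendsto_simps .
    have lim1: "((\<lambda>t. C * exp (- (Re w / 2 * t)) * t powr Re p) \<longlongrightarrow> 0) at_top"
      using p w by real_asymp
    have ev1: "\<forall>\<^sub>F t in at_top. norm (F t) \<le> C * exp (- (Re w / 2 * t)) * t powr Re p"
      by (rule eventually_mono[OF eventually_gt_at_top[of 0]]) (rule C)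
    have "(F \<longlongrightarrow> 0) at_top"
      by (rule Lim_null_comparison[OF ev1 lim1])
    then show "((F \<circ> real_of_ereal) \<longlongrightarrow> 0) (at_left \<infinity>)"
      unfolding ereal_tendsto_simps by simp
  qed simp
  then have "0 = (LBINT t:{0<..}. f t)"
    by (simp add: interval_lebesgue_integral_def ein)
  also have "\<dots> = p * tricomi_integral p q w + q * tricomi_integral (p + 1) (q - 1) w
      - w * tricomi_integral (p + 1) q w"
    unfolding f_def tricomi_integral_def
    by (subst set_integral_diff set_integral_add; (intro set_integral_add set_integrable_mult_right ints)?)+ simp
  finally show ?thesis by simp
qed

lemma has_field_derivative_tricomi_integral:
  assumes p: "Re p > 0" and w: "Re w > 0"
  shows "(tricomi_integral p q has_field_derivative - tricomi_integral (p + 1) q w) (at w)"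
proof -
  \<comment> \<open>Expanding the exponential makes the integral a power series in \<open>w - u\<close>.\<close>
  define c where "c n = (LBINT t:{0<..}. of_real t ^ n * tricomi_integrand p q w t) / fact n" for n
  \<comment> \<open>The majorant exp(|w-u| t) replaces w by w - |w-u|, whose real part is positive
    exactly for |w-u| < Re w; this is the disc of convergence obtained.\<close>
  have sums: "(\<lambda>n. c n * (w - u) ^ n) sums tricomi_integral p q u" if u: "norm (w - u) < Re w" for u
  proof -
    have "Re (w - of_real (norm (w - u))) > 0" using u by simp
    then have "set_integrable lborel {0<..} (tricomi_integrand p q (w - of_real (norm (w - u))))"
      by (rule set_integrable_tricomi_integrand[OF p])
    moreover have "tricomi_integrand p q (w - of_real (norm (w - u))) t = exp (norm (w - u) * \<bar>t\<bar>) *\<^sub>R tricomi_integrand p q w t"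
      if "t \<in> {0<..}" for t
      using that unfolding tricomi_integrand_def scaleR_conv_of_real
      by (simp add: exp_of_real[symmetric] mult.assoc[symmetric] exp_add[symmetric] left_diff_distrib)
    ultimately have "set_integrable lborel {0<..} (\<lambda>t. exp (norm (w - u) * \<bar>t\<bar>) *\<^sub>R tricomi_integrand p q w t)"
      by (subst (asm) set_integrable_cong[OF refl refl]) auto
    then have "(\<lambda>n. (w - u) ^ n / fact n * (LBINT t:{0<..}. of_real t ^ n * tricomi_integrand p q w t)) sums
       (LBINT t:{0<..}. exp ((w - u) * of_real t) * tricomi_integrand p q w t)"
      by (rule set_integral_exp_sums) (auto simp: set_borel_measurable_def)
    moreover have "exp ((w - u) * of_real t) * tricomi_integrand p q w t = tricomi_integrand p q u t" for t
      unfolding tricomi_integrand_def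
      by (simp add: mult.assoc[symmetric] exp_add[symmetric] left_diff_distrib)
    ultimately show ?thesis by (simp add: c_def tricomi_integral_def mult_ac divide_inverse)
  qed
  have c1: "c 1 = tricomi_integral (p + 1) q w"
    unfolding c_def tricomi_integral_def
    by (simp, intro set_lebesgue_integral_cong) (auto simp: tricomi_integrand_def powr_diff)
  define G where "G h = (\<Sum>n. c n * h ^ n)" for h
  have "ereal (Re w / 2) \<le> conv_radius c"
  proof -
    have "summable (\<lambda>n. c n * (w - (w - of_real (Re w / 2))) ^ n)"
      using sums[of "w - of_real (Re w / 2)"] w by (simp add: sums_iff)
    then have "summable (\<lambda>n. c n * of_real (Re w / 2) ^ n)" by simp
    from conv_radius_geI[OF this] w show ?thesis by simp
  qed
  then have "ereal (norm (0 :: complex)) < conv_radius c"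
    using w by (simp add: zero_ereal_def[symmetric] less_le_trans[of 0 "ereal (Re w / 2)"])
  then have "(G has_field_derivative (\<Sum>n. diffs c n * 0 ^ n)) (at 0)"
    unfolding G_def by (rule has_field_derivative_powser)
  also have "(\<Sum>n. diffs c n * 0 ^ n) = c 1"
    using powser_zero[of "diffs c"] by (simp add: diffs_def)
  finally have "(G has_field_derivative c 1) (at (w - w))" by simp
  then have "((\<lambda>u. G (w - u)) has_field_derivative c 1 * (0 - 1)) (at w)"
    by (rule DERIV_chain2) (auto intro!: derivative_eq_intros)
  moreover have "\<forall>\<^sub>F u in nhds w. G (w - u) = tricomi_integral p q u"
  proof -
    have "\<forall>\<^sub>F u in nhds w. u \<in> ball w (Re w)"
      using w by (intro eventually_nhds_in_open) auto
    then show ?thesis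
      by eventually_elim (use sums in \<open>auto simp: G_def sums_iff dist_norm\<close>)
  qed
  ultimately have "(tricomi_integral p q has_field_derivative c 1 * (0 - 1)) (at w)"
    by (subst (asm) DERIV_cong_ev[OF refl _ refl]) auto
  then show ?thesis by (simp add: c1[simplified])
qed

section \<open>The connection formula\<close>

lemma set_integral_dominated_convergence:
  fixes f :: "'a \<Rightarrow> 'b::{banach, second_countable_topology}" and w :: "'a \<Rightarrow> real"
  assumes w: "set_integrable M A w"
    and "\<And>n. set_borel_measurable M A (s n)" "set_borel_measurable M A f"
    and lim: "\<And>x. x \<in> A \<Longrightarrow> (\<lambda>n. s n x) \<longlonglongrightarrow> f x"
    and bound: "\<And>n x. x \<in> A \<Longrightarrow> norm (s n x) \<le> w x"
  shows "(\<lambda>n. LINT x:A|M. s n x) \<longlonglongrightarrow> (LINT x:A|M. f x)"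
  unfolding set_lebesgue_integral_def
proof (rule integral_dominated_convergence)
  show "integrable M (\<lambda>x. indicator A x *\<^sub>R w x)" using w by (simp add: set_integrable_def)
  show "AE x in M. (\<lambda>n. indicator A x *\<^sub>R s n x) \<longlonglongrightarrow> indicator A x *\<^sub>R f x"
    using lim by (auto simp: indicator_def)
  show "AE x in M. norm (indicator A x *\<^sub>R s n x) \<le> indicator A x *\<^sub>R w x" for n
    using bound by (auto simp: indicator_def)
qed (use assms(2,3) in \<open>simp_all add: set_borel_measurable_def\<close>)

text \<open>For w >= 0 the factor e^(-wt) is at most 1, so the Beta integrand at w = 0 dominates. A
  limit along one sequence is enough to identify a constant.\<close>

lemma tricomi_integral_limit_0:
  assumes a: "Re a > 0" and b: "Re b > 0"
  shows "(\<lambda>n. tricomi_integral a (- (a + b)) (of_real (inverse (real (Suc n))))) \<longlonglongrightarrow> Beta a b"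
proof -
  have "(\<lambda>n. LBINT t:{0<..}. tricomi_integrand a (- (a + b)) (of_real (inverse (real (Suc n)))) t)
      \<longlonglongrightarrow> (LBINT t:{0<..}. tricomi_integrand a (- (a + b)) 0 t)"
  proof (rule set_integral_dominated_convergence)
    show "set_integrable lborel {0<..} (\<lambda>t. norm (tricomi_integrand a (- (a + b)) 0 t))"
      using Beta_prime_integral(1)[OF a b] by (rule set_integrable_norm)
    show "(\<lambda>n. tricomi_integrand a (- (a + b)) (of_real (inverse (real (Suc n)))) t)
      \<longlonglongrightarrow> tricomi_integrand a (- (a + b)) 0 t" for t
      unfolding tricomi_integrand_def
      by (intro tendsto_intros tendsto_of_real_iff[THEN iffD2, of _ 0, simplified] LIMSEQ_inverse_real_of_nat)
    show "norm (tricomi_integrand a (- (a + b)) (of_real (inverse (real (Suc n)))) t)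
        \<le> norm (tricomi_integrand a (- (a + b)) 0 t)" if "t \<in> {0<..}" for t n
      using that by (auto simp: norm_tricomi_integrand intro!: mult_right_mono)
  qed (intro set_borel_measurable_lborel_continuous_on open_greaterThan continuous_on_tricomi_integrand)+
  then show ?thesis
    using Beta_prime_integral(2)[OF a b] by (simp add: tricomi_integral_def)
qed

text \<open>After scaling, the integrand is e^(-s) s^(a-1) (x+s)^(b-a), which tends to the integrand
  e^(-s) s^(b-1) of Gamma(b) as x tends to 0.\<close>

lemma tricomi_integral_asymptotic_0:
  assumes a: "Re a > 0" and b: "Re b > 0"
  shows "(\<lambda>n. of_real (inverse (real (Suc n))) powr b * tricomi_integral a (b - a) (of_real (inverse (real (Suc n))))) \<longlonglongrightarrow> Gamma b"
proof -
  let ?x = "\<lambda>n. inverse (real (Suc n))"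
  let ?s = "\<lambda>x s. exp (- of_real s) * of_real s powr (a - 1) * of_real (x + s) powr (b - a) :: complex"
  have x: "0 < ?x n" "?x n \<le> 1" for n by (auto simp: field_simps)
  have "(\<lambda>n. LBINT s:{0<..}. ?s (?x n) s) \<longlonglongrightarrow> (LBINT s:{0<..}. ?s 0 s)"
  proof (rule set_integral_dominated_convergence)
    have "set_integrable lborel {0<..} (\<lambda>s. norm (exp (- (of_real 1 * of_real s)) * (of_real s :: complex) powr (b - 1))
        + norm (tricomi_integrand a (b - a) 1 s))"
      using has_Gamma_integral_scaled(1)[OF b, of 1] set_integrable_tricomi_integrand[OF a, of 1 "b - a"]
      by (intro set_integral_add set_integrable_norm) auto
    then show "set_integrable lborel {0<..} (\<lambda>s. norm (exp (- (of_real 1 * of_real s)) * (of_real s :: complex) powr (b - 1))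
        + norm (tricomi_integrand a (b - a) 1 s))" .
    show "(\<lambda>n. ?s (?x n) s) \<longlonglongrightarrow> ?s 0 s" if "s \<in> {0<..}" for s
    proof -
      have "(\<lambda>n. complex_of_real (?x n + s)) \<longlonglongrightarrow> of_real (0 + s)"
        by (intro tendsto_of_real tendsto_add LIMSEQ_inverse_real_of_nat tendsto_const)
      then have "(\<lambda>n. of_real (?x n + s) powr (b - a)) \<longlonglongrightarrow> (of_real (0 + s) powr (b - a) :: complex)"
        using that by (intro tendsto_powr_complex) (auto simp: complex_nonpos_Reals_iff)
      then show ?thesis by (intro tendsto_mult tendsto_const)
    qed
    show "norm (?s (?x n) s) \<le> norm (exp (- (of_real 1 * of_real s)) * (of_real s :: complex) powr (b - 1))
        + norm (tricomi_integrand a (b - a) 1 s)" if "s \<in> {0<..}" for s n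
    proof -
      have s: "s > 0" using that by simp
      \<comment> \<open>For 0 < x <= 1 the base lies between s and 1 + s. Which end is larger
        depends on the sign of the exponent; the sum of both bounds covers the two cases.\<close>
      have "(?x n + s) powr Re (b - a) \<le> s powr Re (b - a) + (1 + s) powr Re (b - a)"
      proof (cases "Re (b - a) \<ge> 0")
        case True
        then have "(?x n + s) powr Re (b - a) \<le> (1 + s) powr Re (b - a)"
          using x[of n] s by (intro powr_mono2) auto
        then show ?thesis by (simp add: add_increasing)
      next
        case False
        then have "(?x n + s) powr Re (b - a) \<le> s powr Re (b - a)"
          using x[of n] s by (intro powr_mono2') auto
        then show ?thesis by (simp add: add_increasing2)
      qed
      then have "norm (?s (?x n) s) \<le> exp (- s) * s powr (Re a - 1) * (s powr Re (b - a) + (1 + s) powr Re (b - a))"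
        using s x(1)[of n] by (simp add: norm_mult norm_powr_real_powr mult_left_mono del: of_real_add of_nat_Suc)
      also have "\<dots> = exp (- s) * (s powr (Re a - 1) * s powr Re (b - a)) + norm (tricomi_integrand a (b - a) 1 s)"
        using s by (simp add: norm_tricomi_integrand algebra_simps)
      also have "s powr (Re a - 1) * s powr Re (b - a) = s powr (Re b - 1)"
        by (simp add: powr_add[symmetric])
      finally show ?thesis using s by (simp add: norm_mult norm_powr_real_powr)
    qed
    have "continuous_on {0<..} (?s y)" if "y \<ge> 0" for y
      using that by (auto intro!: continuous_intros simp del: of_real_add)
    note cont = set_borel_measurable_lborel_continuous_on[OF open_greaterThan this]
    show "set_borel_measurable lborel {0<..} (?s (?x n))" for n
      by (rule cont) (rule less_imp_le[OF x(1)])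
    show "set_borel_measurable lborel {0<..} (?s 0)"
      by (rule cont) (rule order_refl)
  qed
  also have "(LBINT s:{0<..}. ?s 0 s) = (LBINT s:{0<..}. exp (- (of_real 1 * of_real s)) * of_real s powr (b - 1))"
    by (intro set_lebesgue_integral_cong) (auto simp: powr_add[symmetric])
  also have "\<dots> = Gamma b" using has_Gamma_integral_scaled(2)[OF b, of 1] by simp
  finally show ?thesis
    using tricomi_integral_scaled(2)[OF x(1), where p = a and q = "b - a"] by simp
qed

section \<open>Wronskians and the connection coefficients\<close>

lemma notin_Ints_imp_notin_nonpos_Ints: "z \<notin> \<int> \<Longrightarrow> z \<notin> \<int>\<^sub>\<le>\<^sub>0"
  by (auto elim!: nonpos_Ints_cases)

lemma notin_Ints_shift:
  fixes b :: complex
  assumes "b \<notin> \<int>"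
  shows "of_int n - b \<notin> \<int>" "b - of_int n \<notin> \<int>"
proof -
  show "of_int n - b \<notin> \<int>"
  proof
    assume "of_int n - b \<in> \<int>"
    then have "of_int n - (of_int n - b) \<in> \<int>" by (intro Ints_diff) auto
    with assms show False by simp
  qed
  show "b - of_int n \<notin> \<int>"
  proof
    assume "b - of_int n \<in> \<int>"
    then have "b - of_int n + of_int n \<in> \<int>" by (intro Ints_add) auto
    with assms show False by simp
  qed
qed

text \<open>Says that the derivative of z^(1-b) P is (1-b) z^(-b) Q, where P and Q have the
  parameters (a+1-b, 2-b) and (a+1-b, 1-b), with the common factor z^(-b) removed.\<close>

lemma kummer_Phi_lower_b_reflected:
  assumes "b \<notin> \<int>"
  shows "z * ((a + 1 - b) / (2 - b) * kummer_Phi (a + 1 - b + 1) (2 - b + 1) z) + (1 - b) * kummer_Phi (a + 1 - b) (2 - b) z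
    = (1 - b) * kummer_Phi (a + 1 - b) (1 - b) z"
proof -
  have e: "2 - b - 1 = of_int 1 - b" by simp
  then have "2 - b - 1 \<notin> \<int>\<^sub>\<le>\<^sub>0"
    using notin_Ints_shift(1)[OF assms, of 1] notin_Ints_imp_notin_nonpos_Ints by (simp only:)
  from kummer_Phi_lower_b[OF this, of z "a + 1 - b"] show ?thesis unfolding e by simp
qed

text \<open>
  The weighted Wronskian \<open>z\<^bsup>b\<^esup> e\<^bsup>-z\<^esup> (F u' - F' u)\<close> with the second solution
  \<open>u = z\<^bsup>1-b\<^esup> \<Phi>(a+1-b, 2-b; z)\<close> is written without the power of \<open>z\<close>, so that it also makes sense at
  \<open>z = 0\<close>.
\<close>

lemma kummer_second_Wronskian_constant:
  assumes b: "b \<notin> \<int>" and S: "convex S"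
    and F: "\<And>z. z \<in> S \<Longrightarrow> (F has_field_derivative F' z) (at z)"
    and F': "\<And>z. z \<in> S \<Longrightarrow> (F' has_field_derivative F'' z) (at z)"
    and ode: "\<And>z. z \<in> S \<Longrightarrow> z * F'' z + (b - z) * F' z = a * F z"
  obtains c where "\<And>z. z \<in> S \<Longrightarrow> exp (- z) * ((1 - b) * F z * kummer_Phi (a + 1 - b) (1 - b) z
      - z * F' z * kummer_Phi (a + 1 - b) (2 - b) z) = c"
proof -
  let ?W = "\<lambda>z. exp (- z) * ((1 - b) * F z * kummer_Phi (a + 1 - b) (1 - b) z
      - z * F' z * kummer_Phi (a + 1 - b) (2 - b) z)"
  have b1: "1 - b \<noteq> 0" using b by auto
  have "(?W has_field_derivative 0) (at z within S)" if z: "z \<in> S" for z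
  proof -
    define P where "P = kummer_Phi (a + 1 - b) (2 - b) z"
    define Q where "Q = kummer_Phi (a + 1 - b) (1 - b) z"
    define R where "R = (a + 1 - b) / (2 - b) * kummer_Phi (a + 1 - b + 1) (2 - b + 1) z"
    define T where "T = (a + 1 - b) / (1 - b) * kummer_Phi (a + 1 - b + 1) (1 - b + 1) z"
    have D': "((\<lambda>z. exp (- z) * ((1 - b) * F z * q z - z * F' z * p z)) has_field_derivative
        - exp (- z) * ((1 - b) * F z * q z - z * F' z * p z)
        + exp (- z) * ((1 - b) * F' z * q z + (1 - b) * F z * t - F' z * p z - z * F'' z * p z - z * F' z * r)) (at z)"
      if "(p has_field_derivative r) (at z)" "(q has_field_derivative t) (at z)" for p q r t
      using F[OF z] F'[OF z] that
      by (auto intro!: derivative_eq_intros simp: algebra_simps)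
    have D: "(?W has_field_derivative
        - exp (- z) * ((1 - b) * F z * Q - z * F' z * P)
        + exp (- z) * ((1 - b) * F' z * Q + (1 - b) * F z * T - F' z * P - z * F'' z * P - z * F' z * R)) (at z)"
      unfolding P_def Q_def R_def T_def by (rule D'; rule has_field_derivative_kummer_Phi)
    have b2: "1 - b + 1 = 2 - b" by simp
    \<comment> \<open>R and T are the derivatives of P and Q. Expressing (1-b) Q and (1-b) T through
      P and R, and eliminating z F'' by the equation, makes the derivative of the Wronskian
      cancel.\<close>
    have "(1 - b) * T = (a + 1 - b) * kummer_Phi (a + 1 - b + 1) (2 - b) z"
      unfolding T_def b2 mult.assoc[symmetric] using b1 by (simp only: nonzero_mult_div_cancel_left times_divide_eq_right not_False_eq_True)
    also have "\<dots> = z * R + (a + 1 - b) * P"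
      unfolding R_def P_def by (rule kummer_Phi_raise_a[symmetric])
    finally have T: "(1 - b) * T = z * R + (a + 1 - b) * P" .
    have Q: "(1 - b) * Q = z * R + (1 - b) * P"
      unfolding Q_def P_def R_def by (rule kummer_Phi_lower_b_reflected[OF b, symmetric])
    have o: "z * F'' z = a * F z - (b - z) * F' z"
      using ode[OF z] by (simp add: algebra_simps)
    have "- ((1 - b) * F z * Q - z * F' z * P)
       + ((1 - b) * F' z * Q + (1 - b) * F z * T - F' z * P - z * F'' z * P - z * F' z * R)
      = - F z * ((1 - b) * Q) + z * F' z * P + F' z * ((1 - b) * Q) + F z * ((1 - b) * T)
         - F' z * P - (z * F'' z) * P - z * F' z * R" by (simp add: algebra_simps)
    also have "\<dots> = 0" unfolding T Q o by (simp add: algebra_simps)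
    finally have "exp (- z) * (- ((1 - b) * F z * Q - z * F' z * P)
       + ((1 - b) * F' z * Q + (1 - b) * F z * T - F' z * P - z * F'' z * P - z * F' z * R)) = 0" by simp
    then have "- exp (- z) * ((1 - b) * F z * Q - z * F' z * P)
        + exp (- z) * ((1 - b) * F' z * Q + (1 - b) * F z * T - F' z * P - z * F'' z * P - z * F' z * R) = 0"
      by (simp only: distrib_left mult_minus_left mult_minus_right)
    then show ?thesis by (rule has_field_derivative_at_within[OF DERIV_cong[OF D]])
  qed
  from has_field_derivative_zero_constant[OF S this] that show ?thesis by blast
qed

text \<open>Abel's identity: Kummer's equation gives z W' = -(b - z) W for the Wronskian W of two
  solutions, and z^b e^(-z) is the factor that compensates this. The set avoids the cut of the
  principal power.\<close>

lemma kummer_first_Wronskian_constant: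
  assumes b: "b \<notin> \<int>\<^sub>\<le>\<^sub>0" and S: "convex S" "S \<inter> \<real>\<^sub>\<le>\<^sub>0 = {}"
    and F: "\<And>z. z \<in> S \<Longrightarrow> (F has_field_derivative F' z) (at z)"
    and F': "\<And>z. z \<in> S \<Longrightarrow> (F' has_field_derivative F'' z) (at z)"
    and ode: "\<And>z. z \<in> S \<Longrightarrow> z * F'' z + (b - z) * F' z = a * F z"
  obtains c where "\<And>z. z \<in> S \<Longrightarrow> z powr b * exp (- z) * (F z * (a / b * kummer_Phi (a + 1) (b + 1) z)
      - F' z * kummer_Phi a b z) = c"
proof -
  let ?W = "\<lambda>z. z powr b * exp (- z) * (F z * (a / b * kummer_Phi (a + 1) (b + 1) z)
      - F' z * kummer_Phi a b z)"
  have "(?W has_field_derivative 0) (at z within S)" if z: "z \<in> S" for z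
  proof -
    have nz: "z \<notin> \<real>\<^sub>\<le>\<^sub>0" using S z by blast
    then have z0: "z \<noteq> 0" by auto
    define P where "P = kummer_Phi a b z"
    define Q where "Q = a / b * kummer_Phi (a + 1) (b + 1) z"
    define R where "R = a / b * ((a + 1) / (b + 1) * kummer_Phi (a + 1 + 1) (b + 1 + 1) z)"
    have D': "((\<lambda>z. z powr b * exp (- z) * (F z * q z - F' z * p z)) has_field_derivative
        (b * z powr (b - 1)) * exp (- z) * (F z * q z - F' z * p z)
        + z powr b * (- exp (- z)) * (F z * q z - F' z * p z)
        + z powr b * exp (- z) * (F' z * q z + F z * r - F'' z * p z - F' z * q z)) (at z)"
      if "(p has_field_derivative q z) (at z)" "(q has_field_derivative r) (at z)" for p q r
    proof -
      have e: "((\<lambda>z. exp (- z)) has_field_derivative - exp (- z)) (at z)"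
        by (auto intro!: derivative_eq_intros)
      show ?thesis
        by (rule DERIV_cong[OF DERIV_mult[OF DERIV_mult[OF has_field_derivative_powr[OF nz] e]
              DERIV_diff[OF DERIV_mult[OF F[OF z] that(2)] DERIV_mult[OF F'[OF z] that(1)]]]])
           (simp add: algebra_simps)
    qed
    have D: "(?W has_field_derivative
        (b * z powr (b - 1)) * exp (- z) * (F z * Q - F' z * P)
        + z powr b * (- exp (- z)) * (F z * Q - F' z * P)
        + z powr b * exp (- z) * (F' z * Q + F z * R - F'' z * P - F' z * Q)) (at z)"
      unfolding P_def Q_def R_def
      by (rule D'; intro DERIV_cmult has_field_derivative_kummer_Phi)
    have p: "z powr b = z * z powr (b - 1)" using z0 by (simp add: powr_diff)
    have u: "z * R + (b - z) * Q = a * P"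
      using kummer_Phi_ODE[OF b, of z a] unfolding P_def Q_def R_def by (simp add: add.assoc mult.assoc)
    have zR: "z * R = a * P - (b - z) * Q" using u by (simp add: algebra_simps)
    have o: "z * F'' z = a * F z - (b - z) * F' z"
      using ode[OF z] by (simp add: algebra_simps)
    have "(b * z powr (b - 1)) * exp (- z) * (F z * Q - F' z * P)
        + z powr b * (- exp (- z)) * (F z * Q - F' z * P)
        + z powr b * exp (- z) * (F' z * Q + F z * R - F'' z * P - F' z * Q)
      = z powr (b - 1) * exp (- z) * ((b - z) * (F z * Q - F' z * P) + F z * (z * R) - (z * F'' z) * P)"
      unfolding p by (simp add: algebra_simps)
    also have "\<dots> = 0" unfolding zR o by (simp add: algebra_simps)
    finally show ?thesis by (rule has_field_derivative_at_within[OF DERIV_cong[OF D]])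
  qed
  from has_field_derivative_zero_constant[OF S(1) this] that show ?thesis by blast
qed

text \<open>Integration by parts with exponent b - a produces two integrals with that exponent, and
  \<open>tricomi_integral_raise_q\<close> brings both back to b - a - 1. The shifts by 1 and 2 in
  the first exponent stand for the derivatives, with sign.\<close>

lemma tricomi_integral_ODE:
  assumes a: "Re a > 0" and z: "Re z > 0"
  shows "z * tricomi_integral (a + 2) (b - a - 1) z + (b - z) * - tricomi_integral (a + 1) (b - a - 1) z
    = a * tricomi_integral a (b - a - 1) z"
proof -
  let ?F = "tricomi_integral a (b - a - 1) z" and ?F1 = "tricomi_integral (a + 1) (b - a - 1) z"
    and ?F2 = "tricomi_integral (a + 2) (b - a - 1) z"
  have a1: "Re (a + 1) > 0" using a by simp
  have 1: "a * tricomi_integral a (b - a) z + (b - a) * ?F1 = z * tricomi_integral (a + 1) (b - a) z"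
    using tricomi_integral_by_parts[OF a z, of "b - a"] by simp
  have 2: "tricomi_integral a (b - a) z = ?F + ?F1"
    using tricomi_integral_raise_q[OF a z, of "b - a - 1"] by simp
  have 3: "tricomi_integral (a + 1) (b - a) z = ?F1 + ?F2"
    using tricomi_integral_raise_q[OF a1 z, of "b - a - 1"] by (simp add: add.assoc)
  show ?thesis using 1 unfolding 2 3 by (simp add: algebra_simps)
qed

lemma DERIV_tricomi_integral':
  assumes "Re a > 0" "Re z > 0"
  shows "(tricomi_integral a q has_field_derivative - tricomi_integral (a + 1) q z) (at z)"
    and "((\<lambda>z. - tricomi_integral (a + 1) q z) has_field_derivative tricomi_integral (a + 2) q z) (at z)"
proof -
  show "(tricomi_integral a q has_field_derivative - tricomi_integral (a + 1) q z) (at z)"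
    using assms by (rule has_field_derivative_tricomi_integral)
  have "Re (a + 1) > 0" using assms by simp
  from DERIV_minus[OF has_field_derivative_tricomi_integral[OF this assms(2), of q]]
  show "((\<lambda>z. - tricomi_integral (a + 1) q z) has_field_derivative tricomi_integral (a + 2) q z) (at z)"
    by (simp add: add.assoc)
qed

lemma Gamma_plus1_shift:
  fixes z :: complex
  assumes "z \<notin> \<int>"
  shows "Gamma (z + 1) = z * Gamma z"
  using assms by (intro Gamma_plus1) (auto elim!: nonpos_Ints_cases)

text \<open>Three weighted Wronskians are constant: \<open>?W1\<close> and \<open>?W2\<close> pair
  the integral \<open>?F\<close> with the two solutions, \<open>?W0\<close> pairs the solutions with
  each other. A linear relation between them is solved for \<open>?F\<close>.\<close>

lemma tricomi_integral_eq_kummer_Psi_nonint_strip: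
  assumes a: "Re a > 0" and b: "0 < Re b" "Re b \<le> 1" "b \<notin> \<int>" and z: "Re z > 0"
  shows "tricomi_integral a (b - a - 1) z = Gamma a * kummer_Psi_nonint a b z"
proof -
  let ?S = "{z. Re z > 0}" and ?q = "b - a - 1"
  let ?F = "tricomi_integral a ?q" and ?F' = "\<lambda>z. - tricomi_integral (a + 1) ?q z"
    and ?F'' = "tricomi_integral (a + 2) ?q"
  let ?u = "kummer_Phi a b" and ?u' = "\<lambda>z. a / b * kummer_Phi (a + 1) (b + 1) z"
  let ?u'' = "\<lambda>z. a / b * ((a + 1) / (b + 1) * kummer_Phi (a + 1 + 1) (b + 1 + 1) z)"
  let ?P = "kummer_Phi (a + 1 - b) (2 - b)" and ?Q = "kummer_Phi (a + 1 - b) (1 - b)"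
  let ?x = "\<lambda>n. of_real (inverse (real (Suc n))) :: complex"
  let ?W1 = "\<lambda>z. z powr b * exp (- z) * (?F z * ?u' z - ?F' z * ?u z)"
  let ?W2 = "\<lambda>z. exp (- z) * ((1 - b) * ?F z * ?Q z - z * ?F' z * ?P z)"
  let ?W0 = "\<lambda>z. exp (- z) * ((1 - b) * ?u z * ?Q z - z * ?u' z * ?P z)"
  have bn: "b \<notin> \<int>\<^sub>\<le>\<^sub>0" using notin_Ints_imp_notin_nonpos_Ints[OF b(3)] .
  have b1: "1 - b \<noteq> 0" using b(3) by auto
  have x: "?x n \<in> ?S" for n by simp
  have x0: "?x \<longlonglongrightarrow> 0"
    using tendsto_of_real[OF LIMSEQ_inverse_real_of_nat] by (simp only: of_real_0)
  have S0: "?S \<inter> \<real>\<^sub>\<le>\<^sub>0 = {}" by (auto simp: complex_nonpos_Reals_iff)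
  have dF: "(?F has_field_derivative ?F' z) (at z)" "(?F' has_field_derivative ?F'' z) (at z)"
    if "z \<in> ?S" for z
    using DERIV_tricomi_integral'[OF a] that by auto
  have odeF: "z * ?F'' z + (b - z) * ?F' z = a * ?F z" if "z \<in> ?S" for z
    using tricomi_integral_ODE[OF a] that by auto
  obtain c1 where c1: "\<And>z. z \<in> ?S \<Longrightarrow> ?W1 z = c1"
  proof (rule kummer_first_Wronskian_constant[OF bn convex_halfspace_Re_gt S0 dF odeF])
    fix c assume *: "\<And>z. z \<in> ?S \<Longrightarrow> ?W1 z = c"
    assume **: "\<And>c1. (\<And>z. z \<in> ?S \<Longrightarrow> ?W1 z = c1) \<Longrightarrow> thesis"
    show thesis by (rule **) (rule *)
  qed
  obtain c2 where c2: "\<And>z. z \<in> ?S \<Longrightarrow> ?W2 z = c2"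
  proof (rule kummer_second_Wronskian_constant[OF b(3) convex_halfspace_Re_gt dF odeF])
    fix c assume *: "\<And>z. z \<in> ?S \<Longrightarrow> ?W2 z = c"
    assume **: "\<And>c2. (\<And>z. z \<in> ?S \<Longrightarrow> ?W2 z = c2) \<Longrightarrow> thesis"
    show thesis by (rule **) (rule *)
  qed
  have du: "(?u has_field_derivative ?u' z) (at z)" "(?u' has_field_derivative ?u'' z) (at z)" for z
    by (intro DERIV_cmult has_field_derivative_kummer_Phi)+
  have odeu: "z * ?u'' z + (b - z) * ?u' z = a * ?u z" for z
    using kummer_Phi_ODE[OF bn, of z a] by (simp add: add.assoc mult.assoc)
  obtain c0 where c0: "\<And>z. ?W0 z = c0"
  proof (rule kummer_second_Wronskian_constant[OF b(3) convex_UNIV du odeu])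
    fix c assume *: "\<And>z. z \<in> UNIV \<Longrightarrow> ?W0 z = c"
    assume **: "\<And>c0. (\<And>z. ?W0 z = c0) \<Longrightarrow> thesis"
    show thesis by (rule **) (rule *[OF UNIV_I])
  qed
  \<comment> \<open>The form without powers of z is constant on the whole plane, so it can be
    evaluated at 0 itself.\<close>
  have c0': "c0 = 1 - b" using c0[of 0] by simp
  have cont: "isCont (kummer_Phi p q) z" for p q z
    using has_field_derivative_kummer_Phi by (rule DERIV_isCont)
  have lim: "(\<lambda>n. kummer_Phi p q (?x n)) \<longlonglongrightarrow> 1" for p q
    using isCont_tendsto_compose[OF cont x0, of p q] by simp
  have lime: "(\<lambda>n. exp (- ?x n)) \<longlonglongrightarrow> 1"
    using tendsto_exp[OF tendsto_minus[OF x0]] by simp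
  have a1: "Re (a + 1) > 0" using a by simp
  have J1: "(\<lambda>n. ?x n powr b * tricomi_integral (a + 1) ?q (?x n)) \<longlonglongrightarrow> Gamma b"
    using tricomi_integral_asymptotic_0[OF a1 b(1)] by (simp add: diff_diff_eq)
  have J0: "(\<lambda>n. ?x n powr b * (?F (?x n) + tricomi_integral (a + 1) ?q (?x n))) \<longlonglongrightarrow> Gamma b"
    using tricomi_integral_asymptotic_0[OF a b(1)] tricomi_integral_raise_q[OF a, of "?x _" ?q]
    by simp
  \<comment> \<open>The integrals with exponents (a, b-a) and (a+1, b-a-1) have the same exponent
    sum b, hence the same leading term; \<open>?F\<close> is their difference.\<close>
  have JF: "(\<lambda>n. ?x n powr b * ?F (?x n)) \<longlonglongrightarrow> 0"
    using tendsto_diff[OF J0 J1] by (simp add: distrib_left)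
  have "(\<lambda>n. exp (- ?x n) * ((?x n powr b * ?F (?x n)) * (a / b * kummer_Phi (a + 1) (b + 1) (?x n))
      + (?x n powr b * tricomi_integral (a + 1) ?q (?x n)) * ?u (?x n))) \<longlonglongrightarrow> 1 * (0 * (a / b * 1) + Gamma b * 1)"
    by (intro tendsto_intros lime JF J1 lim)
  also have "(\<lambda>n. exp (- ?x n) * ((?x n powr b * ?F (?x n)) * (a / b * kummer_Phi (a + 1) (b + 1) (?x n))
      + (?x n powr b * tricomi_integral (a + 1) ?q (?x n)) * ?u (?x n))) = (\<lambda>n. ?W1 (?x n))"
    by (simp add: fun_eq_iff algebra_simps)
  also have "\<dots> = (\<lambda>n. c1)" using c1[OF x] by blast
  finally have c1': "c1 = Gamma b" unfolding LIMSEQ_const_iff by simp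
  \<comment> \<open>This is where Re b <= 1 enters: it gives |x| <= |x^b| for 0 < x <= 1.\<close>
  have xF: "(\<lambda>n. ?x n * ?F (?x n)) \<longlonglongrightarrow> 0"
  proof (rule Lim_null_comparison[OF _ tendsto_norm_zero[OF JF]])
    show "\<forall>\<^sub>F n in sequentially. norm (?x n * ?F (?x n)) \<le> norm (?x n powr b * ?F (?x n))"
    proof (intro always_eventually allI)
      fix n
      let ?r = "inverse (real (Suc n))"
      have r: "0 < ?r" "?r \<le> 1" by (auto simp: field_simps)
      have "norm (of_real r :: complex) \<le> norm (of_real r powr b :: complex)" if "0 < r" "r \<le> 1" for r :: real
        using powr_mono'[of "Re b" 1 r] that b by (simp add: norm_powr_real_powr)
      from this[OF r] have "norm (?x n) \<le> norm (?x n powr b)" .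
      then show "norm (?x n * ?F (?x n)) \<le> norm (?x n powr b * ?F (?x n))"
        by (simp add: norm_mult mult_right_mono)
    qed
  qed
  have b2: "Re (2 - b) > 0" using b by simp
  \<comment> \<open>On the line Re b = 1 the part z^(1-b) of \<open>?F\<close> oscillates at 0, so
    \<open>?F\<close> alone need not converge. The operator (1-b) - z d/dz annihilates that part,
    and what remains is an integral with a Beta limit because Re(2-b) > 0.\<close>
  have parts: "(1 - b) * ?F z - z * ?F' z = (a + 1 - b) * tricomi_integral a (- (a + (2 - b))) z" if "Re z > 0" for z
  proof -
    have "a * ?F z + ?q * tricomi_integral (a + 1) (?q - 1) z = z * tricomi_integral (a + 1) ?q z"
      by (rule tricomi_integral_by_parts[OF a that])
    moreover have "?F z = tricomi_integral a (?q - 1) z + tricomi_integral (a + 1) (?q - 1) z"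
      using tricomi_integral_raise_q[OF a that, of "?q - 1"] by simp
    moreover have "?q - 1 = - (a + (2 - b))" by simp
    ultimately show ?thesis by (simp add: algebra_simps)
  qed
  let ?R = "\<lambda>z. (a + 1 - b) / (2 - b) * kummer_Phi (a + 1 - b + 1) (2 - b + 1) z"
  have W2: "?W2 z = exp (- z) * (((1 - b) * ?F z - z * ?F' z) * ?P z + z * ?F z * ?R z)" for z
  proof -
    have "z * ?R z + (1 - b) * ?P z = (1 - b) * ?Q z"
      by (rule kummer_Phi_lower_b_reflected[OF b(3)])
    then have "(1 - b) * ?F z * ?Q z = ?F z * (z * ?R z + (1 - b) * ?P z)" by simp
    then show ?thesis by (simp only:) (simp add: algebra_simps)
  qed
  have "(\<lambda>n. exp (- ?x n) * ((a + 1 - b) * tricomi_integral a (- (a + (2 - b))) (?x n) * ?P (?x n) + ?x n * ?F (?x n) * ?R (?x n)))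
     \<longlonglongrightarrow> 1 * ((a + 1 - b) * Beta a (2 - b) * 1 + 0 * ((a + 1 - b) / (2 - b) * 1))"
    by (intro tendsto_intros lime lim xF tricomi_integral_limit_0[OF a b2])
  also have "(\<lambda>n. exp (- ?x n) * ((a + 1 - b) * tricomi_integral a (- (a + (2 - b))) (?x n) * ?P (?x n) + ?x n * ?F (?x n) * ?R (?x n)))
     = (\<lambda>n. ?W2 (?x n))"
    using parts x unfolding W2 by simp
  also have "\<dots> = (\<lambda>n. c2)" using c2[OF x] by blast
  finally have "c2 = (a + 1 - b) * Beta a (2 - b)" unfolding LIMSEQ_const_iff by simp
  also have "\<dots> = (1 - b) * (Gamma a * (Gamma (1 - b) * rGamma (a + 1 - b)))"
  proof -
    have "1 - b \<notin> \<int>" using notin_Ints_shift(1)[OF b(3), of 1] by simp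
    from Gamma_plus1_shift[OF this] have G: "Gamma (2 - b) = (1 - b) * Gamma (1 - b)" by simp
    have "(a + 1 - b) * rGamma (a + (2 - b)) = rGamma (a + 1 - b)"
      using rGamma_plus1[of "a + 1 - b"] by (simp add: algebra_simps)
    moreover have "(a + 1 - b) * Beta a (2 - b) = Gamma a * Gamma (2 - b) * ((a + 1 - b) * rGamma (a + (2 - b)))"
      by (simp add: Beta_altdef mult_ac)
    ultimately show ?thesis by (simp add: G mult_ac)
  qed
  finally have c2': "c2 = (1 - b) * (Gamma a * (Gamma (1 - b) * rGamma (a + 1 - b)))" .
  have z0: "z \<noteq> 0" using z by auto
  \<comment> \<open>The terms with \<open>?F'\<close> cancel on the right, which expresses
    \<open>?F\<close> by the three constants.\<close>
  have "(1 - b) * ?F z = ?F z * ?W0 z" using c0 c0' by simp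
  also have "\<dots> = ?u z * ?W2 z - z powr (1 - b) * ?P z * ?W1 z"
  proof -
    have "z powr (1 - b) * z powr b = z" using z0 by (simp add: powr_add[symmetric])
    moreover have "z powr (1 - b) * ?P z * ?W1 z
        = (z powr (1 - b) * z powr b) * (?P z * (exp (- z) * (?F z * ?u' z - ?F' z * ?u z)))"
      by (simp only: mult_ac)
    ultimately have "z powr (1 - b) * ?P z * ?W1 z = z * (?P z * (exp (- z) * (?F z * ?u' z - ?F' z * ?u z)))"
      by (simp only:)
    then show ?thesis by (simp only:) (simp add: algebra_simps)
  qed
  also have "\<dots> = ?u z * c2 - z powr (1 - b) * ?P z * c1" using c1[of z] c2[of z] z by simp
  also have "\<dots> = (1 - b) * (Gamma a * kummer_Psi_nonint a b z)"
  proof -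
    have "b - 1 \<notin> \<int>" using notin_Ints_shift(2)[OF b(3), of 1] by simp
    from Gamma_plus1_shift[OF this] have "Gamma b = (b - 1) * Gamma (b - 1)" by simp
    moreover have "(1 - b) * (Gamma a * (Gamma (b - 1) * rGamma a * X)) = - ((b - 1) * Gamma (b - 1)) * X" for X
    proof -
      have "(1 - b) * (Gamma a * (Gamma (b - 1) * rGamma a * X)) = (Gamma a * rGamma a) * (- ((b - 1) * Gamma (b - 1)) * X)"
        by (simp add: algebra_simps)
      also have "Gamma a * rGamma a = 1"
        using Gamma_Re_pos_nonzero[OF a] by (simp add: rGamma_inverse_Gamma)
      finally show ?thesis by simp
    qed
    note this[of "z powr (1 - b) * ?P z"]
    ultimately have 2: "(1 - b) * (Gamma a * (Gamma (b - 1) * rGamma a * (z powr (1 - b) * ?P z))) = - (z powr (1 - b) * ?P z * Gamma b)"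
      by simp
    show ?thesis
      unfolding c1' c2' kummer_Psi_nonint_def
      using 2 by (simp add: distrib_left mult_ac)
  qed
  finally show ?thesis using b1 by simp
qed

text \<open>The rule holds for each part of the definition separately:
  \<open>kummer_Phi_raise_b\<close> treats the first, \<open>kummer_Phi_lower_b_reflected\<close>
  with \<open>kummer_Phi_diff_a\<close> the second, and the recurrences of \<open>Gamma\<close> and
  \<open>rGamma\<close> shift the coefficients.\<close>

lemma kummer_Psi_nonint_raise_b:
  assumes b: "b \<notin> \<int>" and z: "Re z > 0"
  obtains D where "(kummer_Psi_nonint a b has_field_derivative D) (at z)"
    "kummer_Psi_nonint a (b + 1) z = kummer_Psi_nonint a b z - D"
proof -
  let ?c = "Gamma (1 - b) * rGamma (a + 1 - b)" and ?d = "Gamma (b - 1) * rGamma a"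
  let ?P = "kummer_Phi (a + 1 - b) (2 - b)"
  let ?R = "(a + 1 - b) / (2 - b) * kummer_Phi (a + 1 - b + 1) (2 - b + 1) z"
  let ?D = "?c * (a / b * kummer_Phi (a + 1) (b + 1) z)
     + ?d * (((1 - b) * z powr (1 - b - 1)) * ?P z + ?R * z powr (1 - b))"
  note nInt = notin_Ints_shift[OF b]
  have nn: "z \<notin> \<real>\<^sub>\<le>\<^sub>0" using z by (auto simp: complex_nonpos_Reals_iff)
  have z0: "z \<noteq> 0" and b0: "b \<noteq> 0" and b1: "1 - b \<noteq> 0" using z b by auto
  have bn: "b \<notin> \<int>\<^sub>\<le>\<^sub>0" using notin_Ints_imp_notin_nonpos_Ints[OF b] .
  have "kummer_Psi_nonint a b = (\<lambda>z. ?c * kummer_Phi a b z + ?d * (z powr (1 - b) * ?P z))"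
    by (simp add: fun_eq_iff kummer_Psi_nonint_def mult.assoc)
  then have D: "(kummer_Psi_nonint a b has_field_derivative ?D) (at z)"
    by (simp only:) (intro DERIV_add DERIV_cmult DERIV_mult has_field_derivative_kummer_Phi has_field_derivative_powr nn)
  have 1: "?c * kummer_Phi a b z - ?c * (a / b * kummer_Phi (a + 1) (b + 1) z)
      = Gamma (1 - (b + 1)) * rGamma (a + 1 - (b + 1)) * kummer_Phi a (b + 1) z"
  proof -
    have "Gamma (1 - b) = - b * Gamma (- b)"
      using Gamma_plus1_shift[of "- b"] nInt(1)[of 0] by (simp add: add.commute)
    moreover have "(a - b) * rGamma (a + 1 - b) = rGamma (a - b)"
      using rGamma_plus1[of "a - b"] by (simp add: algebra_simps)
    then have r: "(b - a) * rGamma (a + 1 - b) = - rGamma (a - b)"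
      by (metis minus_diff_eq mult_minus_left)
    moreover have "kummer_Phi a b z - a / b * kummer_Phi (a + 1) (b + 1) z = (b - a) * kummer_Phi a (b + 1) z / b"
      using kummer_Phi_raise_b[OF bn, of a z] b0 by (simp add: field_simps)
    then have "?c * kummer_Phi a b z - ?c * (a / b * kummer_Phi (a + 1) (b + 1) z)
      = Gamma (1 - b) / b * ((b - a) * rGamma (a + 1 - b)) * kummer_Phi a (b + 1) z"
      unfolding right_diff_distrib[symmetric] by simp
    ultimately show ?thesis using b0 by simp
  qed
  have 2: "?d * (z powr (1 - b) * ?P z) - ?d * (((1 - b) * z powr (1 - b - 1)) * ?P z + ?R * z powr (1 - b))
      = Gamma (b + 1 - 1) * rGamma a * (z powr (1 - (b + 1)) * kummer_Phi (a + 1 - (b + 1)) (2 - (b + 1)) z)"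
  proof -
    have p: "z powr (1 - b) = z * z powr (- b)" using z0 by (simp add: powr_diff powr_minus field_simps)
    have q: "z * ?R + (1 - b) * ?P z = (1 - b) * kummer_Phi (a + 1 - b) (1 - b) z"
      by (rule kummer_Phi_lower_b_reflected[OF b])
    have "kummer_Phi (a + 1 - b) (1 - b) z - kummer_Phi (a + 1 - b - 1) (1 - b) z
        = z / (1 - b) * kummer_Phi (a + 1 - b) (1 - b + 1) z" by (rule kummer_Phi_diff_a)
    moreover have "1 - b + 1 = 2 - b" "a + 1 - b - 1 = a - b" by simp_all
    ultimately have r: "z * ?P z = (1 - b) * (kummer_Phi (a + 1 - b) (1 - b) z - kummer_Phi (a - b) (1 - b) z)"
      using b1 by simp
    have "z powr (1 - b) * ?P z - (((1 - b) * z powr (1 - b - 1)) * ?P z + ?R * z powr (1 - b))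
       = z powr (- b) * (z * ?P z - (z * ?R + (1 - b) * ?P z))"
      unfolding p by (simp add: algebra_simps)
    also have "\<dots> = (b - 1) * (z powr (- b) * kummer_Phi (a - b) (1 - b) z)"
      unfolding q r by (simp add: algebra_simps)
    finally have "?d * (z powr (1 - b) * ?P z - (((1 - b) * z powr (1 - b - 1)) * ?P z + ?R * z powr (1 - b)))
       = ((b - 1) * Gamma (b - 1)) * rGamma a * (z powr (- b) * kummer_Phi (a - b) (1 - b) z)"
      by (simp only: mult_ac)
    also have "(b - 1) * Gamma (b - 1) = Gamma b"
      using Gamma_plus1_shift[of "b - 1"] nInt(2)[of 1] by simp
    finally show ?thesis unfolding right_diff_distrib[symmetric] by simp
  qed
  have "kummer_Psi_nonint a (b + 1) z = kummer_Psi_nonint a b z - ?D"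
  proof -
    have "kummer_Psi_nonint a b z - ?D
      = (?c * kummer_Phi a b z - ?c * (a / b * kummer_Phi (a + 1) (b + 1) z))
       + (?d * (z powr (1 - b) * ?P z) - ?d * (((1 - b) * z powr (1 - b - 1)) * ?P z + ?R * z powr (1 - b)))"
      unfolding kummer_Psi_nonint_def by (simp add: mult.assoc)
    also have "\<dots> = kummer_Psi_nonint a (b + 1) z"
      unfolding 1 2 kummer_Psi_nonint_def by (simp only: mult.assoc)
    finally show ?thesis by simp
  qed
  with D that show ?thesis by blast
qed

lemma tricomi_integral_eq_kummer_Psi_nonint:
  assumes a: "Re a > 0" and b: "0 < Re b" "b \<notin> \<int>" and z: "Re z > 0"
  shows "tricomi_integral a (b - a - 1) z = Gamma a * kummer_Psi_nonint a b z"
proof -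
  \<comment> \<open>Induction over strips of width 1. The argument z is quantified inside, because
    the step differentiates the induction hypothesis in z and so needs it in a
    neighbourhood.\<close>
  have "\<forall>b z. real n < Re b \<and> Re b \<le> real (Suc n) \<and> b \<notin> \<int> \<and> Re z > 0 \<longrightarrow>
      tricomi_integral a (b - a - 1) z = Gamma a * kummer_Psi_nonint a b z" for n
  proof (induction n)
    case 0
    then show ?case using tricomi_integral_eq_kummer_Psi_nonint_strip[OF a] by simp
  next
    case (Suc n)
    show ?case
    proof (intro allI impI)
      fix b z :: complex
      assume *: "real (Suc n) < Re b \<and> Re b \<le> real (Suc (Suc n)) \<and> b \<notin> \<int> \<and> Re z > 0"
      define b' where "b' = b - 1"
      have bi: "b' \<notin> \<int>" using notin_Ints_shift(2)[of b 1] * by (simp add: b'_def)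
      have IH: "tricomi_integral a (b' - a - 1) y = Gamma a * kummer_Psi_nonint a b' y" if "Re y > 0" for y
      proof -
        have "real n < Re b'" "Re b' \<le> real (Suc n)" using * by (auto simp: b'_def)
        with Suc.IH bi that show ?thesis by blast
      qed
      from * have z: "Re z > 0" by simp
      obtain D where D: "(kummer_Psi_nonint a b' has_field_derivative D) (at z)"
          "kummer_Psi_nonint a (b' + 1) z = kummer_Psi_nonint a b' z - D"
        using kummer_Psi_nonint_raise_b[OF bi z] by blast
      have "\<forall>\<^sub>F y in nhds z. y \<in> {y. Re y > 0}"
        using z by (intro eventually_nhds_in_open open_halfspace_Re_gt) auto
      then have ev: "\<forall>\<^sub>F y in nhds z. Gamma a * kummer_Psi_nonint a b' y = tricomi_integral a (b' - a - 1) y"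
        by eventually_elim (simp add: IH)
      have "((\<lambda>y. Gamma a * kummer_Psi_nonint a b' y) has_field_derivative Gamma a * D) (at z)"
        by (intro DERIV_cmult D(1))
      then have "(tricomi_integral a (b' - a - 1) has_field_derivative Gamma a * D) (at z)"
        using DERIV_cong_ev[OF refl ev refl] by blast
      then have "Gamma a * D = - tricomi_integral (a + 1) (b' - a - 1) z"
        using DERIV_tricomi_integral'(1)[OF a z] by (rule DERIV_unique)
      then have "Gamma a * kummer_Psi_nonint a (b' + 1) z
         = tricomi_integral a (b' - a - 1) z + tricomi_integral (a + 1) (b' - a - 1) z"
        unfolding D(2) right_diff_distrib IH[OF z, symmetric] by simp
      also have "\<dots> = tricomi_integral a (b' - a - 1 + 1) z"
        by (rule tricomi_integral_raise_q[OF a z, symmetric])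
      finally show "tricomi_integral a (b - a - 1) z = Gamma a * kummer_Psi_nonint a b z"
        by (simp add: b'_def diff_right_commute)
    qed
  qed
  \<comment> \<open>The strips are open on the left and closed on the right, hence the ceiling minus
    1 as the index.\<close>
  moreover have "real (nat (\<lceil>Re b\<rceil> - 1)) < Re b" "Re b \<le> real (Suc (nat (\<lceil>Re b\<rceil> - 1)))"
    using b(1) by linarith+
  ultimately show ?thesis using b(2) z by blast
qed

text \<open>Within distance 1 of \<open>q0\<close> the real part of the exponent is at most Re q0 +
  1; since 1 + t >= 1, the integrand for \<open>q0 + 1\<close> dominates all others.\<close>

lemma tendsto_tricomi_integral_exponent:
  assumes p: "Re p > 0" and w: "Re w > 0"
  shows "((\<lambda>q. tricomi_integral p q w) \<longlongrightarrow> tricomi_integral p q0 w) (at q0)"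
proof -
  have "((\<lambda>q. tricomi_integral p q w) \<longlongrightarrow> tricomi_integral p q0 w) (at q0 within ball q0 1)"
    unfolding tendsto_at_iff_sequentially comp_def
  proof (intro allI impI)
    fix X :: "nat \<Rightarrow> complex"
    assume X: "\<forall>i. X i \<in> ball q0 1 - {q0}" "X \<longlonglongrightarrow> q0"
    show "(\<lambda>n. tricomi_integral p (X n) w) \<longlonglongrightarrow> tricomi_integral p q0 w"
      unfolding tricomi_integral_def
    proof (rule set_integral_dominated_convergence)
      show "set_integrable lborel {0<..} (\<lambda>t. norm (tricomi_integrand p (q0 + 1) w t))"
        using set_integrable_tricomi_integrand[OF p w] by (rule set_integrable_norm)
      show "(\<lambda>n. tricomi_integrand p (X n) w t) \<longlonglongrightarrow> tricomi_integrand p q0 w t" if "t \<in> {0<..}" for t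
        unfolding tricomi_integrand_def using that X(2)
        by (intro tendsto_mult tendsto_const tendsto_powr_complex) (auto simp: complex_nonpos_Reals_iff)
      show "norm (tricomi_integrand p (X n) w t) \<le> norm (tricomi_integrand p (q0 + 1) w t)" if "t \<in> {0<..}" for n t
      proof -
        have "norm (X n - q0) < 1" using X(1) by (auto simp: dist_norm norm_minus_commute)
        then have "Re (X n) \<le> Re (q0 + 1)" using complex_Re_le_cmod[of "X n - q0"] by simp
        then show ?thesis
          using that by (simp add: norm_tricomi_integrand mult_left_mono powr_mono)
      qed
    qed (intro set_borel_measurable_lborel_continuous_on open_greaterThan continuous_on_tricomi_integrand)+
  qed
  then show ?thesis by (simp add: at_within_open[of q0 "ball q0 1"])
qed

lemma tricomi_integral_eq_kummer_Psi:
  assumes a: "Re a > 0" and b: "0 < Re b" and z: "Re z > 0"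
  shows "tricomi_integral a (b - a - 1) z = Gamma a * kummer_Psi a b z"
proof (cases "b \<in> \<int>")
  case False
  then show ?thesis
    using tricomi_integral_eq_kummer_Psi_nonint[OF a b _ z] by (simp add: kummer_Psi_def)
next
  case True
  have nz: "Gamma a \<noteq> 0" using a by (rule Gamma_Re_pos_nonzero)
  have "((\<lambda>m. tricomi_integral a (m - a - 1) z) \<longlongrightarrow> tricomi_integral a (b - a - 1) z) (at b)"
  proof -
    have "filterlim (\<lambda>m. m - a - 1) (at (b - a - 1)) (at b)"
      unfolding filterlim_at
      by (auto intro!: tendsto_eq_intros simp: eventually_at_filter)
    from filterlim_compose[OF tendsto_tricomi_integral_exponent[OF a z] this] show ?thesis .
  qed
  then have "((\<lambda>m. tricomi_integral a (m - a - 1) z / Gamma a) \<longlongrightarrow> tricomi_integral a (b - a - 1) z / Gamma a) (at b)"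
    by (intro tendsto_divide tendsto_const nz)
  moreover have "\<forall>\<^sub>F m in at b. tricomi_integral a (m - a - 1) z / Gamma a = kummer_Psi_nonint a m z"
  proof -
    \<comment> \<open>An integer b is the only integer at distance less than 1 from itself, so the
      formula for noninteger parameters applies throughout the punctured ball.\<close>
    have "\<forall>\<^sub>F m in at b. m \<in> ball b 1 - {b}"
      by (intro eventually_at_in_open) auto
    moreover have "\<forall>\<^sub>F m in at b. m \<in> {m. Re m > 0}"
      using b by (intro eventually_at_in_open' open_halfspace_Re_gt) auto
    ultimately show ?thesis
    proof eventually_elim
      case (elim m)
      have "m \<notin> \<int>"
      proof
        assume "m \<in> \<int>"
        with True obtain i j where ij: "m = of_int i" "b = of_int j" by (auto elim!: Ints_cases)
        then have "norm (of_int (j - i) :: complex) < 1" using elim(1) by (simp add: dist_norm)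
        then have "\<bar>j - i\<bar> < 1" unfolding norm_of_int by linarith
        with ij elim(1) show False by simp
      qed
      with elim(2) nz show ?case
        using tricomi_integral_eq_kummer_Psi_nonint[OF a _ _ z, of m] by simp
    qed
  qed
  ultimately have "((\<lambda>m. kummer_Psi_nonint a m z) \<longlongrightarrow> tricomi_integral a (b - a - 1) z / Gamma a) (at b)"
    by (rule Lim_transform_eventually)
  then have "kummer_Psi a b z = tricomi_integral a (b - a - 1) z / Gamma a"
    using True by (simp add: kummer_Psi_def tendsto_Lim)
  then show ?thesis using nz by simp
qed

section \<open>Parabolic cylinder functions\<close>

lemma has_half_Gaussian_moment:
  fixes s :: complex
  assumes s: "Re s > 0"
  shows "set_integrable lborel {0<..} (\<lambda>x. of_real x powr (s - 1) * exp (- (of_real x)\<^sup>2 / 2))"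
    and "(LBINT x:{0<..}. of_real x powr (s - 1) * exp (- (of_real x)\<^sup>2 / 2)) = 2 powr (s / 2 - 1) * Gamma (s / 2)"
proof -
  let ?m = "\<lambda>x::real. of_real x powr (s - 1) * exp (- (of_real x)\<^sup>2 / 2) :: complex"
  let ?f = "\<lambda>y. exp (- (of_real 1 * of_real y)) * of_real y powr (s / 2 - 1) :: complex"
  let ?g = "\<lambda>x::real. x\<^sup>2 / 2"
  have s2: "Re (s / 2) > 0" using s by simp
  have img: "?g ` {0<..} = {0<..}"
  proof -
    have "y \<in> ?g ` {0<..}" if "y > 0" for y
      using that by (intro image_eqI[of _ _ "sqrt (2 * y)"]) auto
    then show ?thesis by auto
  qed
  have inj: "inj_on ?g {0<..}"
    by (rule inj_onI) (auto simp: power2_eq_iff)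
  have der: "(?g has_real_derivative x) (at x)" for x
    by (auto intro!: derivative_eq_intros)
  have contf: "continuous_on {0<..} ?f" by (auto intro!: continuous_intros)
  note sub = set_integral_change_of_variables_real[OF open_greaterThan open_greaterThan img inj der
      continuous_on_id contf]
  have eq: "\<bar>x\<bar> *\<^sub>R ?f (?g x) = 2 powr (1 - s / 2) * (?m x)" if "x > 0" for x :: real
  proof -
    have "of_real (x\<^sup>2 / 2) powr (s / 2 - 1) = (of_real (x * x) * of_real (1 / 2)) powr (s / 2 - 1)"
      by (simp add: power2_eq_square)
    also have "\<dots> = of_real (x * x) powr (s / 2 - 1) * of_real (1 / 2) powr (s / 2 - 1)"
      using that by (intro powr_times_real) auto
    also have "of_real (x * x) powr (s / 2 - 1) = (of_real x powr (s / 2 - 1) * of_real x powr (s / 2 - 1) :: complex)"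
      unfolding of_real_mult using that by (intro powr_times_real) auto
    also have "of_real (1 / 2) powr (s / 2 - 1) = (2 powr (1 - s / 2) :: complex)"
    proof -
      have "Ln (of_real (1 / 2) :: complex) = - Ln (of_real 2)"
        using Ln_of_real[of "1/2"] Ln_of_real[of 2] by (simp add: ln_div)
      then show ?thesis by (simp add: powr_def algebra_simps)
    qed
    finally have "of_real x * of_real (x\<^sup>2 / 2) powr (s / 2 - 1)
        = (of_real x * (of_real x powr (s / 2 - 1) * of_real x powr (s / 2 - 1))) * (2 powr (1 - s / 2) :: complex)"
      by (simp only: mult.assoc)
    also have "of_real x * (of_real x powr (s / 2 - 1) * of_real x powr (s / 2 - 1)) = (of_real x powr (s - 1) :: complex)"
      unfolding of_real_powr_twice[OF that] by simp
    finally show ?thesis using that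
      by (simp add: scaleR_conv_of_real mult_ac)
  qed
  have nz: "2 powr (1 - s / 2) \<noteq> (0::complex)" by simp
  have "set_integrable lborel {0<..} (\<lambda>x. \<bar>x\<bar> *\<^sub>R ?f (?g x))"
    using has_Gamma_integral_scaled(1)[OF s2, of 1] sub(1) by simp
  then have "set_integrable lborel {0<..} (\<lambda>x. 2 powr (1 - s / 2) * (?m x))"
    by (subst set_integrable_cong[OF refl refl eq[symmetric]]) auto
  then show "set_integrable lborel {0<..} (\<lambda>x. ?m x)"
    using nz by simp
  have "Gamma (s / 2) = (LBINT y:{0<..}. ?f y)"
    using has_Gamma_integral_scaled(2)[OF s2, of 1] by simp
  also have "\<dots> = (LBINT x:{0<..}. \<bar>x\<bar> *\<^sub>R ?f (?g x))" by (rule sub(2))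
  also have "\<dots> = (LBINT x:{0<..}. 2 powr (1 - s / 2) * (?m x))"
    by (intro set_lebesgue_integral_cong) (use eq in auto)
  also have "\<dots> = 2 powr (1 - s / 2) * (LBINT x:{0<..}. ?m x)"
    by simp
  finally have "Gamma (s / 2) = 2 powr (1 - s / 2) * (LBINT x:{0<..}. ?m x)" .
  then have "2 powr (s / 2 - 1) * Gamma (s / 2) = (2 powr (s / 2 - 1) * 2 powr (1 - s / 2)) * (LBINT x:{0<..}. ?m x)"
    by (simp only: mult.assoc)
  also have "2 powr (s / 2 - 1) * 2 powr (1 - s / 2) = (1 :: complex)"
    by (simp add: powr_add[symmetric])
  finally show "(LBINT x:{0<..}. ?m x) = 2 powr (s / 2 - 1) * Gamma (s / 2)"
    by simp
qed

definition cylinder_integrand :: "complex \<Rightarrow> complex \<Rightarrow> real \<Rightarrow> complex" where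
  "cylinder_integrand \<nu> z x = of_real x powr (\<nu> - 1) * exp (- (z * of_real x) - (of_real x)\<^sup>2 / 2)"

definition cylinder_integral :: "complex \<Rightarrow> complex \<Rightarrow> complex" where
  "cylinder_integral \<nu> z = (LBINT x:{0<..}. cylinder_integrand \<nu> z x)"

lemma continuous_on_cylinder_integrand: "continuous_on {0<..} (cylinder_integrand \<nu> z)"
  unfolding cylinder_integrand_def by (auto intro!: continuous_intros)

lemma norm_cylinder_integrand:
  "x > 0 \<Longrightarrow> norm (cylinder_integrand \<nu> z x) = x powr (Re \<nu> - 1) * exp (- (Re z * x) - x\<^sup>2 / 2)"
  by (simp add: cylinder_integrand_def norm_mult norm_powr_real_powr power2_eq_square)

lemma set_integrable_cylinder_integrand:
  assumes "Re \<nu> > 0"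
  shows "set_integrable lborel {0<..} (cylinder_integrand \<nu> z)"
proof (rule set_integrable_bound)
  show "set_integrable lborel {0<..} (\<lambda>x. exp ((1 - Re z)\<^sup>2 / 2) * (exp (- (1 * x)) * x powr (Re \<nu> - 1)))"
    using has_Gamma_integral_scaled_real(1)[of "Re \<nu>" 1] assms by (intro set_integrable_mult_right) auto
  show "set_borel_measurable lborel {0<..} (cylinder_integrand \<nu> z)"
    by (intro set_borel_measurable_lborel_continuous_on continuous_on_cylinder_integrand) auto
  show "AE x in lborel. x \<in> {0<..} \<longrightarrow> norm (cylinder_integrand \<nu> z x)
      \<le> norm (exp ((1 - Re z)\<^sup>2 / 2) * (exp (- (1 * x)) * x powr (Re \<nu> - 1)))"
  proof (intro AE_I2 impI)
    fix x :: real assume x: "x \<in> {0<..}"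
    \<comment> \<open>Completing the square with one extra x set aside: this is the origin of the
      constant, and the extra x becomes the factor e^(-x) of a Gamma integrand.\<close>
    have "0 \<le> (x - (1 - Re z))\<^sup>2" by simp
    then have "- (Re z * x) - x\<^sup>2 / 2 \<le> (1 - Re z)\<^sup>2 / 2 + - (1 * x)"
      by (simp add: power2_eq_square algebra_simps)
    then have "exp (- (Re z * x) - x\<^sup>2 / 2) \<le> exp ((1 - Re z)\<^sup>2 / 2) * exp (- (1 * x))"
      unfolding exp_add[symmetric] by simp
    then have "exp (- (Re z * x) - x\<^sup>2 / 2) * x powr (Re \<nu> - 1) \<le> exp ((1 - Re z)\<^sup>2 / 2) * exp (- (1 * x)) * x powr (Re \<nu> - 1)"
      by (rule mult_right_mono) simp
    with x show "norm (cylinder_integrand \<nu> z x)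
      \<le> norm (exp ((1 - Re z)\<^sup>2 / 2) * (exp (- (1 * x)) * x powr (Re \<nu> - 1)))"
      by (simp add: norm_cylinder_integrand abs_mult mult_ac)
  qed
qed

text \<open>Expanding e^(-zx) gives half-Gaussian moments. Since (2k)! = 4^k (1/2)_k k! and (2k+1)!
  = 4^k (3/2)_k k!, the even terms form the series with lower parameter 1/2 and the odd terms the
  one with 3/2.\<close>

lemma cylinder_integral_eq_kummer_Phi:
  assumes \<nu>: "Re \<nu> > 0"
  shows "cylinder_integral \<nu> z = 2 powr (\<nu> / 2 - 1) * Gamma (\<nu> / 2) * kummer_Phi (\<nu> / 2) (1 / 2) (z\<^sup>2 / 2)
     - z * 2 powr ((\<nu> - 1) / 2) * Gamma ((\<nu> + 1) / 2) * kummer_Phi ((\<nu> + 1) / 2) (3 / 2) (z\<^sup>2 / 2)"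
proof -
  let ?h = "\<lambda>x. of_real x powr (\<nu> - 1) * exp (- (of_real x)\<^sup>2 / 2) :: complex"
  let ?E = "\<lambda>n. 2 powr (\<nu> / 2 - 1) * Gamma (\<nu> / 2) * (pochhammer (\<nu> / 2) n / pochhammer (1 / 2) n * (z\<^sup>2 / 2) ^ n / fact n)"
  let ?O = "\<lambda>n. - (z * 2 powr ((\<nu> - 1) / 2) * Gamma ((\<nu> + 1) / 2)) * (pochhammer ((\<nu> + 1) / 2) n / pochhammer (3 / 2) n * (z\<^sup>2 / 2) ^ n / fact n)"
  have ex: "exp (w * of_real x) * ?h x = cylinder_integrand \<nu> (- w) x" for w :: complex and x :: real
    unfolding cylinder_integrand_def by (simp add: exp_add[symmetric] mult_ac)
  have "exp (norm (- z) * \<bar>x\<bar>) *\<^sub>R ?h x = cylinder_integrand \<nu> (- of_real (norm z)) x" if "x \<in> {0<..}" for x :: real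
    using ex[of "of_real (norm z)" x] that by (simp add: scaleR_conv_of_real exp_of_real[symmetric])
  then have int: "set_integrable lborel {0<..} (\<lambda>x. exp (norm (- z) * \<bar>x\<bar>) *\<^sub>R ?h x)"
    using set_integrable_cylinder_integrand[OF \<nu>] by (subst set_integrable_cong[OF refl refl]) auto
  have "(\<lambda>n. (- z) ^ n / fact n * (LBINT x:{0<..}. of_real x ^ n * ?h x)) sums
           (LBINT x:{0<..}. exp (- z * of_real x) * ?h x)"
    using int by (rule set_integral_exp_sums) (auto simp: set_borel_measurable_def)
  moreover have "(LBINT x:{0<..}. exp (- z * of_real x) * ?h x) = cylinder_integral \<nu> z"
    using ex[of "- z"] by (simp add: cylinder_integral_def)
  moreover have M: "(LBINT x:{0<..}. of_real x ^ n * ?h x) = 2 powr ((\<nu> + of_nat n) / 2 - 1) * Gamma ((\<nu> + of_nat n) / 2)" for n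
  proof -
    have "(LBINT x:{0<..}. of_real x ^ n * ?h x) = (LBINT x:{0<..}. of_real x powr (\<nu> + of_nat n - 1) * exp (- (of_real x)\<^sup>2 / 2))"
    proof (intro set_lebesgue_integral_cong allI impI)
      fix x :: real assume x: "x \<in> {0<..}"
      have "\<nu> + of_nat n - 1 = of_nat n + (\<nu> - 1)" by simp
      then have "of_real x powr (\<nu> + of_nat n - 1) = (of_real x ^ n * of_real x powr (\<nu> - 1) :: complex)"
        using x by (simp only: powr_add) simp
      then show "of_real x ^ n * ?h x = of_real x powr (\<nu> + of_nat n - 1) * exp (- (of_real x)\<^sup>2 / 2)"
        by (simp add: mult.assoc)
    qed auto
    also have "\<dots> = 2 powr ((\<nu> + of_nat n) / 2 - 1) * Gamma ((\<nu> + of_nat n) / 2)"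
      by (rule has_half_Gaussian_moment(2)) (use \<nu> in \<open>simp add: add_pos_nonneg\<close>)
    finally show ?thesis .
  qed
  moreover have "(- z) ^ n / fact n * (2 powr ((\<nu> + of_nat n) / 2 - 1) * Gamma ((\<nu> + of_nat n) / 2))
      = (if even n then ?E (n div 2) else ?O ((n - 1) div 2))" for n
  proof (cases "even n")
    case True
    then obtain k where n: "n = 2 * k" by (elim evenE)
    have "(\<nu> + of_nat n) / 2 - 1 = (\<nu> / 2 - 1) + of_nat k" by (simp add: n field_simps)
    then have p: "(2::complex) powr ((\<nu> + of_nat n) / 2 - 1) = 2 powr (\<nu> / 2 - 1) * 2 ^ k"
      by (simp only: powr_add) simp
    have "\<nu> / 2 \<notin> \<int>\<^sub>\<le>\<^sub>0" using \<nu> by (intro Re_pos_notin_nonpos_Ints) simp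
    then have "Gamma (\<nu> / 2 + of_nat k) = Gamma (\<nu> / 2) * pochhammer (\<nu> / 2) k"
      by (simp add: pochhammer_Gamma Gamma_eq_zero_iff)
    moreover have "(\<nu> + of_nat n) / 2 = \<nu> / 2 + of_nat k" by (simp add: n field_simps)
    ultimately have g: "Gamma ((\<nu> + of_nat n) / 2) = Gamma (\<nu> / 2) * pochhammer (\<nu> / 2) k" by (simp only:)
    have f: "fact n = (2 ^ (2 * k) * pochhammer (1 / 2) k * fact k :: complex)"
      unfolding n by (rule fact_double)
    have nz: "pochhammer (1 / 2 :: complex) k \<noteq> 0" by (intro pochhammer_nonzero Re_pos_notin_nonpos_Ints) simp
    have 2: "(2::complex) ^ (2 * k) = 2 ^ k * 2 ^ k" by (simp add: mult_2 power_add)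
    have 3: "(- z) ^ n = (z\<^sup>2) ^ k" unfolding n by (simp add: power_mult)
    have 4: "n div 2 = k" using n by simp
    show ?thesis using True nz unfolding p g f 3 4 2
      by (simp add: power_divide field_simps)
  next
    case False
    then obtain k where n: "n = 2 * k + 1" by (elim oddE)
    have "(\<nu> + of_nat n) / 2 - 1 = (\<nu> - 1) / 2 + of_nat k" by (simp add: n field_simps)
    then have p: "(2::complex) powr ((\<nu> + of_nat n) / 2 - 1) = 2 powr ((\<nu> - 1) / 2) * 2 ^ k"
      by (simp only: powr_add) simp
    have "(\<nu> + 1) / 2 \<notin> \<int>\<^sub>\<le>\<^sub>0" using \<nu> by (intro Re_pos_notin_nonpos_Ints) simp
    then have "Gamma ((\<nu> + 1) / 2 + of_nat k) = Gamma ((\<nu> + 1) / 2) * pochhammer ((\<nu> + 1) / 2) k"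
      by (simp add: pochhammer_Gamma Gamma_eq_zero_iff)
    moreover have "(\<nu> + of_nat n) / 2 = (\<nu> + 1) / 2 + of_nat k" by (simp add: n field_simps)
    ultimately have g: "Gamma ((\<nu> + of_nat n) / 2) = Gamma ((\<nu> + 1) / 2) * pochhammer ((\<nu> + 1) / 2) k" by (simp only:)
    have "(1 / 2) * pochhammer (1 / 2 + 1) k = pochhammer (1 / 2 :: complex) (Suc k)"
      by (rule pochhammer_rec[symmetric])
    also have "\<dots> = (1 / 2 + of_nat k) * pochhammer (1 / 2) k" by (rule pochhammer_rec')
    finally have q: "pochhammer (3 / 2) k = (of_nat n * pochhammer (1 / 2) k :: complex)"
      by (simp add: n field_simps)
    have "fact n = of_nat n * (fact (2 * k) :: complex)" unfolding n by simp
    also have "\<dots> = 2 ^ (2 * k) * (of_nat n * pochhammer (1 / 2) k) * fact k"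
      unfolding fact_double by simp
    finally have f: "fact n = (2 ^ (2 * k) * pochhammer (3 / 2) k * fact k :: complex)"
      unfolding q .
    have nz: "pochhammer (3 / 2 :: complex) k \<noteq> 0" by (intro pochhammer_nonzero Re_pos_notin_nonpos_Ints) simp
    have 2: "(2::complex) ^ (2 * k) = 2 ^ k * 2 ^ k" by (simp add: mult_2 power_add)
    have 3: "(- z) ^ n = - (z * (z\<^sup>2) ^ k)" unfolding n by (simp add: power_mult)
    have 4: "(n - 1) div 2 = k" using n by simp
    show ?thesis using False nz unfolding p g f 3 4 2
      by (simp add: power_divide field_simps)
  qed
  ultimately have "(\<lambda>n. if even n then ?E (n div 2) else ?O ((n - 1) div 2)) sums cylinder_integral \<nu> z"
    by simp
  note sums = this
  have pair_sum: "(\<Sum>n\<in>{k * 2..<k * 2 + 2}. if even n then e (n div 2) else d ((n - 1) div 2)) = e k + d k"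
    for e d :: "nat \<Rightarrow> complex" and k
  proof -
    have "{k * 2..<k * 2 + 2} = {2 * k, Suc (2 * k)}" by auto
    then show ?thesis by simp
  qed
  \<comment> \<open>Each even term is grouped with the odd term after it, so that the interleaved
    series becomes the sum of two series.\<close>
  from sums_group[OF sums, of 2]
  have "(\<lambda>n. ?E n + ?O n) sums cylinder_integral \<nu> z"
    unfolding pair_sum by simp
  moreover have "(\<lambda>n. ?E n + ?O n) sums
     (2 powr (\<nu> / 2 - 1) * Gamma (\<nu> / 2) * kummer_Phi (\<nu> / 2) (1 / 2) (z\<^sup>2 / 2)
      + - (z * 2 powr ((\<nu> - 1) / 2) * Gamma ((\<nu> + 1) / 2)) * kummer_Phi ((\<nu> + 1) / 2) (3 / 2) (z\<^sup>2 / 2))"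
    by (intro sums_add sums_mult kummer_Phi_sums)
  ultimately have "cylinder_integral \<nu> z =
     2 powr (\<nu> / 2 - 1) * Gamma (\<nu> / 2) * kummer_Phi (\<nu> / 2) (1 / 2) (z\<^sup>2 / 2)
      + - (z * 2 powr ((\<nu> - 1) / 2) * Gamma ((\<nu> + 1) / 2)) * kummer_Phi ((\<nu> + 1) / 2) (3 / 2) (z\<^sup>2 / 2)"
    by (rule sums_unique2)
  then show ?thesis by simp
qed

lemma two_powr_Gamma_duplication:
  assumes "Re \<nu> > 0"
  shows "Gamma (\<nu> / 2) * Gamma (\<nu> / 2 + 1 / 2) = 2 powr (1 - \<nu>) * of_real (sqrt pi) * Gamma \<nu>"
proof -
  have "\<nu> / 2 \<notin> \<int>\<^sub>\<le>\<^sub>0" "\<nu> / 2 + 1 / 2 \<notin> \<int>\<^sub>\<le>\<^sub>0"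
    using assms by (auto intro!: Re_pos_notin_nonpos_Ints simp: add_pos_pos)
  from Gamma_legendre_duplication[OF this] show ?thesis
    using Ln_of_real[of 2] by (simp add: powr_def)
qed

text \<open>The expansion of the integral has the same two Kummer functions as the definition at the
  index \<open>- \<nu>\<close>; Legendre's duplication formula at \<open>\<nu> / 2\<close> makes the
  coefficients agree.\<close>

lemma parabolic_cylinder_D_integral:
  assumes \<nu>: "Re \<nu> > 0"
  shows "Gamma \<nu> * exp (z\<^sup>2 / 4) * parabolic_cylinder_D (- \<nu>) z = cylinder_integral \<nu> z"
proof -
  have nz: "Gamma (\<nu> / 2) \<noteq> 0" "Gamma (\<nu> / 2 + 1 / 2) \<noteq> 0"
    using \<nu> by (auto intro!: Gamma_Re_pos_nonzero simp: add_pos_pos)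
  have half: "complex_of_real (sqrt 2) = 2 powr (1 / 2)"
    using powr_of_real[of 2 "1/2"] by (simp add: powr_half_sqrt)
  note dup = two_powr_Gamma_duplication[OF \<nu>]
  have inv: "2 powr (\<nu> - 1) * 2 powr (1 - \<nu>) = (1 :: complex)" by (simp add: powr_add[symmetric])
  have dup': "Gamma \<nu> * of_real (sqrt pi) = 2 powr (\<nu> - 1) * (Gamma (\<nu> / 2) * Gamma (\<nu> / 2 + 1 / 2))"
  proof -
    have "2 powr (\<nu> - 1) * (Gamma (\<nu> / 2) * Gamma (\<nu> / 2 + 1 / 2))
        = (2 powr (\<nu> - 1) * 2 powr (1 - \<nu>)) * (of_real (sqrt pi) * Gamma \<nu>)"
      unfolding dup by (simp only: mult.assoc)
    then show ?thesis unfolding inv by simp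
  qed
  have A: "2 powr (- \<nu> / 2) * (Gamma \<nu> * of_real (sqrt pi)) * rGamma (\<nu> / 2 + 1 / 2) = 2 powr (\<nu> / 2 - 1) * Gamma (\<nu> / 2)"
  proof -
    have "2 powr (- \<nu> / 2) * (Gamma \<nu> * of_real (sqrt pi)) * rGamma (\<nu> / 2 + 1 / 2)
        = (2 powr (- \<nu> / 2) * 2 powr (\<nu> - 1)) * Gamma (\<nu> / 2)"
      unfolding dup' using nz by (simp add: rGamma_inverse_Gamma)
    also have "2 powr (- \<nu> / 2) * 2 powr (\<nu> - 1) = (2 powr (\<nu> / 2 - 1) :: complex)"
      by (simp add: powr_add[symmetric] field_simps)
    finally show ?thesis .
  qed
  have B: "2 powr (- \<nu> / 2) * (Gamma \<nu> * of_real (sqrt pi)) * of_real (sqrt 2) * rGamma (\<nu> / 2)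
      = 2 powr ((\<nu> - 1) / 2) * Gamma (\<nu> / 2 + 1 / 2)"
  proof -
    have "2 powr (- \<nu> / 2) * (Gamma \<nu> * of_real (sqrt pi)) * of_real (sqrt 2) * rGamma (\<nu> / 2)
        = (2 powr (- \<nu> / 2) * 2 powr (\<nu> - 1) * 2 powr (1 / 2)) * Gamma (\<nu> / 2 + 1 / 2)"
      unfolding dup' half using nz by (simp add: rGamma_inverse_Gamma)
    also have "2 powr (- \<nu> / 2) * 2 powr (\<nu> - 1) * 2 powr (1 / 2) = (2 powr ((\<nu> - 1) / 2) :: complex)"
      by (simp add: powr_add[symmetric] field_simps)
    finally show ?thesis .
  qed
  have e: "exp (z\<^sup>2 / 4) * exp (- (z\<^sup>2 / 4)) = 1" by (simp add: exp_add[symmetric])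
  have c: "1 / 2 + \<nu> / 2 = \<nu> / 2 + 1 / 2" "(\<nu> + 1) / 2 = \<nu> / 2 + 1 / 2" by (simp_all add: field_simps)
  have "Gamma \<nu> * exp (z\<^sup>2 / 4) * parabolic_cylinder_D (- \<nu>) z
    = (exp (z\<^sup>2 / 4) * exp (- (z\<^sup>2 / 4))) *
      ((2 powr (- \<nu> / 2) * (Gamma \<nu> * of_real (sqrt pi)) * rGamma (\<nu> / 2 + 1 / 2)) * kummer_Phi (\<nu> / 2) (1 / 2) (z\<^sup>2 / 2)
      - z * (2 powr (- \<nu> / 2) * (Gamma \<nu> * of_real (sqrt pi)) * of_real (sqrt 2) * rGamma (\<nu> / 2)) * kummer_Phi (\<nu> / 2 + 1 / 2) (3 / 2) (z\<^sup>2 / 2))"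
    unfolding parabolic_cylinder_D_def by (simp add: real_sqrt_mult c right_diff_distrib mult_ac)
  also have "\<dots> = cylinder_integral \<nu> z"
    unfolding e A B cylinder_integral_eq_kummer_Phi[OF \<nu>] c by (simp add: mult_ac)
  finally show ?thesis .
qed

section \<open>Products of parabolic cylinder functions\<close>

text \<open>Fubini together with translation invariance of the inner integral.\<close>

lemma lborel_convolution:
  fixes f g :: "real \<Rightarrow> complex"
  assumes f: "integrable lborel f" and g: "integrable lborel g"
  shows "integrable lborel (\<lambda>s. LBINT x. f x * g (s - x))"
    and "(LBINT s. LBINT x. f x * g (s - x)) = integral\<^sup>L lborel f * integral\<^sup>L lborel g"
proof -
  define P where "P = (\<lambda>(x, s). f x * g (s - x))"
  have [measurable]: "f \<in> borel_measurable borel" "g \<in> borel_measurable borel"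
    using f g by (auto dest: borel_measurable_integrable)
  have shift: "(LBINT s. h (s - x)) = integral\<^sup>L lborel h" for h :: "real \<Rightarrow> 'c :: {banach, second_countable_topology}" and x
    using lborel_integral_real_affine[of 1 h "- x"] by (simp add: add.commute)
  have "integrable (lborel \<Otimes>\<^sub>M lborel) P"
  proof (rule lborel_pair.Fubini_integrable)
    show "P \<in> borel_measurable (lborel \<Otimes>\<^sub>M lborel)" unfolding P_def by measurable
    have "(\<lambda>x. LBINT s. norm (P (x, s))) = (\<lambda>x. norm (f x) * (LBINT s. norm (g s)))"
      by (simp add: P_def norm_mult shift[of "\<lambda>s. norm (g s)"])
    then show "integrable lborel (\<lambda>x. LBINT s. norm (P (x, s)))" using f by simp
    show "AE x in lborel. integrable lborel (\<lambda>s. P (x, s))"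
      using lborel_integrable_real_affine[OF g, of 1 "- x" for x] by (simp add: P_def add.commute)
  qed
  then have P: "integrable (lborel \<Otimes>\<^sub>M lborel) (case_prod (\<lambda>x s. f x * g (s - x)))"
    by (simp add: P_def)
  show "integrable lborel (\<lambda>s. LBINT x. f x * g (s - x))"
    using lborel_pair.integrable_snd[OF P] .
  have "(LBINT s. LBINT x. f x * g (s - x)) = (LBINT x. LBINT s. f x * g (s - x))"
    using lborel_pair.Fubini_integral[OF P] .
  also have "\<dots> = integral\<^sup>L lborel f * integral\<^sup>L lborel g"
    by (simp add: shift)
  finally show "(LBINT s. LBINT x. f x * g (s - x)) = integral\<^sup>L lborel f * integral\<^sup>L lborel g" .
qed

text \<open>The rotation of the plane is done by one-dimensional substitutions in the convolution: s
  = 2u outside, which gives the factor 2, and x = u + v inside.\<close>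

lemma lborel_integral_product_rotate:
  fixes f g :: "real \<Rightarrow> complex"
  assumes "integrable lborel f" "integrable lborel g"
  shows "integrable lborel (\<lambda>u. LBINT v. f (u + v) * g (u - v))"
    and "integral\<^sup>L lborel f * integral\<^sup>L lborel g = 2 * (LBINT u. LBINT v. f (u + v) * g (u - v))"
proof -
  have eq: "(LBINT x. f x * g (2 * u - x)) = (LBINT v. f (u + v) * g (u - v))" for u
    using lborel_integral_real_affine[of 1 "\<lambda>x. f x * g (2 * u - x)" u] by (simp add: algebra_simps)
  show "integrable lborel (\<lambda>u. LBINT v. f (u + v) * g (u - v))"
    using lborel_integrable_real_affine[OF lborel_convolution(1)[OF assms], of 2 0] by (simp add: eq)
  show "integral\<^sup>L lborel f * integral\<^sup>L lborel g = 2 * (LBINT u. LBINT v. f (u + v) * g (u - v))"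
    unfolding lborel_convolution(2)[OF assms, symmetric]
    by (subst lborel_integral_real_affine[of 2 _ 0]) (simp_all add: eq scaleR_conv_of_real)
qed

text \<open>Assumes integrability on the half line only, which is what is known of the inner
  integral in \<open>cylinder_integral_square\<close>.\<close>

lemma lborel_integral_even:
  fixes f :: "real \<Rightarrow> complex"
  assumes f: "f \<in> borel_measurable borel" and even: "\<And>x. f (- x) = f x"
    and int: "set_integrable lborel {0<..} f"
  shows "integral\<^sup>L lborel f = 2 * (LBINT x:{0<..}. f x)"
proof -
  let ?g = "\<lambda>x. indicator {0<..} x *\<^sub>R f x"
  have g: "integrable lborel ?g" using int by (simp add: set_integrable_def)
  have g': "integrable lborel (\<lambda>x. ?g (- x))"
    using lborel_integrable_real_affine[OF g, of "-1" 0] by simp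
  have "integral\<^sup>L lborel f = (LBINT x. ?g x + ?g (- x))"
  proof (rule integral_cong_AE)
    show "AE x in lborel. f x = ?g x + ?g (- x)"
      using AE_lborel_singleton[of 0]
    proof eventually_elim
      case (elim x)
      then show ?case using even[of x] by (auto simp: indicator_def)
    qed
    show "(\<lambda>x. ?g x + ?g (- x)) \<in> borel_measurable lborel"
      using g g' by (intro borel_measurable_integrable Bochner_Integration.integrable_add)
  qed (use f in simp)
  also have "\<dots> = (LBINT x. ?g x) + (LBINT x. ?g (- x))"
    by (rule Bochner_Integration.integral_add[OF g g'])
  also have "(LBINT x. ?g (- x)) = (LBINT x. ?g x)"
    using lborel_integral_real_affine[of "-1" ?g 0] by simp
  finally show ?thesis by (simp add: set_lebesgue_integral_def)
qed

lemma cylinder_integrand_mult: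
  assumes "0 < x" "0 < y"
  shows "cylinder_integrand \<nu> z x * cylinder_integrand \<nu> w y
    = of_real (x * y) powr (\<nu> - 1) * exp (- (z * of_real x + w * of_real y) - of_real (x\<^sup>2 + y\<^sup>2) / 2)"
proof -
  have "of_real (x * y) powr (\<nu> - 1) = (of_real x powr (\<nu> - 1) * of_real y powr (\<nu> - 1) :: complex)"
    using assms by (simp add: powr_times_real)
  moreover have "exp (- (z * of_real x) - (of_real x)\<^sup>2 / 2) * exp (- (w * of_real y) - (of_real y)\<^sup>2 / 2)
      = exp (- (z * of_real x + w * of_real y) - of_real (x\<^sup>2 + y\<^sup>2) / 2)"
  proof -
    have "- (z * of_real x) - (of_real x)\<^sup>2 / 2 + (- (w * of_real y) - (of_real y)\<^sup>2 / 2)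
        = - (z * of_real x + w * of_real y) - of_real (x\<^sup>2 + y\<^sup>2) / 2"
      by (simp add: field_simps)
    then show ?thesis unfolding exp_add[symmetric] by (rule arg_cong)
  qed
  ultimately show ?thesis by (simp add: cylinder_integrand_def)
qed

text \<open>With w = 1 - v^2/u^2 one has u^2 - v^2 = u^2 w and e^(-v^2) = e^(-u^2) e^(u^2 w), and
  the Jacobian supplies (1-w)^(-1/2): this is Euler's integral with Beta parameters
  \<open>\<nu>\<close> and 1/2.\<close>

lemma integral_square_gap_power:
  assumes \<nu>: "Re \<nu> > 0" and u: "u > 0"
  shows "set_integrable lborel {0<..<u} (\<lambda>v. of_real (u\<^sup>2 - v\<^sup>2) powr (\<nu> - 1) * exp (- of_real (v\<^sup>2)) :: complex)"
    and "(LBINT v:{0<..<u}. of_real (u\<^sup>2 - v\<^sup>2) powr (\<nu> - 1) * exp (- of_real (v\<^sup>2)))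
      = of_real u powr (2 * \<nu> - 1) * exp (- of_real (u\<^sup>2)) / 2 * (Beta \<nu> (1 / 2) * kummer_Phi \<nu> (\<nu> + 1 / 2) (of_real (u\<^sup>2)))"
proof -
  let ?p = "of_real u powr (\<nu> - 1) * of_real u powr (\<nu> - 1) :: complex"
  let ?f = "\<lambda>v::real. of_real (u\<^sup>2 - v\<^sup>2) powr (\<nu> - 1) * exp (- of_real (v\<^sup>2)) :: complex"
  let ?g = "\<lambda>w::real. u * sqrt (1 - w)" and ?h = "\<lambda>w::real. - u / (2 * sqrt (1 - w))"
  let ?k = "\<lambda>w::real. exp (of_real (u\<^sup>2) * of_real w) * (of_real w powr (\<nu> - 1) * of_real (1 - w) powr (1 / 2 - 1)) :: complex"
  let ?c = "of_real u powr (2 * \<nu> - 1) * exp (- of_real (u\<^sup>2)) / 2 :: complex"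
  have img: "?g ` {0<..<1} = {0<..<u}"
  proof -
    have "v \<in> ?g ` {0<..<1}" if "0 < v" "v < u" for v
    proof (rule image_eqI)
      have "v\<^sup>2 < u\<^sup>2" using that by (intro power_strict_mono) auto
      then show "1 - v\<^sup>2 / u\<^sup>2 \<in> {0<..<1}" using that by (auto simp: field_simps)
      show "v = ?g (1 - v\<^sup>2 / u\<^sup>2)" using that by (simp add: real_sqrt_divide)
    qed
    moreover have "?g w \<in> {0<..<u}" if "w \<in> {0<..<1}" for w
      using that u by (auto simp: mult_less_cancel_left1)
    ultimately show ?thesis by auto
  qed
  have inj: "inj_on ?g {0<..<1}" using u by (auto simp: inj_on_def)
  have der: "(?g has_real_derivative ?h w) (at w)" if "w \<in> {0<..<1}" for w
    using that by (auto intro!: derivative_eq_intros simp: field_simps)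
  have conth: "continuous_on {0<..<1} ?h" by (auto intro!: continuous_intros)
  have contf: "continuous_on {0<..<u} ?f"
  proof -
    have "v\<^sup>2 < u\<^sup>2" if "v \<in> {0<..<u}" for v using that by (intro power_strict_mono) auto
    then show ?thesis by (intro continuous_intros) (auto simp: complex_nonneg_Reals_iff less_imp_le dest!: less_imp_neq simp del: of_real_diff)
  qed
  note sub = set_integral_change_of_variables_real[OF open_greaterThanLessThan open_greaterThanLessThan img inj der conth contf]
  have eq: "\<bar>?h w\<bar> *\<^sub>R ?f (?g w) = ?c * ?k w" if "w \<in> {0<..<1}" for w
  proof -
    have w: "0 < w" "w < 1" using that by auto
    have g2: "(?g w)\<^sup>2 = u\<^sup>2 * (1 - w)" using w by (simp add: power_mult_distrib)
    have "u\<^sup>2 - (?g w)\<^sup>2 = (u * u) * w" unfolding g2 by (simp add: power2_eq_square algebra_simps)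
    then have "of_real (u\<^sup>2 - (?g w)\<^sup>2) powr (\<nu> - 1) = (?p * of_real w powr (\<nu> - 1) :: complex)"
      using u w by (simp add: powr_times_real)
    moreover have "exp (- of_real ((?g w)\<^sup>2)) = exp (- of_real (u\<^sup>2)) * (exp (of_real (u\<^sup>2) * of_real w) :: complex)"
      unfolding g2 by (simp add: exp_add[symmetric] algebra_simps)
    moreover have "complex_of_real \<bar>?h w\<bar> = of_real u / 2 * of_real (1 - w) powr (1 / 2 - 1)"
    proof -
      have "of_real (1 - w) powr (1 / 2 - 1) = complex_of_real (1 / sqrt (1 - w))"
        using w powr_minus_half_of_real[of "1 - w"] by (simp del: of_real_diff)
      then show ?thesis using u w by (simp del: of_real_diff)
    qed
    moreover have "of_real u * (?p) = (of_real u powr (2 * \<nu> - 1) :: complex)"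
      unfolding of_real_powr_twice[OF u] by (simp add: algebra_simps)
    moreover have "(x / 2 * r) * ((p * p * y) * (e * k)) = (x * (p * p)) * e / 2 * (k * (y * r))"
      for x r p y e k :: complex
      by (simp add: mult_ac)
    ultimately show ?thesis unfolding scaleR_conv_of_real by (simp only:)
  qed
  have u0: "?c \<noteq> 0" using u by simp
  have half: "Re (1 / 2) > 0" by simp
  note k = kummer_Phi_integral[OF \<nu> half, of "of_real (u\<^sup>2)"]
  have "set_integrable lborel {0<..<1} (\<lambda>w. \<bar>?h w\<bar> *\<^sub>R ?f (?g w))"
    using set_integrable_mult_right[OF k(1), of ?c] by (subst set_integrable_cong[OF refl refl eq]) auto
  then show "set_integrable lborel {0<..<u} ?f" using sub(1) by blast
  have "(LBINT v:{0<..<u}. ?f v) = (LBINT w:{0<..<1}. \<bar>?h w\<bar> *\<^sub>R ?f (?g w))" by (rule sub(2))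
  also have "\<dots> = (LBINT w:{0<..<1}. ?c * ?k w)"
    by (intro set_lebesgue_integral_cong) (use eq in auto)
  also have "\<dots> = ?c * (LBINT w:{0<..<1}. ?k w)" by (rule set_integral_mult_right)
  also have "(LBINT w:{0<..<1}. ?k w) = Beta \<nu> (1 / 2) * kummer_Phi \<nu> (\<nu> + 1 / 2) (of_real (u\<^sup>2))" by (rule k(2))
  finally show "(LBINT v:{0<..<u}. ?f v) = ?c * (Beta \<nu> (1 / 2) * kummer_Phi \<nu> (\<nu> + 1 / 2) (of_real (u\<^sup>2)))" .
qed

text \<open>With t = v^2/u^2 - 1 one has v^2 - u^2 = u^2 t, and the Jacobian supplies (1+t)^(-1/2).
  The exponent -1/2 is b - a - 1 for a = \<open>\<nu>\<close> and b =
  \<open>\<nu> + 1 / 2\<close>.\<close>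

lemma integral_square_excess_power:
  assumes \<nu>: "Re \<nu> > 0" and u: "u > 0"
  shows "(LBINT v:{u<..}. of_real (v\<^sup>2 - u\<^sup>2) powr (\<nu> - 1) * exp (- of_real (v\<^sup>2)))
      = of_real u powr (2 * \<nu> - 1) * exp (- of_real (u\<^sup>2)) / 2 * tricomi_integral \<nu> (- 1 / 2) (of_real (u\<^sup>2))"
proof -
  let ?p = "of_real u powr (\<nu> - 1) * of_real u powr (\<nu> - 1) :: complex"
  let ?f = "\<lambda>v::real. of_real (v\<^sup>2 - u\<^sup>2) powr (\<nu> - 1) * exp (- of_real (v\<^sup>2)) :: complex"
  let ?g = "\<lambda>t::real. u * sqrt (1 + t)" and ?h = "\<lambda>t::real. u / (2 * sqrt (1 + t))"
  let ?c = "of_real u powr (2 * \<nu> - 1) * exp (- of_real (u\<^sup>2)) / 2 :: complex"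
  have img: "?g ` {0<..} = {u<..}"
  proof -
    have "v \<in> ?g ` {0<..}" if "u < v" for v
    proof (rule image_eqI)
      have "u\<^sup>2 < v\<^sup>2" using that u by (intro power_strict_mono) auto
      then show "v\<^sup>2 / u\<^sup>2 - 1 \<in> {0<..}" using u by (auto simp: field_simps)
      show "v = ?g (v\<^sup>2 / u\<^sup>2 - 1)" using that u by (simp add: real_sqrt_divide)
    qed
    moreover have "?g t \<in> {u<..}" if "t \<in> {0<..}" for t
      using that u by auto
    ultimately show ?thesis by auto
  qed
  have inj: "inj_on ?g {0<..}" using u by (auto simp: inj_on_def)
  have der: "(?g has_real_derivative ?h t) (at t)" if "t \<in> {0<..}" for t
    using that by (auto intro!: derivative_eq_intros simp: field_simps)
  have conth: "continuous_on {0<..} ?h" by (auto intro!: continuous_intros)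
  have contf: "continuous_on {u<..} ?f"
  proof -
    have pos: "0 < v\<^sup>2 - u\<^sup>2" if "u < v" for v using that u by (simp add: power_strict_mono)
    show ?thesis by (intro continuous_intros) (auto dest: pos simp del: of_real_diff)
  qed
  note sub = set_integral_change_of_variables_real[OF open_greaterThan open_greaterThan img inj der conth contf]
  have eq: "\<bar>?h t\<bar> *\<^sub>R ?f (?g t) = ?c * tricomi_integrand \<nu> (- 1 / 2) (of_real (u\<^sup>2)) t" if "t \<in> {0<..}" for t
  proof -
    have t: "0 < t" using that by auto
    have g2: "(?g t)\<^sup>2 = u\<^sup>2 * (1 + t)" using t by (simp add: power_mult_distrib)
    have "(?g t)\<^sup>2 - u\<^sup>2 = (u * u) * t" unfolding g2 by (simp add: power2_eq_square algebra_simps)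
    then have "of_real ((?g t)\<^sup>2 - u\<^sup>2) powr (\<nu> - 1) = (?p * of_real t powr (\<nu> - 1) :: complex)"
      using u t by (simp add: powr_times_real)
    moreover have "exp (- of_real ((?g t)\<^sup>2)) = exp (- of_real (u\<^sup>2)) * (exp (- (of_real (u\<^sup>2) * of_real t)) :: complex)"
      unfolding g2 by (simp add: exp_add[symmetric] algebra_simps)
    moreover have "complex_of_real \<bar>?h t\<bar> = of_real u / 2 * of_real (1 + t) powr (- 1 / 2)"
    proof -
      have "of_real (1 + t) powr (- 1 / 2) = complex_of_real (1 / sqrt (1 + t))"
        using t by (intro powr_minus_half_of_real) simp
      then show ?thesis using u t by (simp del: of_real_add)
    qed
    moreover have "of_real u * (?p) = (of_real u powr (2 * \<nu> - 1) :: complex)"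
      unfolding of_real_powr_twice[OF u] by (simp add: algebra_simps)
    moreover have "(x / 2 * r) * ((p * p * y) * (e * k)) = (x * (p * p)) * e / 2 * (k * y * r)"
      for x r p y e k :: complex
      by (simp add: mult_ac)
    ultimately show ?thesis unfolding scaleR_conv_of_real tricomi_integrand_def by (simp only:)
  qed
  have "(LBINT v:{u<..}. ?f v) = (LBINT t:{0<..}. \<bar>?h t\<bar> *\<^sub>R ?f (?g t))" by (rule sub(2))
  also have "\<dots> = (LBINT t:{0<..}. ?c * tricomi_integrand \<nu> (- 1 / 2) (of_real (u\<^sup>2)) t)"
    by (intro set_lebesgue_integral_cong) (use eq in auto)
  also have "\<dots> = ?c * tricomi_integral \<nu> (- 1 / 2) (of_real (u\<^sup>2))"
    by (simp add: tricomi_integral_def)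
  finally show "(LBINT v:{u<..}. ?f v) = ?c * tricomi_integral \<nu> (- 1 / 2) (of_real (u\<^sup>2))" .
qed

section \<open>Gaussian integrals\<close>

lemma kummer_Phi_same:
  assumes "a \<notin> \<int>\<^sub>\<le>\<^sub>0"
  shows "kummer_Phi a a z = exp z"
proof -
  have "pochhammer a n / pochhammer a n * z ^ n / fact n = z ^ n /\<^sub>R fact n" for n
    using pochhammer_nonzero[OF assms, of n] by (simp add: scaleR_conv_of_real divide_inverse mult.commute)
  then show ?thesis
    using kummer_Phi_sums[of a a z] exp_converges[of z] by (simp only: sums_unique2)
qed

text \<open>After scaling by sqrt(2 \<beta>) the integral is half the sum of
  \<open>cylinder_integral\<close> with index 1 at two opposite arguments. The odd parts cancel, and
  the even part is Kummer's function with equal parameters, an exponential.\<close>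

lemma has_Gaussian_cosh_integral:
  fixes w :: complex and \<beta> :: real
  assumes \<beta>: "\<beta> > 0"
  shows "set_integrable lborel {0<..} (\<lambda>u. cosh (w * of_real u) * exp (- (of_real \<beta> * of_real (u\<^sup>2))))"
    and "(LBINT u:{0<..}. cosh (w * of_real u) * exp (- (of_real \<beta> * of_real (u\<^sup>2))))
      = of_real (sqrt pi / (2 * sqrt \<beta>)) * exp (w\<^sup>2 / (4 * of_real \<beta>))"
proof -
  define c where "c = sqrt (2 * \<beta>)"
  have c: "c > 0" "c\<^sup>2 = 2 * \<beta>" using \<beta> by (auto simp: c_def)
  define w' where "w' = w / of_real c"
  let ?f = "\<lambda>x::real. cosh (w' * of_real x) * exp (- of_real (x\<^sup>2) / 2)"
  let ?k = "\<lambda>u::real. cosh (w * of_real u) * exp (- (of_real \<beta> * of_real (u\<^sup>2)))"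
  have one: "Re 1 > 0" by simp
  have eq: "cylinder_integrand 1 w' x + cylinder_integrand 1 (- w') x = 2 * ?f x" if "x > 0" for x
    using that unfolding cylinder_integrand_def cosh_field_def diff_conv_add_uminus exp_add
    by (simp add: algebra_simps)
  have ints: "set_integrable lborel {0<..} (cylinder_integrand 1 y)" for y
    using set_integrable_cylinder_integrand[OF one] .
  have "set_integrable lborel {0<..} (\<lambda>x. 2 * ?f x)"
    using set_integral_add(1)[OF ints[of w'] ints[of "- w'"]] by (subst set_integrable_cong[OF refl refl eq[symmetric]]) auto
  then have intf: "set_integrable lborel {0<..} ?f" by simp
  have "2 * (LBINT x:{0<..}. ?f x) = (LBINT x:{0<..}. 2 * ?f x)" by simp
  also have "\<dots> = (LBINT x:{0<..}. cylinder_integrand 1 w' x + cylinder_integrand 1 (- w') x)"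
    by (intro set_lebesgue_integral_cong) (use eq in auto)
  also have "\<dots> = cylinder_integral 1 w' + cylinder_integral 1 (- w')"
    unfolding cylinder_integral_def by (rule set_integral_add(2)[OF ints ints])
  also have "\<dots> = 2 * (2 powr (1 / 2 - 1) * Gamma (1 / 2)) * kummer_Phi (1 / 2) (1 / 2) (w'\<^sup>2 / 2)"
    unfolding cylinder_integral_eq_kummer_Phi[OF one] by simp
  also have "kummer_Phi (1 / 2) (1 / 2) (w'\<^sup>2 / 2) = exp (w'\<^sup>2 / 2)"
    by (intro kummer_Phi_same Re_pos_notin_nonpos_Ints) simp
  also have "2 * (2 powr (1 / 2 - 1) * Gamma (1 / 2)) = (of_real (sqrt 2 * sqrt pi) :: complex)"
  proof -
    have "2 powr (1 / 2 - 1) = complex_of_real (1 / sqrt 2)"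
      using powr_minus_half_of_real[of 2] by simp
    then have "2 * (2 powr (1 / 2 - 1) * Gamma (1 / 2)) = complex_of_real (2 * (1 / sqrt 2) * sqrt pi)"
      by (simp add: Gamma_one_half_complex)
    also have "2 * (1 / sqrt 2) = sqrt 2" by (simp add: real_div_sqrt)
    finally show ?thesis .
  qed
  also have "w'\<^sup>2 / 2 = w\<^sup>2 / (4 * of_real \<beta>)"
  proof -
    have "(of_real c)\<^sup>2 = (2 * of_real \<beta> :: complex)" unfolding of_real_power[symmetric] c(2) by simp
    then show ?thesis by (simp add: w'_def power_divide)
  qed
  finally have val: "2 * (LBINT x:{0<..}. ?f x) = of_real (sqrt 2 * sqrt pi) * exp (w\<^sup>2 / (4 * of_real \<beta>))" .
  have contf: "continuous_on {0<..} ?f"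
    unfolding cosh_field_def by (intro continuous_intros) auto
  note sub = set_integral_scale_Ioi[OF c(1) contf]
  have eq': "of_real c * ?f (c * u) = of_real c * ?k u" for u
  proof -
    have "w' * of_real (c * u) = w * of_real u" using c by (simp add: w'_def)
    moreover have sq: "(c * u)\<^sup>2 = 2 * (\<beta> * u\<^sup>2)" using c(2) by (simp add: power_mult_distrib)
    have "- complex_of_real ((c * u)\<^sup>2) / 2 = - (of_real \<beta> * of_real (u\<^sup>2))"
      unfolding sq by simp
    ultimately show ?thesis by (simp only:)
  qed
  have c0: "complex_of_real c \<noteq> 0" using c by simp
  have "set_integrable lborel {0<..} (\<lambda>u. of_real c * ?k u)"
    using sub(1) intf unfolding eq' by blast
  then show "set_integrable lborel {0<..} ?k" using c0 by simp
  have "(LBINT x:{0<..}. ?f x) = of_real c * (LBINT u:{0<..}. ?k u)"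
    using sub(2) unfolding eq' by simp
  with val have "2 * (of_real c * (LBINT u:{0<..}. ?k u)) = of_real (sqrt 2 * sqrt pi) * exp (w\<^sup>2 / (4 * of_real \<beta>))"
    by simp
  then have "(LBINT u:{0<..}. ?k u) = of_real (sqrt 2 * sqrt pi / (2 * c)) * exp (w\<^sup>2 / (4 * of_real \<beta>))"
    using c0 by (simp add: field_simps)
  also have "sqrt 2 * sqrt pi / (2 * c) = sqrt pi / (2 * sqrt \<beta>)"
    using \<beta> by (simp add: c_def real_sqrt_mult)
  finally show "(LBINT u:{0<..}. ?k u) = of_real (sqrt pi / (2 * sqrt \<beta>)) * exp (w\<^sup>2 / (4 * of_real \<beta>))" .
qed

text \<open>The growth e^(|w| u) of the cosine is absorbed by |w| u <= |w|^2/2 + u^2/2, at the price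
  of 1/2 in the Gaussian rate.\<close>

lemma norm_Gaussian_cosh_integral_le:
  fixes w :: complex and \<beta> :: real
  assumes \<beta>: "\<beta> > 1 / 2"
  shows "(LBINT u:{0<..}. norm (cosh (w * of_real u) * exp (- (of_real \<beta> * of_real (u\<^sup>2)))))
      \<le> exp ((norm w)\<^sup>2 / 2) * (sqrt pi / (2 * sqrt (\<beta> - 1 / 2)))"
proof -
  have b: "\<beta> > 0" "\<beta> - 1 / 2 > 0" using \<beta> by auto
  let ?g = "\<lambda>u::real. exp (- ((\<beta> - 1 / 2) * u\<^sup>2))"
  have g: "cosh (0 * of_real u) * exp (- (of_real (\<beta> - 1 / 2) * of_real (u\<^sup>2))) = complex_of_real (?g u)" for u
    by (simp add: exp_of_real[symmetric])
  note G = has_Gaussian_cosh_integral[OF b(2), of 0, unfolded g]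
  have "complex_of_real (LBINT u:{0<..}. ?g u) = complex_of_real (sqrt pi / (2 * sqrt (\<beta> - 1 / 2)))"
    using G(2) unfolding set_integral_complex_of_real[symmetric] by simp
  then have val: "(LBINT u:{0<..}. ?g u) = sqrt pi / (2 * sqrt (\<beta> - 1 / 2))"
    by (simp only: of_real_eq_iff)
  have intg: "set_integrable lborel {0<..} ?g"
    using set_integrable_norm[OF G(1)] by simp
  have "(LBINT u:{0<..}. norm (cosh (w * of_real u) * exp (- (of_real \<beta> * of_real (u\<^sup>2)))))
      \<le> (LBINT u:{0<..}. exp ((norm w)\<^sup>2 / 2) * ?g u)"
  proof (rule set_integral_mono)
    show "set_integrable lborel {0<..} (\<lambda>u. norm (cosh (w * of_real u) * exp (- (of_real \<beta> * of_real (u\<^sup>2)))))"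
      by (intro set_integrable_norm has_Gaussian_cosh_integral(1) b)
    show "set_integrable lborel {0<..} (\<lambda>u. exp ((norm w)\<^sup>2 / 2) * ?g u)"
      using intg by simp
    fix u :: real assume "u \<in> {0<..}"
    then have u: "u > 0" by simp
    have "norm (cosh (w * of_real u)) \<le> (norm (exp (w * of_real u)) + norm (exp (- (w * of_real u)))) / 2"
      unfolding cosh_field_def using norm_triangle_ineq[of "exp (w * of_real u)" "exp (- (w * of_real u))"]
      by (simp add: norm_divide divide_right_mono)
    also have "\<dots> \<le> (exp (norm w * u) + exp (norm w * u)) / 2"
    proof -
      have "Re w * u \<le> norm w * u" "- Re w * u \<le> norm w * u"
        using u complex_Re_le_cmod[of w] complex_Re_le_cmod[of "- w"]
          mult_right_mono[of "Re w" "norm w" u] mult_right_mono[of "- Re w" "norm w" u] by simp_all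
      then show ?thesis by (intro divide_right_mono add_mono) auto
    qed
    finally have "norm (cosh (w * of_real u)) \<le> exp (norm w * u)" by simp
    moreover have "norm (exp (- (of_real \<beta> * of_real (u\<^sup>2)) :: complex)) = exp (- (\<beta> * u\<^sup>2))"
      by (simp add: power2_eq_square)
    ultimately have "norm (cosh (w * of_real u) * exp (- (of_real \<beta> * of_real (u\<^sup>2)))) \<le> exp (norm w * u) * exp (- (\<beta> * u\<^sup>2))"
      by (simp only: norm_mult) (rule mult_right_mono, simp_all)
    also have "\<dots> \<le> exp ((norm w)\<^sup>2 / 2) * ?g u"
    proof -
      have "0 \<le> (norm w - u)\<^sup>2" by simp
      then have "norm w * u + - (\<beta> * u\<^sup>2) \<le> (norm w)\<^sup>2 / 2 + - ((\<beta> - 1 / 2) * u\<^sup>2)"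
        by (simp add: power2_eq_square algebra_simps)
      then show ?thesis unfolding exp_add[symmetric] by simp
    qed
    finally show "norm (cosh (w * of_real u) * exp (- (of_real \<beta> * of_real (u\<^sup>2)))) \<le> exp ((norm w)\<^sup>2 / 2) * ?g u" .
  qed
  also have "\<dots> = exp ((norm w)\<^sup>2 / 2) * (sqrt pi / (2 * sqrt (\<beta> - 1 / 2)))"
    using val by simp
  finally show ?thesis .
qed

section \<open>Rotated products of cylinder integrals\<close>

lemma integrable_cylinder_cutoff:
  assumes "Re \<nu> > 0"
  shows "integrable lborel (\<lambda>x. indicator {0<..} x *\<^sub>R cylinder_integrand \<nu> z x)"
    and "(LBINT x. indicator {0<..} x *\<^sub>R cylinder_integrand \<nu> z x) = cylinder_integral \<nu> z"
  using set_integrable_cylinder_integrand[OF assms, of z]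
  by (simp_all add: set_integrable_def cylinder_integral_def set_lebesgue_integral_def)

lemma Beta_half_nonzero: "Re \<nu> > 0 \<Longrightarrow> Beta \<nu> (1 / 2) \<noteq> 0"
  using Re_pos_notin_nonpos_Ints[of \<nu>] Re_pos_notin_nonpos_Ints[of "\<nu> + 1 / 2"] Re_pos_notin_nonpos_Ints[of "1 / 2"]
  by (simp add: Beta_def Gamma_eq_zero_iff)

lemma cylinder_integral_square:
  fixes \<nu> z :: complex
  assumes \<nu>: "Re \<nu> > 0"
  defines "K \<equiv> \<lambda>x::real. of_real x powr (2 * \<nu> - 1) * exp (- 2 * z * of_real x - 2 * (of_real x)\<^sup>2)
              * kummer_Phi \<nu> (\<nu> + 1 / 2) ((of_real x)\<^sup>2)"
  shows "set_integrable lborel {0<..} K"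
    and "(cylinder_integral \<nu> z)\<^sup>2 = 2 * Beta \<nu> (1 / 2) * (LBINT x:{0<..}. K x)"
proof -
  define F where "F x = indicator {0<..} x *\<^sub>R cylinder_integrand \<nu> z x" for x
  have F: "integrable lborel F" "integral\<^sup>L lborel F = cylinder_integral \<nu> z"
    unfolding F_def by (rule integrable_cylinder_cutoff[OF \<nu>])+
  have Fm [measurable]: "F \<in> borel_measurable borel" using borel_measurable_integrable[OF F(1)] by simp
  \<comment> \<open>Both cutoffs are active exactly for |v| < u, so the inner integral is 0 for u <=
    0 and, by evenness in v, twice the integral over 0 < v < u otherwise.\<close>
  have H: "(LBINT v. F (u + v) * F (u - v)) = indicator {0<..} u *\<^sub>R (Beta \<nu> (1 / 2) * K u)" for u
  proof (cases "u > 0")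
    case False
    then have "(\<lambda>v. F (u + v) * F (u - v)) = (\<lambda>_. 0)" by (auto simp: F_def indicator_def)
    then show ?thesis using False by (simp only:) simp
  next
    case u: True
    let ?g = "\<lambda>v::real. of_real (u\<^sup>2 - v\<^sup>2) powr (\<nu> - 1) * exp (- of_real (v\<^sup>2)) :: complex"
    let ?e = "exp (- (2 * z * of_real u) - of_real (u\<^sup>2))"
    have eq: "indicator {0<..} v *\<^sub>R (F (u + v) * F (u - v)) = indicator {0<..<u} v *\<^sub>R (?e * ?g v)" for v
    proof (cases "0 < v \<and> v < u")
      case True
      then have "F (u + v) * F (u - v) = cylinder_integrand \<nu> z (u + v) * cylinder_integrand \<nu> z (u - v)"
        using u by (simp add: F_def)
      also have "\<dots> = of_real ((u + v) * (u - v)) powr (\<nu> - 1)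
         * exp (- (z * of_real (u + v) + z * of_real (u - v)) - of_real ((u + v)\<^sup>2 + (u - v)\<^sup>2) / 2)"
        by (rule cylinder_integrand_mult) (use True u in auto)
      also have "(u + v) * (u - v) = u\<^sup>2 - v\<^sup>2" by (simp add: power2_eq_square algebra_simps)
      also have "- (z * of_real (u + v) + z * of_real (u - v)) - of_real ((u + v)\<^sup>2 + (u - v)\<^sup>2) / 2
         = - (2 * z * of_real u) - of_real (u\<^sup>2) + (- of_real (v\<^sup>2))"
        by (simp add: power2_eq_square field_simps)
      finally show ?thesis using True unfolding exp_add by (simp add: mult_ac)
    next
      case False
      then show ?thesis by (auto simp: F_def indicator_def)
    qed
    have g: "set_integrable lborel {0<..<u} (\<lambda>v. ?e * ?g v)"
      using integral_square_gap_power(1)[OF \<nu> u] by (intro set_integrable_mult_right) auto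
    have "(LBINT v. F (u + v) * F (u - v)) = 2 * (LBINT v:{0<..}. F (u + v) * F (u - v))"
    proof (rule lborel_integral_even)
      show "set_integrable lborel {0<..} (\<lambda>v. F (u + v) * F (u - v))"
        using g unfolding set_integrable_def eq .
    qed (simp_all add: mult.commute)
    also have "(LBINT v:{0<..}. F (u + v) * F (u - v)) = (LBINT v:{0<..<u}. ?e * ?g v)"
      unfolding set_lebesgue_integral_def eq ..
    also have "\<dots> = ?e * (LBINT v:{0<..<u}. ?g v)" by (rule set_integral_mult_right)
    also have "\<dots> = ?e * (of_real u powr (2 * \<nu> - 1) * exp (- of_real (u\<^sup>2)) / 2 * (Beta \<nu> (1 / 2) * kummer_Phi \<nu> (\<nu> + 1 / 2) (of_real (u\<^sup>2))))"
      unfolding integral_square_gap_power(2)[OF \<nu> u] ..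
    finally have "(LBINT v. F (u + v) * F (u - v)) = (?e * exp (- of_real (u\<^sup>2))) * of_real u powr (2 * \<nu> - 1) * (Beta \<nu> (1 / 2) * kummer_Phi \<nu> (\<nu> + 1 / 2) (of_real (u\<^sup>2)))"
      by simp
    also have "?e * exp (- of_real (u\<^sup>2)) = exp (- 2 * z * of_real u - 2 * (of_real u)\<^sup>2)"
      unfolding exp_add[symmetric] by (simp add: algebra_simps)
    finally show ?thesis using u by (simp add: K_def mult_ac)
  qed
  have nz: "Beta \<nu> (1 / 2) \<noteq> 0" using \<nu> by (rule Beta_half_nonzero)
  have "set_integrable lborel {0<..} (\<lambda>x. Beta \<nu> (1 / 2) * K x)"
    using lborel_integral_product_rotate(1)[OF F(1) F(1)] unfolding H set_integrable_def .
  then show "set_integrable lborel {0<..} K" using nz by simp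
  show "(cylinder_integral \<nu> z)\<^sup>2 = 2 * Beta \<nu> (1 / 2) * (LBINT x:{0<..}. K x)"
    using lborel_integral_product_rotate(2)[OF F(1) F(1)] unfolding H F(2)
    by (simp add: power2_eq_square set_lebesgue_integral_def[symmetric])
qed

lemma cylinder_integral_mult_reflected:
  fixes \<nu> z :: complex
  assumes \<nu>: "Re \<nu> > 0"
  defines "K \<equiv> \<lambda>x::real. cosh (2 * z * of_real x) * of_real x powr (2 * \<nu> - 1) * exp (- 2 * (of_real x)\<^sup>2)
      * tricomi_integral \<nu> (- 1 / 2) ((of_real x)\<^sup>2)"
  shows "set_integrable lborel {0<..} K"
    and "cylinder_integral \<nu> z * cylinder_integral \<nu> (- z) = 2 * (LBINT x:{0<..}. K x)"
proof -
  define F where "F w x = indicator {0<..} x *\<^sub>R cylinder_integrand \<nu> w x" for w x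
  have F: "integrable lborel (F w)" "integral\<^sup>L lborel (F w) = cylinder_integral \<nu> w" for w
    unfolding F_def by (rule integrable_cylinder_cutoff[OF \<nu>])+
  \<comment> \<open>Reflecting the second factor keeps its integral and moves its support to u - v <
    0; both cutoffs are then active exactly for v > |u|, and the linear exponent -z(v+u) + z(v-u)
    becomes -2zu, free of v.\<close>
  define G where "G x = F (- z) (- x)" for x
  have G: "integrable lborel G" "integral\<^sup>L lborel G = cylinder_integral \<nu> (- z)"
    unfolding G_def using lborel_integrable_real_affine[OF F(1), of "-1" "- z" 0]
      lborel_integral_real_affine[of "-1" "F (- z)" 0] F(2)[of "- z"] by simp_all
  define H where "H u = (LBINT v. F z (u + v) * G (u - v))" for u
  have H: "H u = exp (- (2 * z * of_real u)) * (exp (- 2 * (of_real \<bar>u\<bar>)\<^sup>2) * of_real \<bar>u\<bar> powr (2 * \<nu> - 1) / 2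
      * tricomi_integral \<nu> (- 1 / 2) ((of_real \<bar>u\<bar>)\<^sup>2))" if "u \<noteq> 0" for u
  proof -
    let ?g = "\<lambda>v::real. of_real (v\<^sup>2 - \<bar>u\<bar>\<^sup>2) powr (\<nu> - 1) * exp (- of_real (v\<^sup>2)) :: complex"
    let ?e = "exp (- (2 * z * of_real u) - of_real (u\<^sup>2))"
    have u: "\<bar>u\<bar> > 0" using that by simp
    have eq: "F z (u + v) * G (u - v) = indicator {\<bar>u\<bar><..} v *\<^sub>R (?e * ?g v)" for v
    proof (cases "\<bar>u\<bar> < v")
      case True
      then have "F z (u + v) * G (u - v) = cylinder_integrand \<nu> z (v + u) * cylinder_integrand \<nu> (- z) (v - u)"
        by (auto simp: F_def G_def add.commute)
      also have "\<dots> = of_real ((v + u) * (v - u)) powr (\<nu> - 1)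
         * exp (- (z * of_real (v + u) + - z * of_real (v - u)) - of_real ((v + u)\<^sup>2 + (v - u)\<^sup>2) / 2)"
        by (rule cylinder_integrand_mult) (use True in auto)
      also have "(v + u) * (v - u) = v\<^sup>2 - \<bar>u\<bar>\<^sup>2" by (simp add: power2_eq_square algebra_simps)
      also have "- (z * of_real (v + u) + - z * of_real (v - u)) - of_real ((v + u)\<^sup>2 + (v - u)\<^sup>2) / 2
         = - (2 * z * of_real u) - of_real (u\<^sup>2) + (- of_real (v\<^sup>2))"
        by (simp add: power2_eq_square field_simps)
      finally show ?thesis using True unfolding exp_add by (simp add: mult_ac)
    next
      case False
      then have "\<not> (0 < u + v \<and> 0 < v - u)" by auto
      then show ?thesis using False by (auto simp: F_def G_def indicator_def)
    qed
    have "H u = (LBINT v:{\<bar>u\<bar><..}. ?e * ?g v)"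
      unfolding H_def set_lebesgue_integral_def eq ..
    also have "\<dots> = ?e * (LBINT v:{\<bar>u\<bar><..}. ?g v)" by (rule set_integral_mult_right)
    also have "\<dots> = ?e * (of_real \<bar>u\<bar> powr (2 * \<nu> - 1) * exp (- of_real (\<bar>u\<bar>\<^sup>2)) / 2 * tricomi_integral \<nu> (- 1 / 2) (of_real (\<bar>u\<bar>\<^sup>2)))"
      unfolding integral_square_excess_power[OF \<nu> u] ..
    finally have "H u = (?e * exp (- of_real (\<bar>u\<bar>\<^sup>2))) * of_real \<bar>u\<bar> powr (2 * \<nu> - 1) / 2 * tricomi_integral \<nu> (- 1 / 2) (of_real (\<bar>u\<bar>\<^sup>2))"
      by simp
    also have "?e * exp (- of_real (\<bar>u\<bar>\<^sup>2)) = exp (- (2 * z * of_real u)) * exp (- 2 * (of_real \<bar>u\<bar>)\<^sup>2)"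
      unfolding exp_add[symmetric] of_real_power[symmetric] by (simp add: algebra_simps)
    finally show ?thesis by (simp add: mult_ac flip: of_real_power)
  qed
  \<comment> \<open>Everything in \<open>H\<close> except exp(-2zu) depends on |u| only.\<close>
  have HK: "H u + H (- u) = K u" if "u \<in> {0<..}" for u
  proof -
    have u: "u \<noteq> 0" "- u \<noteq> 0" "\<bar>u\<bar> = u" "\<bar>- u\<bar> = u" using that by auto
    have "exp (- (2 * z * of_real u)) + exp (- (2 * z * of_real (- u))) = 2 * cosh (2 * z * of_real u)"
      by (simp add: cosh_field_def add.commute)
    then show ?thesis
      unfolding H[OF u(1)] H[OF u(2)] u(3,4) distrib_right[symmetric] K_def by simp
  qed
  note rot = lborel_integral_product_rotate[OF F(1)[of z] G(1), folded H_def]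
  note ev = lborel_integral_eq_integral_even_part[OF rot(1)]
  show "set_integrable lborel {0<..} K"
    using ev(1) by (subst set_integrable_cong[OF refl refl HK[symmetric]]) auto
  have "(LBINT x:{0<..}. H x + H (- x)) = (LBINT x:{0<..}. K x)"
    by (intro set_lebesgue_integral_cong) (use HK in auto)
  then show "cylinder_integral \<nu> z * cylinder_integral \<nu> (- z) = 2 * (LBINT x:{0<..}. K x)"
    using rot(2) ev(2) by (simp add: F(2) G(2))
qed

section \<open>The two Gaussian mixtures of the third identity\<close>

text \<open>Inserting the Laplace integral for \<open>tricomi_integral\<close> makes the integral
  over u a Gaussian one of rate 2 + t.\<close>

lemma cylinder_product_Fubini:
  fixes \<nu> z :: complex
  assumes \<nu>: "Re \<nu> > 0"
  shows "(LBINT u:{0<..}. cosh (2 * z * of_real u) * exp (- 2 * (of_real u)\<^sup>2) * tricomi_integral (1 / 2) (- \<nu>) ((of_real u)\<^sup>2))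
    = of_real (sqrt pi / 2) * (LBINT t:{0<..}. of_real t powr (1 / 2 - 1) * of_real (1 + t) powr (- \<nu>)
         * of_real (1 / sqrt (2 + t)) * exp (z\<^sup>2 / of_real (2 + t)))"
proof -
  let ?w = "\<lambda>t::real. of_real t powr (1 / 2 - 1) * of_real (1 + t) powr (- \<nu>) :: complex"
  let ?G = "\<lambda>u t::real. cosh (2 * z * of_real u) * exp (- (of_real (2 + t) * of_real (u\<^sup>2))) :: complex"
  let ?E = "\<lambda>u::real. cosh (2 * z * of_real u) * exp (- 2 * (of_real u)\<^sup>2) :: complex"
  let ?K = "\<lambda>u::real. tricomi_integral (1 / 2) (- \<nu>) ((of_real u)\<^sup>2)"
  let ?T = "tricomi_integrand (1 / 2) (- (1 / 2 + \<nu>)) 0"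
  define f :: "real \<Rightarrow> real \<Rightarrow> complex" where
    "f u t = ?G u t * (?w t)" for u t
  let ?C = "exp ((norm (2 * z))\<^sup>2 / 2) * (sqrt pi / 2)"
  have cont: "continuous_on ({0<..} \<times> {0<..}) (\<lambda>(u, t). f u t)"
    unfolding f_def case_prod_unfold cosh_field_def by (intro continuous_intros) (auto simp del: of_real_add)
  have inner: "set_integrable lborel {0<..} (\<lambda>u. f u t)" if "t \<in> {0<..}" for t
    unfolding f_def by (intro set_integrable_mult_left has_Gaussian_cosh_integral(1)) (use that in auto)
  have tri: "?T t = ?w t * of_real (1 / sqrt (1 + t))"
    if "t > 0" for t
  proof -
    have "complex_of_real (1 / sqrt (1 + t)) = of_real (1 + t) powr (- (1 / 2))"
      using that powr_minus_half_of_real[of "1 + t"] by (simp del: of_real_add)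
    then have "of_real (1 + t) powr (- \<nu>) * complex_of_real (1 / sqrt (1 + t)) = of_real (1 + t) powr (- \<nu> + - (1 / 2))"
      unfolding powr_add by simp
    also have "- \<nu> + - (1 / 2) = - (1 / 2 + \<nu>)" by simp
    finally show ?thesis unfolding tricomi_integrand_def mult.assoc by (simp only:) simp
  qed
  \<comment> \<open>The norm estimate lowers the rate to 2 + t - 1/2, which is still at least 1 + t;
    the majorant thus becomes the Beta integrand \<open>?T\<close>.\<close>
  have bound: "(LBINT u:{0<..}. norm (f u t)) \<le> ?C * norm (?T t)" if "t \<in> {0<..}" for t
  proof -
    have t: "t > 0" using that by simp
    have "(LBINT u:{0<..}. norm (f u t)) = (LBINT u:{0<..}. norm (?G u t))
       * norm (?w t)"
      unfolding f_def norm_mult[of "cosh _ * _"] by (rule set_integral_mult_left)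
    also have "\<dots> \<le> exp ((norm (2 * z))\<^sup>2 / 2) * (sqrt pi / (2 * sqrt (2 + t - 1 / 2))) * norm (?w t)"
      using t by (intro mult_right_mono norm_Gaussian_cosh_integral_le) auto
    also have "\<dots> \<le> exp ((norm (2 * z))\<^sup>2 / 2) * (sqrt pi / (2 * sqrt (1 + t))) * norm (?w t)"
      using t by (intro mult_right_mono mult_left_mono divide_left_mono mult_pos_pos) auto
    also have "\<dots> = ?C * (norm (?w t) * norm (complex_of_real (1 / sqrt (1 + t))))"
      using t by (simp add: norm_divide)
    also have "\<dots> = ?C * norm (?T t)"
      unfolding tri[OF t] by (simp only: norm_mult)
    finally show ?thesis .
  qed
  have outer: "set_integrable lborel {0<..} (\<lambda>t. ?C * norm (?T t))"
    using set_integrable_norm[OF Beta_prime_integral(1)[of "1 / 2" \<nu>]] \<nu> by simp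
  note swap = set_integral_swap_lborel(3)[OF open_greaterThan open_greaterThan cont inner outer bound]
  have "(LBINT u:{0<..}. ?E u * ?K u)
      = (LBINT u:{0<..}. LBINT t:{0<..}. f u t)"
  proof (intro set_lebesgue_integral_cong allI impI)
    fix u :: real
    have "(LBINT t:{0<..}. f u t) = (LBINT t:{0<..}. (?E u) * tricomi_integrand (1 / 2) (- \<nu>) ((of_real u)\<^sup>2) t)"
    proof (intro set_lebesgue_integral_cong allI impI)
      fix t :: real
      have "exp (- (of_real (2 + t) * of_real (u\<^sup>2))) = exp (- 2 * (of_real u)\<^sup>2) * (exp (- ((of_real u)\<^sup>2 * of_real t)) :: complex)"
        by (simp add: exp_add[symmetric] algebra_simps)
      then show "f u t = (?E u) * tricomi_integrand (1 / 2) (- \<nu>) ((of_real u)\<^sup>2) t"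
        unfolding f_def tricomi_integrand_def by (simp only: mult.assoc)
    qed auto
    also have "\<dots> = (?E u) * ?K u"
      unfolding tricomi_integral_def by (rule set_integral_mult_right)
    finally show "?E u * ?K u
      = (LBINT t:{0<..}. f u t)" by simp
  qed auto
  also have "\<dots> = (LBINT t:{0<..}. LBINT u:{0<..}. f u t)" by (rule swap)
  also have "\<dots> = (LBINT t:{0<..}. of_real (sqrt pi / 2) * (?w t
         * of_real (1 / sqrt (2 + t)) * exp (z\<^sup>2 / of_real (2 + t))))"
  proof (intro set_lebesgue_integral_cong allI impI)
    fix t :: real assume "t \<in> {0<..}"
    then have t: "2 + t > 0" by simp
    have "(LBINT u:{0<..}. f u t) = (LBINT u:{0<..}. ?G u t) * (?w t)"
      unfolding f_def by (rule set_integral_mult_left)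
    also have "(LBINT u:{0<..}. ?G u t) = of_real (sqrt pi / (2 * sqrt (2 + t))) * exp ((2 * z)\<^sup>2 / (4 * of_real (2 + t)))"
      by (rule has_Gaussian_cosh_integral(2)[OF t])
    also have "(2 * z)\<^sup>2 / (4 * of_real (2 + t)) = z\<^sup>2 / of_real (2 + t)" by (simp add: power_mult_distrib del: of_real_add)
    also have "sqrt pi / (2 * sqrt (2 + t)) = sqrt pi / 2 * (1 / sqrt (2 + t))" by simp
    finally show "(LBINT u:{0<..}. f u t) = of_real (sqrt pi / 2) * (?w t
         * of_real (1 / sqrt (2 + t)) * exp (z\<^sup>2 / of_real (2 + t)))"
      unfolding of_real_mult[of "sqrt pi / 2"] by (simp only: mult_ac)
  qed auto
  finally show ?thesis unfolding set_integral_mult_right .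
qed

text \<open>Inserting Euler's integral for Kummer's function makes the integral over x a Gaussian
  one of rate 2 - s, with the cosine written as \<open>cosh\<close> of an imaginary argument. As s <
  1, the lowered rate 2 - s - 1/2 exceeds 1/2, which gives the uniform constant
  \<open>?C\<close>.\<close>

lemma cos_kummer_Phi_Fubini:
  fixes \<nu> z :: complex
  assumes \<nu>: "Re \<nu> > 0"
  defines "K \<equiv> \<lambda>x::real. cos (2 * z * of_real x) * exp (- 2 * (of_real x)\<^sup>2) * kummer_Phi (1 / 2) (\<nu> + 1 / 2) ((of_real x)\<^sup>2)"
  shows "set_integrable lborel {0<..} K"
    and "Beta (1 / 2) \<nu> * (LBINT x:{0<..}. K x)
    = of_real (sqrt pi / 2) * (LBINT s:{0<..<1}. of_real s powr (1 / 2 - 1) * of_real (1 - s) powr (\<nu> - 1)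
         * of_real (1 / sqrt (2 - s)) * exp (- (z\<^sup>2 / of_real (2 - s))))"
proof -
  let ?w = "\<lambda>s::real. of_real s powr (1 / 2 - 1) * of_real (1 - s) powr (\<nu> - 1) :: complex"
  let ?G = "\<lambda>x s::real. cosh (2 * \<i> * z * of_real x) * exp (- (of_real (2 - s) * of_real (x\<^sup>2))) :: complex"
  let ?E = "\<lambda>x::real. cos (2 * z * of_real x) * exp (- 2 * (of_real x)\<^sup>2) :: complex"
  define f :: "real \<Rightarrow> real \<Rightarrow> complex" where
    "f x s = ?G x s * (?w s)" for x s
  let ?C = "exp ((norm (2 * \<i> * z))\<^sup>2 / 2) * (sqrt pi / (2 * sqrt (1 / 2)))"
  have half: "Re (1 / 2) > 0" by simp
  have cont: "continuous_on ({0<..} \<times> {0<..<1}) (\<lambda>(x, s). f x s)"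
    unfolding f_def case_prod_unfold cosh_field_def by (intro continuous_intros) (auto simp del: of_real_diff)
  have inner: "set_integrable lborel {0<..} (\<lambda>x. f x s)" if "s \<in> {0<..<1}" for s
    unfolding f_def by (intro set_integrable_mult_left has_Gaussian_cosh_integral(1)) (use that in auto)
  have bound: "(LBINT x:{0<..}. norm (f x s)) \<le> ?C * norm (?w s)" if "s \<in> {0<..<1}" for s
  proof -
    have "(LBINT x:{0<..}. norm (f x s)) = (LBINT x:{0<..}. norm (?G x s))
       * norm (?w s)"
      unfolding f_def norm_mult[of "cosh _ * _"] by (rule set_integral_mult_left)
    also have "\<dots> \<le> exp ((norm (2 * \<i> * z))\<^sup>2 / 2) * (sqrt pi / (2 * sqrt (2 - s - 1 / 2))) * norm (?w s)"
      using that by (intro mult_right_mono norm_Gaussian_cosh_integral_le) auto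
    also have "\<dots> \<le> ?C * norm (?w s)"
      using that by (intro mult_right_mono mult_left_mono divide_left_mono mult_pos_pos real_sqrt_le_mono) auto
    finally show ?thesis .
  qed
  have outer: "set_integrable lborel {0<..<1} (\<lambda>s. ?C * norm (?w s))"
    using set_integrable_norm[OF has_Beta_integral_complex(1)[OF half \<nu>]] by simp
  note swap = set_integral_swap_lborel[OF open_greaterThan open_greaterThanLessThan cont inner outer bound]
  have cs: "cosh (2 * \<i> * z * of_real x) = cos (2 * z * of_real x)" for x :: real
  proof -
    have "\<i> * (2 * \<i> * z * of_real x) = (\<i> * \<i>) * (2 * z * of_real x)" by (simp only: mult_ac)
    then show ?thesis unfolding cosh_conv_cos by (simp only:) simp
  qed
  have fK: "(LBINT s:{0<..<1}. f x s) = Beta (1 / 2) \<nu> * K x" for x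
  proof -
    have "(LBINT s:{0<..<1}. f x s) = (LBINT s:{0<..<1}. (?E x) * (exp ((of_real x)\<^sup>2 * of_real s) * (?w s)))"
    proof (intro set_lebesgue_integral_cong allI impI)
      fix s :: real
      have "exp (- (of_real (2 - s) * of_real (x\<^sup>2))) = exp (- 2 * (of_real x)\<^sup>2) * (exp ((of_real x)\<^sup>2 * of_real s) :: complex)"
        by (simp add: exp_add[symmetric] algebra_simps)
      then show "f x s = (?E x) * (exp ((of_real x)\<^sup>2 * of_real s) * (?w s))"
        unfolding f_def cs by (simp only: mult.assoc)
    qed auto
    also have "\<dots> = (?E x) * (LBINT s:{0<..<1}. exp ((of_real x)\<^sup>2 * of_real s) * (?w s))"
      by (rule set_integral_mult_right)
    also have "(LBINT s:{0<..<1}. exp ((of_real x)\<^sup>2 * of_real s) * (?w s))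
       = Beta (1 / 2) \<nu> * kummer_Phi (1 / 2) (1 / 2 + \<nu>) ((of_real x)\<^sup>2)"
      by (rule kummer_Phi_integral(2)[OF half \<nu>])
    finally show ?thesis by (simp add: K_def add.commute mult_ac)
  qed
  have nz: "Beta (1 / 2) \<nu> \<noteq> 0" using Beta_half_nonzero[OF \<nu>] by (simp add: Beta_commute)
  show "set_integrable lborel {0<..} K"
    using swap(1) nz unfolding fK by simp
  have "Beta (1 / 2) \<nu> * (LBINT x:{0<..}. K x) = (LBINT x:{0<..}. LBINT s:{0<..<1}. f x s)"
    unfolding fK by simp
  also have "\<dots> = (LBINT s:{0<..<1}. LBINT x:{0<..}. f x s)" by (rule swap(3))
  also have "\<dots> = (LBINT s:{0<..<1}. of_real (sqrt pi / 2) * (?w s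
         * of_real (1 / sqrt (2 - s)) * exp (- (z\<^sup>2 / of_real (2 - s)))))"
  proof (intro set_lebesgue_integral_cong allI impI)
    fix s :: real assume "s \<in> {0<..<1}"
    then have s: "2 - s > 0" by simp
    have "(LBINT x:{0<..}. f x s) = (LBINT x:{0<..}. ?G x s) * (?w s)"
      unfolding f_def by (rule set_integral_mult_left)
    also have "(LBINT x:{0<..}. ?G x s) = of_real (sqrt pi / (2 * sqrt (2 - s))) * exp ((2 * \<i> * z)\<^sup>2 / (4 * of_real (2 - s)))"
      by (rule has_Gaussian_cosh_integral(2)[OF s])
    also have "(2 * \<i> * z)\<^sup>2 / (4 * of_real (2 - s)) = - (z\<^sup>2 / of_real (2 - s))" by (simp add: power_mult_distrib del: of_real_diff)
    also have "sqrt pi / (2 * sqrt (2 - s)) = sqrt pi / 2 * (1 / sqrt (2 - s))" by simp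
    finally show "(LBINT x:{0<..}. f x s) = of_real (sqrt pi / 2) * (?w s
         * of_real (1 / sqrt (2 - s)) * exp (- (z\<^sup>2 / of_real (2 - s))))"
      unfolding of_real_mult[of "sqrt pi / 2"] by (simp only: mult_ac)
  qed auto
  finally show "Beta (1 / 2) \<nu> * (LBINT x:{0<..}. K x)
    = of_real (sqrt pi / 2) * (LBINT s:{0<..<1}. ?w s
         * of_real (1 / sqrt (2 - s)) * exp (- (z\<^sup>2 / of_real (2 - s))))"
    unfolding set_integral_mult_right .
qed

text \<open>Under s = t/(1+t) the powers of 1 + t have the exponents -2 from the Jacobian, 1/2 from
  s, 1 - \<open>\<nu>\<close> from 1 - s and 1/2 from the square root; their sum is
  -\<open>\<nu>\<close>.\<close>

lemma Fubini_integrals_agree: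
  fixes \<nu> z :: complex
  shows "(LBINT s:{0<..<1}. of_real s powr (1 / 2 - 1) * of_real (1 - s) powr (\<nu> - 1)
         * of_real (1 / sqrt (2 - s)) * exp (- (z\<^sup>2 / of_real (2 - s))))
     = exp (- z\<^sup>2) * (LBINT t:{0<..}. of_real t powr (1 / 2 - 1) * of_real (1 + t) powr (- \<nu>)
         * of_real (1 / sqrt (2 + t)) * exp (z\<^sup>2 / of_real (2 + t)))"
proof -
  let ?f = "\<lambda>s::real. of_real s powr (1 / 2 - 1) * of_real (1 - s) powr (\<nu> - 1)
         * of_real (1 / sqrt (2 - s)) * exp (- (z\<^sup>2 / of_real (2 - s))) :: complex"
  let ?k = "\<lambda>t::real. of_real t powr (1 / 2 - 1) * of_real (1 + t) powr (- \<nu>)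
         * of_real (1 / sqrt (2 + t)) * exp (z\<^sup>2 / of_real (2 + t)) :: complex"
  have contf: "continuous_on {0<..<1} ?f" by (intro continuous_intros) (auto simp del: of_real_diff)
  have eq: "of_real (1 / (1 + t)\<^sup>2) * ?f (t / (1 + t)) = exp (- z\<^sup>2) * ?k t" if "t \<in> {0<..}" for t
  proof -
    have t: "t > 0" using that by simp
    let ?u = "of_real (1 + t) :: complex"
    have u: "?u \<noteq> 0" using t by (simp del: of_real_add)
    have u2: "of_real (2 + t) \<noteq> (0 :: complex)" using t by (simp del: of_real_add)
    have inv: "of_real (inverse (1 + t)) powr s = ?u powr (- s)" for s :: complex
      using t by (simp add: powr_def Ln_inverse Ln_of_real del: of_real_add)
    have "of_real (t * inverse (1 + t)) powr (1 / 2 - 1) = (of_real t powr (1 / 2 - 1) * of_real (inverse (1 + t)) powr (1 / 2 - 1) :: complex)"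
      using t unfolding of_real_mult by (intro powr_times_real) auto
    then have 1: "of_real ((t / (1 + t))) powr (1 / 2 - 1) = of_real t powr (1 / 2 - 1) * ?u powr (- (1 / 2 - 1))"
      unfolding inv divide_inverse[of t] .
    have "1 - t / (1 + t) = inverse (1 + t)" using t by (simp add: field_simps)
    then have 2: "of_real (1 - t / (1 + t)) powr (\<nu> - 1) = ?u powr (- (\<nu> - 1))"
      unfolding inv[symmetric] by simp
    have d: "2 - t / (1 + t) = (2 + t) / (1 + t)" using t by (simp add: field_simps)
    have 3: "complex_of_real (1 / sqrt (2 - t / (1 + t))) = ?u powr (1 / 2) * of_real (1 / sqrt (2 + t))"
    proof -
      have "?u powr (1 / 2) = of_real (sqrt (1 + t))"
        using t powr_of_real[of "1 + t" "1 / 2"] by (simp add: powr_half_sqrt del: of_real_add)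
      moreover have "1 / sqrt (2 - t / (1 + t)) = sqrt (1 + t) * (1 / sqrt (2 + t))"
        unfolding d by (simp add: real_sqrt_divide)
      ultimately show ?thesis by (simp only: of_real_mult)
    qed
    have 4: "exp (- (z\<^sup>2 / of_real (2 - t / (1 + t)))) = exp (- z\<^sup>2) * exp (z\<^sup>2 / of_real (2 + t))"
    proof -
      have "?u = of_real (2 + t) - 1" by simp
      then have "z\<^sup>2 / of_real (2 - t / (1 + t)) = z\<^sup>2 * (of_real (2 + t) - 1) / of_real (2 + t)"
        unfolding d of_real_divide by (simp only: divide_divide_eq_right)
      also have "\<dots> = z\<^sup>2 - z\<^sup>2 / of_real (2 + t)"
        using u2 by (simp add: right_diff_distrib diff_divide_distrib del: of_real_add)
      finally show ?thesis unfolding exp_add[symmetric] by simp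
    qed
    have 5: "complex_of_real (1 / (1 + t)\<^sup>2) = ?u powr (- 2)"
      using u by (simp add: powr_minus divide_inverse)
    have "?u powr (- 2) * ?u powr (- (1 / 2 - 1)) * ?u powr (- (\<nu> - 1)) * ?u powr (1 / 2)
        = ?u powr (- 2 + - (1 / 2 - 1) + - (\<nu> - 1) + 1 / 2)"
      unfolding powr_add by simp
    also have "- 2 + - (1 / 2 - 1) + - (\<nu> - 1) + 1 / 2 = - \<nu>" by simp
    finally have 6: "?u powr (- 2) * ?u powr (- (1 / 2 - 1)) * ?u powr (- (\<nu> - 1)) * ?u powr (1 / 2) = ?u powr (- \<nu>)" .
    have rearrange: "a * ((x * b) * c * (d * y) * (e * w)) = e * (x * (a * b * c * d) * y * w)"
      for a b c d e x y w :: complex by (simp add: mult_ac)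
    show ?thesis
      unfolding 1 2 3 4 5 rearrange 6 ..
  qed
  have "(LBINT s:{0<..<1}. ?f s) = (LBINT t:{0<..}. of_real (1 / (1 + t)\<^sup>2) * ?f (t / (1 + t)))"
    by (rule set_integral_rational_substitution(2)[OF contf])
  also have "\<dots> = (LBINT t:{0<..}. exp (- z\<^sup>2) * ?k t)"
    by (intro set_lebesgue_integral_cong) (use eq in auto)
  also have "\<dots> = exp (- z\<^sup>2) * (LBINT t:{0<..}. ?k t)" by (rule set_integral_mult_right)
  finally show ?thesis .
qed

section \<open>From cylinder integrals to the three identities\<close>

text \<open>The condition on \<open>w\<close> covers both products at once, w = z and w = -z: the
  two factors e^(z^2/4) and e^(w^2/4) combine to e^(z^2/2).\<close>

lemma parabolic_cylinder_D_mult: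
  assumes "Re \<nu> > 0" "w\<^sup>2 = z\<^sup>2"
  shows "exp (z\<^sup>2 / 2) * (parabolic_cylinder_D (- \<nu>) z * parabolic_cylinder_D (- \<nu>) w)
     = cylinder_integral \<nu> z * cylinder_integral \<nu> w / (Gamma \<nu>)\<^sup>2"
proof -
  have nz: "Gamma \<nu> \<noteq> 0" using assms(1) by (rule Gamma_Re_pos_nonzero)
  have "exp (z\<^sup>2 / 2) = exp (z\<^sup>2 / 4) * exp (w\<^sup>2 / 4)"
    unfolding exp_add[symmetric] assms(2) by simp
  then show ?thesis
    unfolding parabolic_cylinder_D_integral[OF assms(1), symmetric]
    using nz by (simp add: power2_eq_square field_simps)
qed

lemma parabolic_cylinder_D_square:
  assumes \<nu>: "Re \<nu> > 0"
  shows "exp (z\<^sup>2 / 2) * (parabolic_cylinder_D (- \<nu>) z)\<^sup>2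
    = 2 powr (2 * \<nu>) / Gamma (2 * \<nu>) * (LBINT x:{0<..}.
        complex_of_real x powr (2 * \<nu> - 1) * exp (- 2 * z * complex_of_real x - 2 * (complex_of_real x)\<^sup>2)
        * kummer_Phi \<nu> (\<nu> + 1 / 2) ((complex_of_real x)\<^sup>2))"
proof -
  \<comment> \<open>The left side is 2 sqrt(pi) / (Gamma(\<open>\<nu>\<close>)
    Gamma(\<open>\<nu> + 1 / 2\<close>)), which the duplication formula rewrites.\<close>
  have C: "2 * Beta \<nu> (1 / 2) / (Gamma \<nu>)\<^sup>2 = 2 powr (2 * \<nu>) / Gamma (2 * \<nu>)"
  proof -
    have nz: "Gamma \<nu> \<noteq> 0" "Gamma (\<nu> + 1 / 2) \<noteq> 0" "Gamma (2 * \<nu>) \<noteq> 0"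
      using \<nu> by (auto intro!: Gamma_Re_pos_nonzero)
    have dup: "Gamma \<nu> * Gamma (\<nu> + 1 / 2) = 2 powr (1 - 2 * \<nu>) * of_real (sqrt pi) * Gamma (2 * \<nu>)"
      using two_powr_Gamma_duplication[of "2 * \<nu>"] \<nu> by simp
    have two: "2 powr (2 * \<nu>) * 2 powr (1 - 2 * \<nu>) = (2 :: complex)"
      by (simp add: powr_add[symmetric])
    have "2 powr (2 * \<nu>) * (Gamma \<nu> * Gamma (\<nu> + 1 / 2)) = (2 powr (2 * \<nu>) * 2 powr (1 - 2 * \<nu>)) * (of_real (sqrt pi) * Gamma (2 * \<nu>))"
      unfolding dup by (simp only: mult.assoc)
    then have "2 powr (2 * \<nu>) * (Gamma \<nu> * Gamma (\<nu> + 1 / 2)) = 2 * (of_real (sqrt pi) * Gamma (2 * \<nu>))"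
      unfolding two .
    then show ?thesis
      using nz by (simp add: Beta_def Gamma_one_half_complex power2_eq_square field_simps)
  qed
  have "exp (z\<^sup>2 / 2) * (parabolic_cylinder_D (- \<nu>) z)\<^sup>2 = (cylinder_integral \<nu> z)\<^sup>2 / (Gamma \<nu>)\<^sup>2"
    using parabolic_cylinder_D_mult[OF \<nu> refl, of z] unfolding power2_eq_square .
  also have "\<dots> = 2 * Beta \<nu> (1 / 2) / (Gamma \<nu>)\<^sup>2 * (LBINT x:{0<..}.
        complex_of_real x powr (2 * \<nu> - 1) * exp (- 2 * z * complex_of_real x - 2 * (complex_of_real x)\<^sup>2)
        * kummer_Phi \<nu> (\<nu> + 1 / 2) ((complex_of_real x)\<^sup>2))"
    unfolding cylinder_integral_square(2)[OF \<nu>] by (simp only: times_divide_eq_left)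
  finally show ?thesis unfolding C .
qed

lemma cylinder_integrand_kummer_Psi:
  assumes \<nu>: "Re \<nu> > 0" and x: "x \<in> {0<..}"
  shows "cosh (2 * z * complex_of_real x) * complex_of_real x powr (2 * \<nu> - 1) * exp (- 2 * (complex_of_real x)\<^sup>2)
      * tricomi_integral \<nu> (- 1 / 2) ((of_real x)\<^sup>2)
    = Gamma \<nu> * (cosh (2 * z * complex_of_real x) * complex_of_real x powr (2 * \<nu> - 1)
              * exp (- 2 * (complex_of_real x)\<^sup>2) * kummer_Psi \<nu> (\<nu> + 1 / 2) ((complex_of_real x)\<^sup>2))"
proof -
  have "Re ((complex_of_real x)\<^sup>2) > 0" using x unfolding of_real_power[symmetric] Re_complex_of_real by simp
  then have "tricomi_integral \<nu> (\<nu> + 1 / 2 - \<nu> - 1) ((complex_of_real x)\<^sup>2) = Gamma \<nu> * kummer_Psi \<nu> (\<nu> + 1 / 2) ((complex_of_real x)\<^sup>2)"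
    using \<nu> by (intro tricomi_integral_eq_kummer_Psi) auto
  moreover have "\<nu> + 1 / 2 - \<nu> - 1 = - 1 / 2" by simp
  ultimately show ?thesis by (simp only: mult_ac)
qed

text \<open>The product of the two cylinder integrals is divided by
  \<open>(Gamma \<nu>)\<^sup>2\<close>, and the Laplace integral of \<open>kummer_Psi\<close>
  returns one of these factors.\<close>

lemma parabolic_cylinder_D_mult_kummer_Psi:
  fixes \<nu> z :: complex
  assumes \<nu>: "Re \<nu> > 0"
  defines "K \<equiv> \<lambda>x. cosh (2 * z * complex_of_real x) * complex_of_real x powr (2 * \<nu> - 1)
              * exp (- 2 * (complex_of_real x)\<^sup>2) * kummer_Psi \<nu> (\<nu> + 1 / 2) ((complex_of_real x)\<^sup>2)"
  shows "set_integrable lborel {0<..} K"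
    and "exp (z\<^sup>2 / 2) * parabolic_cylinder_D (- \<nu>) z * parabolic_cylinder_D (- \<nu>) (- z)
            = 2 / Gamma \<nu> * (LBINT x:{0<..}. K x)"
proof -
  have nz: "Gamma \<nu> \<noteq> 0" using \<nu> by (rule Gamma_Re_pos_nonzero)
  have eq: "cosh (2 * z * complex_of_real x) * complex_of_real x powr (2 * \<nu> - 1) * exp (- 2 * (complex_of_real x)\<^sup>2)
      * tricomi_integral \<nu> (- 1 / 2) ((of_real x)\<^sup>2) = Gamma \<nu> * K x" if "x \<in> {0<..}" for x
    unfolding K_def by (rule cylinder_integrand_kummer_Psi[OF \<nu> that])
  note J = cylinder_integral_mult_reflected[OF \<nu>, of z]
  have "set_integrable lborel {0<..} (\<lambda>x. Gamma \<nu> * K x)"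
    using J(1) by (subst set_integrable_cong[OF refl refl eq[symmetric]]) auto
  then show "set_integrable lborel {0<..} K" using nz by simp
  have "cylinder_integral \<nu> z * cylinder_integral \<nu> (- z) = 2 * (LBINT x:{0<..}. Gamma \<nu> * K x)"
    unfolding J(2) by (intro arg_cong[where f = "(*) 2"] set_lebesgue_integral_cong) (use eq in auto)
  also have "\<dots> = 2 * (Gamma \<nu> * (LBINT x:{0<..}. K x))"
    by (simp only: set_integral_mult_right)
  finally show "exp (z\<^sup>2 / 2) * parabolic_cylinder_D (- \<nu>) z * parabolic_cylinder_D (- \<nu>) (- z)
            = 2 / Gamma \<nu> * (LBINT x:{0<..}. K x)"
    using parabolic_cylinder_D_mult[OF \<nu>, of "- z" z] nz
    by (simp add: power2_eq_square mult.assoc)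
qed

lemma parabolic_cylinder_D_mult_kummer_Phi:
  fixes \<nu> z :: complex
  assumes \<nu>: "Re \<nu> > 0"
  shows "exp (- (z\<^sup>2 / 2)) * parabolic_cylinder_D (- \<nu>) z * parabolic_cylinder_D (- \<nu>) (- z)
    = 2 / Gamma (\<nu> + 1 / 2) * (LBINT x:{0<..}. cos (2 * z * complex_of_real x) * exp (- 2 * (complex_of_real x)\<^sup>2)
              * kummer_Phi (1 / 2) (\<nu> + 1 / 2) ((complex_of_real x)\<^sup>2))"
proof -
  let ?T = "\<lambda>x::real. tricomi_integral (1 / 2) (- \<nu>) ((of_real x)\<^sup>2)"
  let ?N = "\<lambda>x::real. tricomi_integral \<nu> (- 1 / 2) ((of_real x)\<^sup>2)"
  let ?p = "\<lambda>x::real. of_real (x\<^sup>2) powr (1 / 2 - \<nu>) :: complex"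
  let ?R = "LBINT t:{0<..}. of_real t powr (1 / 2 - 1) * of_real (1 + t) powr (- \<nu>)
         * of_real (1 / sqrt (2 + t)) * exp (z\<^sup>2 / of_real (2 + t)) :: complex"
  let ?L = "LBINT x:{0<..}. cos (2 * z * complex_of_real x) * exp (- 2 * (complex_of_real x)\<^sup>2)
              * kummer_Phi (1 / 2) (\<nu> + 1 / 2) ((complex_of_real x)\<^sup>2)"
  let ?D = "parabolic_cylinder_D (- \<nu>) z * parabolic_cylinder_D (- \<nu>) (- z)"
  have nz: "Gamma \<nu> \<noteq> 0" "Gamma (\<nu> + 1 / 2) \<noteq> 0"
    using \<nu> by (auto intro!: Gamma_Re_pos_nonzero)
  have half: "Re (1 / 2) > 0" by simp
  have s: "complex_of_real (sqrt pi) \<noteq> 0" by simp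
  have "cosh (2 * z * of_real x) * of_real x powr (2 * \<nu> - 1) * exp (- 2 * (of_real x)\<^sup>2)
      * ?N x
    = Gamma \<nu> / of_real (sqrt pi) * (cosh (2 * z * of_real x) * exp (- 2 * (of_real x)\<^sup>2) * ?T x)"
    if "x > 0" for x :: real
  proof -
    have "Gamma (1 / 2) * tricomi_integral \<nu> (- (1 / 2)) (of_real (x\<^sup>2))
        = Gamma \<nu> * (?p x * tricomi_integral (1 / 2) (- \<nu>) (of_real (x\<^sup>2)))"
      using that by (intro tricomi_integral_symmetry[OF \<nu> half]) simp
    then have sym: "of_real (sqrt pi) * ?N x
        = Gamma \<nu> * (?p x * ?T x)"
      by (simp add: Gamma_one_half_complex)
    \<comment> \<open>The power of x^2 left by Kummer's transformation is exactly the inverse of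
      x^(2 \<open>\<nu>\<close> - 1), so no power of x survives in the integrand.\<close>
    have "?p x = (of_real x powr (1 / 2 - \<nu>) * of_real x powr (1 / 2 - \<nu>) :: complex)"
      unfolding power2_eq_square of_real_mult using that by (intro powr_times_real) auto
    also have "\<dots> = of_real x powr (1 - 2 * \<nu>)"
      by (simp add: powr_add[symmetric])
    finally have "of_real x powr (2 * \<nu> - 1) * ?p x = (of_real x powr (2 * \<nu> - 1 + (1 - 2 * \<nu>)) :: complex)"
      by (simp only: powr_add)
    also have "\<dots> = 1" using that by simp
    finally have p: "of_real x powr (2 * \<nu> - 1) * ?p x = (1 :: complex)" .
    have "of_real x powr (2 * \<nu> - 1) * (of_real (sqrt pi) * ?N x)
        = (of_real x powr (2 * \<nu> - 1) * ?p x) * (Gamma \<nu> * ?T x)"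
      unfolding sym by (simp only: mult_ac)
    then have "of_real x powr (2 * \<nu> - 1) * ?N x
        = Gamma \<nu> / of_real (sqrt pi) * ?T x"
      unfolding p using s by (simp add: field_simps)
    moreover have "c * p * e * t = c * e * (p * t)" "g * (c * e * k) = c * e * (g * k)" for c p e t g k :: complex
      by (simp_all only: mult_ac)
    ultimately show ?thesis by (simp only:)
  qed
  then have "(LBINT x:{0<..}. cosh (2 * z * of_real x) * of_real x powr (2 * \<nu> - 1) * exp (- 2 * (of_real x)\<^sup>2)
      * ?N x)
    = (LBINT x:{0<..}. Gamma \<nu> / of_real (sqrt pi) * (cosh (2 * z * of_real x) * exp (- 2 * (of_real x)\<^sup>2) * ?T x))"
    by (intro set_lebesgue_integral_cong) auto
  also have "\<dots> = Gamma \<nu> / of_real (sqrt pi) * (of_real (sqrt pi / 2) * ?R)"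
    unfolding set_integral_mult_right cylinder_product_Fubini[OF \<nu>] ..
  also have "\<dots> = Gamma \<nu> / 2 * ?R" using s by simp
  finally have "cylinder_integral \<nu> z * cylinder_integral \<nu> (- z) = 2 * (Gamma \<nu> / 2 * ?R)"
    unfolding cylinder_integral_mult_reflected(2)[OF \<nu>] by (simp only:)
  then have "cylinder_integral \<nu> z * cylinder_integral \<nu> (- z) = Gamma \<nu> * ?R" by simp
  \<comment> \<open>The mixture \<open>?R\<close> is the common term: it gives the product of
    cylinder functions here, and the cosine integral \<open>?L\<close> below up to e^(-z^2) and
    Gamma factors.\<close>
  then have D: "exp (z\<^sup>2 / 2) * ?D = ?R / Gamma \<nu>"
    using parabolic_cylinder_D_mult[OF \<nu>, of "- z" z] nz by (simp add: power2_eq_square)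
  have "Beta (1 / 2) \<nu> * ?L = of_real (sqrt pi / 2) * (exp (- z\<^sup>2) * ?R)"
    unfolding cos_kummer_Phi_Fubini(2)[OF \<nu>] Fubini_integrals_agree ..
  also have "Beta (1 / 2) \<nu> = of_real (sqrt pi) * (Gamma \<nu> / Gamma (\<nu> + 1 / 2))"
    by (simp add: Beta_def Gamma_one_half_complex add.commute)
  also have "of_real (sqrt pi / 2) * (exp (- z\<^sup>2) * ?R) = of_real (sqrt pi) / 2 * (exp (- z\<^sup>2) * ?R)"
    by simp
  finally have E: "of_real (sqrt pi) * (Gamma \<nu> / Gamma (\<nu> + 1 / 2)) * ?L = of_real (sqrt pi) / 2 * (exp (- z\<^sup>2) * ?R)" .
  have double: "p * (g * (2 / h * l)) = p * y" if "p * (g / h) * l = p / 2 * y" for p g h l y :: complex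
  proof -
    have "p * (g * (2 / h * l)) = 2 * (p * (g / h) * l)" by simp
    also have "\<dots> = p * y" unfolding that by simp
    finally show ?thesis .
  qed
  have "of_real (sqrt pi) * (Gamma \<nu> * (2 / Gamma (\<nu> + 1 / 2) * ?L)) = of_real (sqrt pi) * (exp (- z\<^sup>2) * ?R)"
    by (rule double[OF E])
  then have L: "Gamma \<nu> * (2 / Gamma (\<nu> + 1 / 2) * ?L) = exp (- z\<^sup>2) * ?R"
    using s by (simp only: mult_cancel_left simp_thms)
  \<comment> \<open>The factor e^(-z^2) of the cosine integral turns e^(z^2/2) into
    e^(-z^2/2).\<close>
  have "exp (- (z\<^sup>2 / 2)) * ?D = exp (- z\<^sup>2) * (exp (z\<^sup>2 / 2) * ?D)"
    unfolding mult.assoc[symmetric] exp_add[symmetric] by (simp add: field_simps)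
  also have "\<dots> = 2 / Gamma (\<nu> + 1 / 2) * ?L"
    unfolding D using L nz(1) by (simp add: field_simps)
  finally show ?thesis by (simp only: mult.assoc)
qed

text \<open>Integrability is claimed along with each identity, because the integral of a function
  that is not integrable is 0 by convention.\<close>

theorem theorem3:
  fixes \<nu> z :: complex
  assumes "Re \<nu> > 0"
  shows "(set_integrable lborel {0<..} (\<lambda>x.
              complex_of_real x powr (2 * \<nu> - 1) * exp (- 2 * z * complex_of_real x - 2 * (complex_of_real x)\<^sup>2)
              * kummer_Phi \<nu> (\<nu> + 1 / 2) ((complex_of_real x)\<^sup>2)) \<and>
          exp (z\<^sup>2 / 2) * (parabolic_cylinder_D (- \<nu>) z)\<^sup>2
            = 2 powr (2 * \<nu>) / Gamma (2 * \<nu>) * (LBINT x:{0<..}.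
              complex_of_real x powr (2 * \<nu> - 1) * exp (- 2 * z * complex_of_real x - 2 * (complex_of_real x)\<^sup>2)
              * kummer_Phi \<nu> (\<nu> + 1 / 2) ((complex_of_real x)\<^sup>2))) \<and>
         (set_integrable lborel {0<..} (\<lambda>x.
              cosh (2 * z * complex_of_real x) * complex_of_real x powr (2 * \<nu> - 1)
              * exp (- 2 * (complex_of_real x)\<^sup>2) * kummer_Psi \<nu> (\<nu> + 1 / 2) ((complex_of_real x)\<^sup>2)) \<and>
          exp (z\<^sup>2 / 2) * parabolic_cylinder_D (- \<nu>) z * parabolic_cylinder_D (- \<nu>) (- z)
            = 2 / Gamma \<nu> * (LBINT x:{0<..}.
              cosh (2 * z * complex_of_real x) * complex_of_real x powr (2 * \<nu> - 1)
              * exp (- 2 * (complex_of_real x)\<^sup>2) * kummer_Psi \<nu> (\<nu> + 1 / 2) ((complex_of_real x)\<^sup>2))) \<and>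
         (set_integrable lborel {0<..} (\<lambda>x.
              cos (2 * z * complex_of_real x) * exp (- 2 * (complex_of_real x)\<^sup>2)
              * kummer_Phi (1 / 2) (\<nu> + 1 / 2) ((complex_of_real x)\<^sup>2)) \<and>
          exp (- (z\<^sup>2 / 2)) * parabolic_cylinder_D (- \<nu>) z * parabolic_cylinder_D (- \<nu>) (- z)
            = 2 / Gamma (\<nu> + 1 / 2) * (LBINT x:{0<..}.
              cos (2 * z * complex_of_real x) * exp (- 2 * (complex_of_real x)\<^sup>2)
              * kummer_Phi (1 / 2) (\<nu> + 1 / 2) ((complex_of_real x)\<^sup>2)))"
  by (intro conjI cylinder_integral_square(1) parabolic_cylinder_D_square
      parabolic_cylinder_D_mult_kummer_Psi cos_kummer_Phi_Fubini(1)
      parabolic_cylinder_D_mult_kummer_Phi assms)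

end
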